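(* Let $d\ge2$ and let $\Omega\subset\mathbb R^d$ be a bounded open connected set with Lipschitz boundary. Let $A^N$ and $A^D$ be the Neumann Stokes operator and the Dirichlet Stokes operator on $\Omega$, and let $\lambda_1^N\le\lambda_2^N\le\dots$ and $\lambda_1^D\le\lambda_2^D\le\dots$ be their eigenvalues repeated with multiplicity. Then $\lambda_{n+1}^N<\lambda_n^D$ for all $n\in\mathbb N$.
   Context: $V=\{u\in H^1(\Omega,\mathbb C^d):\operatorname{div}u=0\}$, $V_D=\{u\in H^1_0(\Omega,\mathbb C^d):\operatorname{div}u=0\}$, $\mathfrak a(u,v)=\int_\Omega\nabla u\cdot\overline{\nabla v}=\sum_{k,l}\int_\Omega\partial_ku_l\overline{\partial_kv_l}$. The Neumann Stokes operator $A^N$ is the self-adjoint operator in the closure $\overline V$ of $V$ in $L_2(\Omega,\mathbb C^d)$ associated with $\mathfrak a$: $u\in D(A^N)$, $A^Nu=f$ iff $u\in V$, $f\in\overline V$ and $\mathfrak a(u,v)=(f,v)_{L_2}$ for all $v\in V$. The Dirichlet Stokes operator $A^D$ is defined in the same way with $V_D$ in place of $V$. Both have compact resolvent. *)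

theory Defs
  imports "HOL-Analysis.Analysis"
begin

coinductive smooth_fun :: "('a::euclidean_space \<Rightarrow> real) \<Rightarrow> bool" where
  "(\<forall>x. f differentiable (at x)) \<Longrightarrow>
   (\<forall>b\<in>Basis. smooth_fun (\<lambda>x. frechet_derivative f (at x) b)) \<Longrightarrow> smooth_fun f"

definition test_fun :: "'a::euclidean_space set \<Rightarrow> ('a \<Rightarrow> real) \<Rightarrow> bool" where
  "test_fun \<Omega> \<phi> \<longleftrightarrow> smooth_fun \<phi> \<and> compact (closure {x. \<phi> x \<noteq> 0})
      \<and> closure {x. \<phi> x \<noteq> 0} \<subseteq> \<Omega>"

definition pderiv_cl :: "'d::finite \<Rightarrow> (real^'d \<Rightarrow> real) \<Rightarrow> real^'d \<Rightarrow> real" where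
  "pderiv_cl k \<phi> x = frechet_derivative \<phi> (at x) (axis k 1)"

definition L2 :: "(real^'d::finite) set \<Rightarrow> (real^'d \<Rightarrow> 'b::euclidean_space) \<Rightarrow> bool" where
  "L2 \<Omega> f \<longleftrightarrow> f \<in> borel_measurable (lebesgue_on \<Omega>)
      \<and> integrable (lebesgue_on \<Omega>) (\<lambda>x. (norm (f x))^2)"

definition is_weak_deriv :: "(real^'d::finite) set \<Rightarrow> 'd \<Rightarrow> (real^'d \<Rightarrow> complex) \<Rightarrow> (real^'d \<Rightarrow> complex) \<Rightarrow> bool" where
  "is_weak_deriv \<Omega> k f g \<longleftrightarrow> (\<forall>\<phi>. test_fun \<Omega> \<phi> \<longrightarrow>
      integral\<^sup>L (lebesgue_on \<Omega>) (\<lambda>x. f x * complex_of_real (pderiv_cl k \<phi> x))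
      = - integral\<^sup>L (lebesgue_on \<Omega>) (\<lambda>x. g x * complex_of_real (\<phi> x)))"

definition H1 :: "(real^'d::finite) set \<Rightarrow> (real^'d \<Rightarrow> complex^'d) \<Rightarrow> bool" where
  "H1 \<Omega> u \<longleftrightarrow> L2 \<Omega> u \<and> (\<forall>k l. \<exists>g. L2 \<Omega> g \<and> is_weak_deriv \<Omega> k (\<lambda>x. u x $ l) g)"

text \<open>The weak derivative d_k u_l (unique up to null sets).\<close>
definition wd :: "(real^'d::finite) set \<Rightarrow> 'd \<Rightarrow> 'd \<Rightarrow> (real^'d \<Rightarrow> complex^'d) \<Rightarrow> real^'d \<Rightarrow> complex" where
  "wd \<Omega> k l u = (SOME g. L2 \<Omega> g \<and> is_weak_deriv \<Omega> k (\<lambda>x. u x $ l) g)"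

definition div_free :: "(real^'d::finite) set \<Rightarrow> (real^'d \<Rightarrow> complex^'d) \<Rightarrow> bool" where
  "div_free \<Omega> u \<longleftrightarrow> (AE x in lebesgue_on \<Omega>. (\<Sum>k\<in>UNIV. wd \<Omega> k k u x) = 0)"

definition L2_inner :: "(real^'d::finite) set \<Rightarrow> (real^'d \<Rightarrow> complex^'d) \<Rightarrow> (real^'d \<Rightarrow> complex^'d) \<Rightarrow> complex" where
  "L2_inner \<Omega> u v = integral\<^sup>L (lebesgue_on \<Omega>) (\<lambda>x. \<Sum>l\<in>UNIV. u x $ l * cnj (v x $ l))"

definition stokes_form :: "(real^'d::finite) set \<Rightarrow> (real^'d \<Rightarrow> complex^'d) \<Rightarrow> (real^'d \<Rightarrow> complex^'d) \<Rightarrow> complex" where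
  "stokes_form \<Omega> u v = (\<Sum>k\<in>UNIV. \<Sum>l\<in>UNIV.
      integral\<^sup>L (lebesgue_on \<Omega>) (\<lambda>x. wd \<Omega> k l u x * cnj (wd \<Omega> k l v x)))"

definition h1_norm_sq :: "(real^'d::finite) set \<Rightarrow> (real^'d \<Rightarrow> complex^'d) \<Rightarrow> real" where
  "h1_norm_sq \<Omega> w = integral\<^sup>L (lebesgue_on \<Omega>) (\<lambda>x. (norm (w x))^2)
     + (\<Sum>k\<in>UNIV. \<Sum>l\<in>UNIV. integral\<^sup>L (lebesgue_on \<Omega>) (\<lambda>x. (cmod (wd \<Omega> k l w x))^2))"

definition vec_test_fun :: "(real^'d::finite) set \<Rightarrow> (real^'d \<Rightarrow> complex^'d) \<Rightarrow> bool" where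
  "vec_test_fun \<Omega> \<phi> \<longleftrightarrow> (\<forall>l. test_fun \<Omega> (\<lambda>x. Re (\<phi> x $ l)) \<and> test_fun \<Omega> (\<lambda>x. Im (\<phi> x $ l)))"

definition H10 :: "(real^'d::finite) set \<Rightarrow> (real^'d \<Rightarrow> complex^'d) \<Rightarrow> bool" where
  "H10 \<Omega> u \<longleftrightarrow> H1 \<Omega> u \<and> (\<exists>\<phi>. (\<forall>n. vec_test_fun \<Omega> (\<phi> n))
      \<and> (\<lambda>n. h1_norm_sq \<Omega> (\<lambda>x. \<phi> n x - u x)) \<longlonglongrightarrow> 0)"

definition V_N :: "(real^'d::finite) set \<Rightarrow> (real^'d \<Rightarrow> complex^'d) set" where
  "V_N \<Omega> = {u. H1 \<Omega> u \<and> div_free \<Omega> u}"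

definition V_D :: "(real^'d::finite) set \<Rightarrow> (real^'d \<Rightarrow> complex^'d) set" where
  "V_D \<Omega> = {u. H10 \<Omega> u \<and> div_free \<Omega> u}"

text \<open>u is an eigenfunction datum of the operator associated with a on V for t:
  u in V and a(u,v) = t (u,v) for all v in V (i.e. u in D(A), A u = t u).\<close>
definition is_eigvec :: "(real^'d::finite) set \<Rightarrow> (real^'d \<Rightarrow> complex^'d) set \<Rightarrow> real \<Rightarrow> (real^'d \<Rightarrow> complex^'d) \<Rightarrow> bool" where
  "is_eigvec \<Omega> V t u \<longleftrightarrow> u \<in> V \<and> (\<forall>v\<in>V. stokes_form \<Omega> u v = complex_of_real t * L2_inner \<Omega> u v)"

definition indep_eigvecs :: "(real^'d::finite) set \<Rightarrow> (real^'d \<Rightarrow> complex^'d) set \<Rightarrow> real \<Rightarrow> nat \<Rightarrow> bool" where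
  "indep_eigvecs \<Omega> V t k \<longleftrightarrow> (\<exists>u :: nat \<Rightarrow> real^'d \<Rightarrow> complex^'d.
      (\<forall>i<k. is_eigvec \<Omega> V t (u i)) \<and>
      (\<forall>c :: nat \<Rightarrow> complex. (AE x in lebesgue_on \<Omega>. (\<Sum>i<k. c i *s u i x) = 0) \<longrightarrow> (\<forall>i<k. c i = 0)))"

text \<open>lam 1 <= lam 2 <= ... are the eigenvalues repeated with multiplicity: lam is
  nondecreasing on indices >= 1 and each real t occurs exactly (dimension of the
  t-eigenspace) many times.\<close>
definition eigenvalue_seq :: "(real^'d::finite) set \<Rightarrow> (real^'d \<Rightarrow> complex^'d) set \<Rightarrow> (nat \<Rightarrow> real) \<Rightarrow> bool" where
  "eigenvalue_seq \<Omega> V lam \<longleftrightarrow> mono_on {1..} lam \<and>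
     (\<forall>t. finite {n. 1 \<le> n \<and> lam n = t} \<and>
        (\<forall>k. indep_eigvecs \<Omega> V t k \<longleftrightarrow> k \<le> card {n. 1 \<le> n \<and> lam n = t}))"

text \<open>Lipschitz boundary: near each boundary point, Omega is (after a rotation) the
  region below the graph of a Lipschitz function; the rotation is encoded by a unit
  normal direction nu and the graph function is defined on the hyperplane nu-perp.\<close>
definition lipschitz_boundary :: "(real^'d::finite) set \<Rightarrow> bool" where
  "lipschitz_boundary \<Omega> \<longleftrightarrow> (\<forall>x\<in>frontier \<Omega>. \<exists>r>0. \<exists>\<nu>. norm \<nu> = 1 \<and>
     (\<exists>C \<gamma>. lipschitz_on C {z. z \<bullet> \<nu> = 0} \<gamma> \<and>
        (\<forall>y\<in>ball x r. y \<in> \<Omega> \<longleftrightarrow> y \<bullet> \<nu> < \<gamma> (y - (y \<bullet> \<nu>) *\<^sub>R \<nu>))))"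

end

theory Submission
  imports Defs "HOL-Library.Function_Algebras"
begin

text \<open>Let \<open>\<lambda> = \<lambda>\<^sub>n\<^sup>D\<close>, let \<open>a\<close> be the Stokes form and \<open>b = a - \<lambda> (\<cdot>, \<cdot>)\<close>. Following Filonov, consider the
  trial space spanned by the first \<open>n\<close> Dirichlet eigenfunctions, the kernel of \<open>A\<^sup>N - \<lambda>\<close> and a
  divergence free plane wave \<open>f(x) = exp(i \<omega> x) \<eta>\<close> with \<open>\<bar>\<omega>\<bar>\<^sup>2 = \<lambda>\<close> and \<open>\<omega> \<bottom> \<eta>\<close>. Integration by parts shows
  that \<open>b\<close> is nonpositive on this space, so by the min-max principle it suffices that the sum is direct.
  A function \<open>u\<close> in the form domain of \<open>A\<^sup>D\<close> with \<open>A\<^sup>N u = \<lambda> u\<close> is orthogonal to every divergence free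
  plane wave with \<open>\<bar>\<omega>\<bar>\<^sup>2 \<noteq> \<lambda>\<close>; as \<open>div u = 0\<close>, its Fourier transform vanishes off a sphere, hence everywhere.
  The wave \<open>f\<close> is independent of the rest because \<open>b(f, f') \<noteq> 0\<close> for plane waves \<open>f'\<close> with a frequency on
  the same sphere close to \<open>\<omega>\<close>, whereas \<open>b(\<cdot>, f')\<close> vanishes on the other two summands.

  The min-max principle rests on the compactness of the embedding into \<open>L\<^sub>2\<close>. Near the boundary the
  \<open>L\<^sub>2\<close> mass is moved into a compact part of the domain by a translation, and there the Poincare
  inequality on small cubes bounds it by finitely many averages.\<close>

section \<open>Semi-inner products and the min-max principle\<close>

text \<open>Including the kernel makes the inequality strict. If m is its dimension, the trial space
  has dimension n + m + 1, while failure of the claim would leave at most n + m Neumann eigenvalues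
  in the range up to \<open>lam\<close>. Since \<open>eigenvalue_seq\<close> records multiplicities
  and says nothing about completeness of the eigenfunctions, the contradiction is reached by a
  construction: some vector of the trial space is orthogonal to all eigenfunctions recorded up to
  \<open>lam\<close>, the Rayleigh quotient attains its minimum on their orthogonal complement, and
  the minimiser is an eigenfunction for some \<open>mu\<close> at most \<open>lam\<close>, one more
  than the multiplicity of \<open>mu\<close> admits. Plane waves fit because they solve -Delta f =
  |w|^2 f without a pressure term and satisfy a(u, f) = |w|^2 (u, f) for every u with zero trace.
  The same identity, compared with the Neumann equation for u, gives the orthogonality that starts
  the Fourier argument. Functions are not identified almost everywhere, so both forms are only
  semidefinite and independence is understood modulo null vectors.\<close>

lemma homogeneous_system_nontrivial_solution:
  fixes A :: "'i \<Rightarrow> 'j \<Rightarrow> complex"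
  assumes "finite J" "finite I" "card J < card I"
  shows "\<exists>c. (\<exists>i\<in>I. c i \<noteq> 0) \<and> (\<forall>j\<in>J. (\<Sum>i\<in>I. c i * A i j) = 0)"
  using assms
proof (induction J arbitrary: I A rule: finite_induct)
  case empty
  then have "I \<noteq> {}" by auto
  then show ?case by (intro exI[of _ "\<lambda>_. 1"]) auto
next
  case (insert j0 J)
  show ?case
  proof (cases "\<forall>i\<in>I. A i j0 = 0")
    case True
    have "card J < card I" using insert.prems insert.hyps by simp
    from insert.IH[OF insert.prems(1) this, of A] obtain c where
      "\<exists>i\<in>I. c i \<noteq> 0" "\<forall>j\<in>J. (\<Sum>i\<in>I. c i * A i j) = 0" by blast
    then show ?thesis using True by (intro exI[of _ c]) auto
  next
    case False
    then obtain i0 where i0: "i0 \<in> I" "A i0 j0 \<noteq> 0" by blast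
    \<comment> \<open>Equation \<open>j0\<close> is solved for the unknown \<open>i0\<close>;
      \<open>A'\<close> holds the coefficients of the remaining equations after this
      substitution.\<close>
    define A' where "A' i j = A i j - (A i j0 / A i0 j0) * A i0 j" for i j
    have "card J < card (I - {i0})"
      using insert i0 by (simp add: card_Diff_singleton)
    from insert.IH[OF _ this, of A'] insert.prems obtain c where
      c: "\<exists>i\<in>I - {i0}. c i \<noteq> 0" "\<forall>j\<in>J. (\<Sum>i\<in>I - {i0}. c i * A' i j) = 0" by auto
    define d where "d i = (if i = i0 then - (\<Sum>i\<in>I - {i0}. c i * (A i j0 / A i0 j0)) else c i)" for i
    have eq: "(\<Sum>i\<in>I. d i * A i j) = (\<Sum>i\<in>I - {i0}. c i * A' i j)" for j
    proof -
      have "(\<Sum>i\<in>I. d i * A i j) = d i0 * A i0 j + (\<Sum>i\<in>I - {i0}. d i * A i j)"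
        using insert.prems i0 by (simp add: sum.remove)
      also have "(\<Sum>i\<in>I - {i0}. d i * A i j) = (\<Sum>i\<in>I - {i0}. c i * A i j)"
        by (rule sum.cong) (auto simp: d_def)
      also have "d i0 * A i0 j + \<dots> = (\<Sum>i\<in>I - {i0}. c i * A' i j)"
        by (simp add: d_def A'_def algebra_simps sum_subtractf sum_distrib_left)
      finally show ?thesis .
    qed
    have "A' i j0 = 0" for i using i0 by (simp add: A'_def)
    then have "(\<Sum>i\<in>I. d i * A i j0) = 0" by (simp add: eq)
    moreover have "\<exists>i\<in>I. d i \<noteq> 0" using c by (auto simp: d_def)
    ultimately show ?thesis using c(2) eq by (intro exI[of _ d]) auto
  qed
qed

lemma finite_family_common_convergent_subsequence:
  fixes f :: "nat \<Rightarrow> nat \<Rightarrow> complex"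
  assumes "\<And>j. j < m \<Longrightarrow> bounded (range (f j))"
  shows "\<exists>r. strict_mono r \<and> (\<forall>j<m. convergent (\<lambda>n. f j (r n)))"
  using assms
proof (induction m)
  case 0
  show ?case using strict_mono_id by auto
next
  case (Suc m)
  then obtain r where r: "strict_mono r" "\<forall>j<m. convergent (\<lambda>n. f j (r n))" by auto
  have "bounded (range (\<lambda>n. f m (r n)))"
    using Suc.prems[of m] by (rule bounded_subset) auto
  from bounded_imp_convergent_subsequence[OF this] obtain l s where
    s: "strict_mono s" "((\<lambda>n. f m (r n)) \<circ> s) \<longlonglongrightarrow> l" by auto
  have "convergent (\<lambda>n. f j ((r \<circ> s) n))" if "j < Suc m" for j
  proof (cases "j = m")
    case True then show ?thesis using s by (auto simp: convergent_def o_def)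
  next
    case False
    then have "convergent (\<lambda>n. f j (r n))" using r that by auto
    then show ?thesis
      using convergent_subseq_convergent[OF _ s(1), of "\<lambda>n. f j (r n)"] by (simp add: o_def)
  qed
  then show ?case using r(1) s(1) by (metis strict_mono_o)
qed

text \<open>All axioms are restricted to the carrier \<open>S\<close> because the forms to come are
  built from \<open>wd\<close>, which is controlled only on \<open>H1\<close>. Positivity is left to
  a later locale so that the indefinite difference of \<open>a\<close> and \<open>lam\<close> times
  \<open>ip\<close> is an instance as well.\<close>

locale hermitian_form = vector_space sc
  for sc :: "complex \<Rightarrow> 'v::ab_group_add \<Rightarrow> 'v" +
  fixes S :: "'v set" and b :: "'v \<Rightarrow> 'v \<Rightarrow> complex"
  assumes subspace_S: "subspace S"
    and form_add: "\<And>u v w. u \<in> S \<Longrightarrow> v \<in> S \<Longrightarrow> w \<in> S \<Longrightarrow> b (u + v) w = b u w + b v w"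
    and form_scale: "\<And>c u v. u \<in> S \<Longrightarrow> v \<in> S \<Longrightarrow> b (sc c u) v = c * b u v"
    and form_cnj: "\<And>u v. u \<in> S \<Longrightarrow> v \<in> S \<Longrightarrow> b v u = cnj (b u v)"
begin

lemma form_add_right: "u \<in> S \<Longrightarrow> v \<in> S \<Longrightarrow> w \<in> S \<Longrightarrow> b w (u + v) = b w u + b w v"
  using form_add[of u v w] form_cnj[of "u+v" w] form_cnj[of u w] form_cnj[of v w]
    subspace_add[OF subspace_S, of u v] by simp

lemma form_scale_right: "u \<in> S \<Longrightarrow> v \<in> S \<Longrightarrow> b v (sc c u) = cnj c * b v u"
  using form_scale[of u v c] form_cnj[of "sc c u" v] form_cnj[of u v]
    subspace_scale[OF subspace_S, of u c] by simp

lemma form_zero: "u \<in> S \<Longrightarrow> b 0 u = 0"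
  using form_scale[of u u 0] by simp

lemma form_uminus: "u \<in> S \<Longrightarrow> v \<in> S \<Longrightarrow> b (- u) v = - b u v"
  using form_scale[of u v "-1"] by simp

lemma form_uminus_right: "u \<in> S \<Longrightarrow> v \<in> S \<Longrightarrow> b u (- v) = - b u v"
  using form_scale_right[of v u "-1"] by simp

lemma form_diff: "u \<in> S \<Longrightarrow> v \<in> S \<Longrightarrow> w \<in> S \<Longrightarrow> b (u - v) w = b u w - b v w"
  using form_add[of u "-v" w] form_uminus[of v w] subspace_neg[OF subspace_S, of v] by simp

lemma form_diff_right: "u \<in> S \<Longrightarrow> v \<in> S \<Longrightarrow> w \<in> S \<Longrightarrow> b w (u - v) = b w u - b w v"
  using form_add_right[of u "-v" w] form_uminus_right[of w v] subspace_neg[OF subspace_S, of v] by simp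

lemma lincomb_mem: "(\<And>i. i \<in> I \<Longrightarrow> u i \<in> S) \<Longrightarrow> (\<Sum>i\<in>I. sc (c i) (u i)) \<in> S"
  by (intro subspace_sum[OF subspace_S] subspace_scale[OF subspace_S])

lemma form_lincomb:
  assumes "finite I" "\<And>i. i \<in> I \<Longrightarrow> u i \<in> S" "v \<in> S"
  shows "b (\<Sum>i\<in>I. sc (c i) (u i)) v = (\<Sum>i\<in>I. c i * b (u i) v)"
  using assms
proof (induction I rule: finite_induct)
  case empty then show ?case by (simp add: form_zero)
next
  case (insert i I)
  then show ?case
    by (simp add: form_add form_scale lincomb_mem subspace_scale[OF subspace_S])
qed

lemma form_diag_scale: "u \<in> S \<Longrightarrow> Re (b (sc c u) (sc c u)) = (cmod c)\<^sup>2 * Re (b u u)"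
proof -
  assume u: "u \<in> S"
  have "b (sc c u) (sc c u) = c * cnj c * b u u"
    using u by (simp add: form_scale form_scale_right subspace_scale[OF subspace_S])
  also have "\<dots> = of_real ((cmod c)\<^sup>2) * b u u"
    by (simp add: complex_mult_cnj cmod_power2)
  finally show ?thesis by simp
qed

lemma form_diag_diff:
  assumes "u \<in> S" "v \<in> S"
  shows "Re (b (u - v) (u - v)) = Re (b u u) + Re (b v v) - 2 * Re (b u v)"
proof -
  have "b (u - v) (u - v) = b u u + b v v - b u v - cnj (b u v)"
    using assms form_cnj[of u v] subspace_diff[OF subspace_S assms]
    by (simp add: form_diff form_diff_right)
  then show ?thesis by simp
qed

lemma form_diag_add:
  assumes "u \<in> S" "v \<in> S"
  shows "Re (b (u + v) (u + v)) = Re (b u u) + Re (b v v) + 2 * Re (b u v)"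
proof -
  have "b (u + v) (u + v) = b u u + b v v + b u v + cnj (b u v)"
    using assms form_cnj[of u v] subspace_add[OF subspace_S assms]
    by (simp add: form_add form_add_right)
  then show ?thesis by simp
qed

lemma form_orthogonal_diag_sum:
  assumes "finite T" "\<And>t. t \<in> T \<Longrightarrow> x t \<in> S"
    and "\<And>s t. s \<in> T \<Longrightarrow> t \<in> T \<Longrightarrow> s \<noteq> t \<Longrightarrow> b (x s) (x t) = 0"
  shows "Re (b (sum x T) (sum x T)) = (\<Sum>t\<in>T. Re (b (x t) (x t)))"
  using assms
proof (induction T rule: finite_induct)
  case empty then show ?case using form_zero[of 0] subspace_0[OF subspace_S] by simp
next
  case (insert t T)
  have m: "x t \<in> S" "sum x T \<in> S" using insert by (auto intro: subspace_sum[OF subspace_S])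
  have "b (sum x T) (x t) = (\<Sum>s\<in>T. b (x s) (x t))"
    using form_lincomb[of T x "x t" "\<lambda>_. 1"] insert by simp
  also have "\<dots> = 0" using insert by (intro sum.neutral) auto
  finally have "b (x t) (sum x T) = 0" using form_cnj[OF m(2,1)] by simp
  then show ?case using insert form_diag_add[OF m] by simp
qed

end

text \<open>Semidefinite only: vectors are functions and not classes, so a function that vanishes
  almost everywhere can be a nonzero null vector.\<close>

locale semi_inner_product = hermitian_form +
  assumes form_nonneg: "\<And>u. u \<in> S \<Longrightarrow> 0 \<le> Re (b u u)"
begin

text \<open>Nonnegativity of \<open>b\<close> at \<open>v - sc c u\<close> with
  \<open>c = s * cnj (b u v)\<close> is a quadratic inequality in the real \<open>s\<close>, since
  this phase makes the cross term real. If \<open>Re (b u u) = 0\<close>, it is affine in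
  \<open>s\<close> and forces \<open>p = 0\<close>; otherwise its minimiser
  \<open>s = 1 / Re (b u u)\<close> gives the claim.\<close>

lemma form_Cauchy_Schwarz:
  assumes u: "u \<in> S" and v: "v \<in> S"
  shows "(cmod (b u v))\<^sup>2 \<le> Re (b u u) * Re (b v v)"
proof -
  define p where "p = (cmod (b u v))\<^sup>2"
  have key: "0 \<le> Re (b v v) - 2 * s * p + s\<^sup>2 * p * Re (b u u)" for s :: real
  proof -
    define c where "c = of_real s * cnj (b u v)"
    have m: "sc c u \<in> S" using u by (rule subspace_scale[OF subspace_S])
    have "0 \<le> Re (b (v - sc c u) (v - sc c u))"
      by (intro form_nonneg subspace_diff[OF subspace_S] v m)
    also have "\<dots> = Re (b v v) + (cmod c)\<^sup>2 * Re (b u u) - 2 * Re (b (sc c u) v)"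
      using form_diag_diff[OF v m] form_diag_scale[OF u, of c] form_cnj[OF m v] by simp
    also have "b (sc c u) v = of_real (s * p)"
      using form_scale[OF u v] complex_norm_square[of "b u v"] by (simp add: c_def p_def mult.commute)
    finally show ?thesis by (simp add: c_def p_def norm_mult power_mult_distrib algebra_simps)
  qed
  have p0: "p \<ge> 0" by (simp add: p_def)
  show ?thesis
  proof (cases "Re (b u u) = 0")
    case True
    have "p = 0"
    proof (rule ccontr)
      assume "p \<noteq> 0"
      then show False using key[of "(Re (b v v) + 1) / p"] True form_nonneg[OF v] by simp
    qed
    then show ?thesis using True by (simp add: p_def)
  next
    case False
    then have pos: "Re (b u u) > 0" using form_nonneg[OF u] by simp
    have "0 \<le> Re (b v v) - p / Re (b u u)"
      using key[of "1 / Re (b u u)"] pos by (simp add: power2_eq_square)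
    then show ?thesis using pos by (simp add: p_def field_simps)
  qed
qed

lemma form_eq_0_if_diag_eq_0: "u \<in> S \<Longrightarrow> v \<in> S \<Longrightarrow> Re (b u u) = 0 \<Longrightarrow> b u v = 0"
  using form_Cauchy_Schwarz[of u v] by simp

lemma form_diag_add_le:
  assumes "u \<in> S" "v \<in> S"
  shows "Re (b (u + v) (u + v)) \<le> 2 * Re (b u u) + 2 * Re (b v v)"
  using form_diag_add[OF assms] form_diag_diff[OF assms] form_nonneg[OF subspace_diff[OF subspace_S assms]]
  by simp

end

text \<open>\<open>form_complete\<close> is completeness of \<open>V\<close> in the form norm, up to
  null vectors. \<open>form_compact\<close> is compactness of the embedding into the
  \<open>ip\<close> norm in quantitative form: up to a small multiple of \<open>a\<close>, finitely
  many bounded functionals control \<open>ip\<close>. One constant \<open>C\<close> serves both as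
  their bound and as the factor in the estimate. \<open>a_null\<close> makes \<open>a\<close> blind
  to the null vectors of \<open>ip\<close>.\<close>

locale compact_form = ip: semi_inner_product sc V ip + a: semi_inner_product sc V a
  for sc :: "complex \<Rightarrow> 'v::ab_group_add \<Rightarrow> 'v" and V ip a +
  assumes a_null: "\<And>u. u \<in> V \<Longrightarrow> Re (ip u u) = 0 \<Longrightarrow> Re (a u u) = 0"
    and form_complete: "\<And>u. (\<And>n. u n \<in> V) \<Longrightarrow>
      (\<And>e. e > 0 \<Longrightarrow> \<exists>N. \<forall>m\<ge>N. \<forall>n\<ge>N.
         Re (ip (u m - u n) (u m - u n)) + Re (a (u m - u n) (u m - u n)) < e) \<Longrightarrow>
      \<exists>l\<in>V. (\<lambda>n. Re (ip (u n - l) (u n - l))) \<longlonglongrightarrow> 0 \<and> (\<lambda>n. Re (a (u n - l) (u n - l))) \<longlonglongrightarrow> 0"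
    and form_compact: "\<And>e. e > 0 \<Longrightarrow> \<exists>(m::nat) \<phi> C. C \<ge> 0 \<and>
      (\<forall>j<m. \<forall>u\<in>V. \<forall>v\<in>V. \<phi> j (u - v) = (\<phi> j u - \<phi> j v :: complex)) \<and>
      (\<forall>j<m. \<forall>u\<in>V. (cmod (\<phi> j u))\<^sup>2 \<le> C * Re (ip u u)) \<and>
      (\<forall>u\<in>V. Re (ip u u) \<le> e * Re (a u u) + C * (\<Sum>j<m. (cmod (\<phi> j u))\<^sup>2))"
begin

definition eigvec :: "real \<Rightarrow> 'v \<Rightarrow> bool" where
  "eigvec t u \<longleftrightarrow> u \<in> V \<and> (\<forall>v\<in>V. a u v = of_real t * ip u v)"

text \<open>Direct method for the Rayleigh quotient on \<open>V'\<close>; the vector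
  \<open>w\<close> shows that its infimum \<open>mu\<close> is at most \<open>lam\<close>. Along a
  minimising sequence the finitely many functionals of \<open>form_compact\<close> converge after
  passing to a subsequence, and the parallelogram law turns this into a Cauchy property in the form
  norm. The limit is a null vector of the difference of \<open>a\<close> and \<open>mu\<close> times
  \<open>ip\<close>, which is semidefinite on \<open>V'\<close>, so Cauchy-Schwarz yields the
  eigenvalue equation without differentiating the quotient.\<close>

lemma constrained_minimizer:
  assumes V': "V' = {v\<in>V. \<forall>j\<in>J. ip v (e j) = 0}" and e: "\<And>j. j \<in> J \<Longrightarrow> e j \<in> V"
    and w: "w \<in> V'" "Re (ip w w) > 0" "Re (a w w) \<le> lam * Re (ip w w)"
  shows "\<exists>mu\<le>lam. \<exists>u\<in>V'. Re (ip u u) > 0 \<and> (\<forall>v\<in>V'. a u v = of_real mu * ip u v)"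
proof -
  define q where "q u = Re (ip u u)" for u
  define A where "A u = Re (a u u)" for u
  have V'V: "v \<in> V" if "v \<in> V'" for v using that V' by simp
  have subV': "ip.subspace V'"
    unfolding ip.subspace_def V' using e
    by (auto simp: ip.form_zero ip.form_add ip.form_scale ip.subspace_0[OF ip.subspace_S]
        ip.subspace_add[OF ip.subspace_S] ip.subspace_scale[OF ip.subspace_S])
  have q0: "0 \<le> q u" and A0: "0 \<le> A u" if "u \<in> V" for u
    using that ip.form_nonneg a.form_nonneg by (auto simp: q_def A_def)
  define R where "R = {A v / q v | v. v \<in> V' \<and> q v > 0}"
  define mu where "mu = Inf R"
  have R0: "r \<ge> 0" if "r \<in> R" for r using that A0 V'V by (auto simp: R_def)
  have wR: "A w / q w \<in> R" using w by (auto simp: R_def q_def)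
  have bdd: "bdd_below R" using R0 by (auto simp: bdd_below_def)
  have "mu \<le> A w / q w" unfolding mu_def by (rule cInf_lower[OF wR bdd])
  also have "\<dots> \<le> lam" using w by (simp add: q_def A_def divide_le_eq)
  finally have mulam: "mu \<le> lam" .
  have mu0: "mu \<ge> 0" unfolding mu_def using wR R0 by (intro cInf_greatest) auto
  have ray: "mu * q v \<le> A v" if "v \<in> V'" for v
  proof (cases "q v = 0")
    case True then show ?thesis using A0[OF V'V[OF that]] by simp
  next
    case False
    then have pos: "q v > 0" using q0[OF V'V[OF that]] by simp
    then have "A v / q v \<in> R" using that by (auto simp: R_def)
    then have "mu \<le> A v / q v" unfolding mu_def by (rule cInf_lower[OF _ bdd])
    then show ?thesis using pos by (simp add: le_divide_eq)
  qed
  have "\<exists>v\<in>V'. q v = 1 \<and> A v \<le> mu + 1 / real (Suc n)" for n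
  proof -
    have "Inf R < mu + 1 / real (Suc n)" by (simp add: mu_def)
    then obtain r where "r \<in> R" "r < mu + 1 / real (Suc n)"
      using wR cInf_lessD[of R] by blast
    then obtain v where v: "v \<in> V'" "q v > 0" "A v / q v < mu + 1 / real (Suc n)" by (auto simp: R_def)
    define c where "c = complex_of_real (1 / sqrt (q v))"
    have c2: "(cmod c)\<^sup>2 = 1 / q v" using v by (simp add: c_def norm_divide power_divide)
    have "q (sc c v) = 1" "A (sc c v) = A v / q v"
      using ip.form_diag_scale[OF V'V[OF v(1)], of c] a.form_diag_scale[OF V'V[OF v(1)], of c] v
      by (simp_all add: q_def A_def c2)
    then show ?thesis using v ip.subspace_scale[OF subV' v(1)] by (intro bexI[of _ "sc c v"]) auto
  qed
  then obtain v where v: "\<And>n. v n \<in> V'" "\<And>n. q (v n) = 1" "\<And>n. A (v n) \<le> mu + 1 / real (Suc n)"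
    by metis
  \<comment> \<open>With this value \<open>ep * mu\<close> is at most 1/2, so that
    \<open>mu * q\<close> can be absorbed into half of \<open>A\<close>; the summand 1 covers
    \<open>mu = 0\<close>.\<close>
  define ep where "ep = 1 / (2 * (mu + 1))"
  have ep: "ep > 0" "ep * mu \<le> 1/2" using mu0 by (auto simp: ep_def field_simps)
  from form_compact[OF ep(1)] obtain m :: nat and \<phi> C where C: "C \<ge> 0"
    and lin: "\<And>j u v. j < m \<Longrightarrow> u \<in> V \<Longrightarrow> v \<in> V \<Longrightarrow> \<phi> j (u - v) = (\<phi> j u - \<phi> j v :: complex)"
    and bd: "\<And>j u. j < m \<Longrightarrow> u \<in> V \<Longrightarrow> (cmod (\<phi> j u))\<^sup>2 \<le> C * q u"
    and cpt: "\<And>u. u \<in> V \<Longrightarrow> q u \<le> ep * A u + C * (\<Sum>j<m. (cmod (\<phi> j u))\<^sup>2)"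
    unfolding q_def A_def by blast
  have "bounded (range (\<lambda>n. \<phi> j (v n)))" if "j < m" for j
  proof (rule boundedI[of _ "sqrt C"])
    fix y assume "y \<in> range (\<lambda>n. \<phi> j (v n))"
    then show "cmod y \<le> sqrt C" using bd[OF that V'V[OF v(1)]] v(2) by (auto intro: real_le_rsqrt)
  qed
  from finite_family_common_convergent_subsequence[of m "\<lambda>j n. \<phi> j (v n)", OF this]
  obtain r where r: "strict_mono r" "\<And>j. j < m \<Longrightarrow> convergent (\<lambda>n. \<phi> j (v (r n)))" by auto
  define u where "u n = v (r n)" for n
  have u: "\<And>n. u n \<in> V'" "\<And>n. q (u n) = 1" by (auto simp: u_def v)
  have uA: "A (u n) \<le> mu + 1 / real (Suc n)" for n
  proof -
    have "1 / real (Suc (r n)) \<le> 1 / real (Suc n)"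
      using seq_suble[OF r(1), of n] by (simp add: frac_le)
    then show ?thesis using v(3)[of "r n"] by (simp add: u_def)
  qed
  define L where "L m' n' = (\<Sum>j<m. (cmod (\<phi> j (u m') - \<phi> j (u n')))\<^sup>2)" for m' n'
  have est: "A (u k - u n) \<le> 2 * (mu * C * L k n + (2 / real (Suc k) + 2 / real (Suc n)))" (is ?th1)
    "q (u k - u n) \<le> ep * A (u k - u n) + C * L k n" (is ?th2) for k n
  proof -
    have k: "u k \<in> V" "u n \<in> V" "u k - u n \<in> V" "u k + u n \<in> V'"
      using u V'V ip.subspace_diff[OF subV'] ip.subspace_add[OF subV'] by blast+
    show th2: ?th2 using cpt[OF k(3)] lin k by (simp add: L_def)
    have pq: "q (u k - u n) = 2 * q (u k) + 2 * q (u n) - q (u k + u n)"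
      using ip.form_diag_add[of "u k" "u n"] ip.form_diag_diff[of "u k" "u n"] k by (simp add: q_def)
    have pA: "A (u k - u n) = 2 * A (u k) + 2 * A (u n) - A (u k + u n)"
      using a.form_diag_add[of "u k" "u n"] a.form_diag_diff[of "u k" "u n"] k by (simp add: A_def)
    \<comment> \<open>Parallelogram law for \<open>A\<close> minus \<open>mu * q\<close>; the value
      of this form at \<open>u k + u n\<close> is nonnegative by \<open>ray\<close> and may be
      dropped.\<close>
    have "A (u k - u n) - mu * q (u k - u n)
      = 2 * (A (u k) - mu * q (u k)) + 2 * (A (u n) - mu * q (u n)) - (A (u k + u n) - mu * q (u k + u n))"
      by (simp add: pq pA algebra_simps)
    also have "\<dots> \<le> 2 / real (Suc k) + 2 / real (Suc n)"
      using ray[OF k(4)] uA[of k] uA[of n] u(2) by simp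
    finally have 1: "A (u k - u n) \<le> mu * q (u k - u n) + (2 / real (Suc k) + 2 / real (Suc n))" by simp
    have "mu * q (u k - u n) \<le> mu * (ep * A (u k - u n) + C * L k n)"
      using th2 mu0 by (rule mult_left_mono)
    also have "\<dots> = (ep * mu) * A (u k - u n) + mu * C * L k n" by (simp add: algebra_simps)
    also have "\<dots> \<le> 1/2 * A (u k - u n) + mu * C * L k n"
      using mult_right_mono[OF ep(2) A0[OF k(3)]] by simp
    finally show ?th1 using 1 by simp
  qed
  have Cauchy: "\<exists>N. \<forall>k\<ge>N. \<forall>n\<ge>N. q (u k - u n) + A (u k - u n) < e" if e: "e > 0" for e
  proof -
    \<comment> \<open>\<open>K\<close> is the factor in front of the errors
      \<open>2 / real (Suc k)\<close>, and \<open>K2\<close> strictly exceeds the factor in front of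
      \<open>L\<close>; each of the two contributions then takes half of \<open>e\<close>.\<close>
    define K where "K = (ep + 1) * 2"
    have K: "K > 0" using ep by (simp add: K_def)
    define K2 where "K2 = K * mu * C + C + 1"
    have K2: "K2 > 0" using K mu0 C by (simp add: K2_def add_nonneg_pos)
    define d where "d = e / (2 * K2)"
    have d: "d > 0" using e K2 by (simp add: d_def)
    have "\<exists>N. \<forall>k\<ge>N. \<forall>n\<ge>N. \<forall>j<m. (cmod (\<phi> j (u k) - \<phi> j (u n)))\<^sup>2 < d / (real m + 1)"
    proof -
      define d' where "d' = sqrt (d / (real m + 1))"
      have d': "d' > 0" using d by (simp add: d'_def)
      have "\<exists>N. \<forall>k\<ge>N. \<forall>n\<ge>N. cmod (\<phi> j (u k) - \<phi> j (u n)) < d'" if "j < m" for j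
        using r(2)[OF that] d' unfolding u_def by (metis CauchyD Cauchy_convergent_iff)
      then obtain Nf where Nf: "\<And>j k n. j < m \<Longrightarrow> k \<ge> Nf j \<Longrightarrow> n \<ge> Nf j \<Longrightarrow> cmod (\<phi> j (u k) - \<phi> j (u n)) < d'"
        by metis
      show ?thesis
      proof (intro exI[of _ "Max (insert 0 (Nf ` {..<m}))"] allI impI)
        fix k n j assume a: "Max (insert 0 (Nf ` {..<m})) \<le> k" "Max (insert 0 (Nf ` {..<m})) \<le> n" "j < m"
        then have "cmod (\<phi> j (u k) - \<phi> j (u n)) < d'" by (intro Nf) auto
        then have "(cmod (\<phi> j (u k) - \<phi> j (u n)))\<^sup>2 < d'\<^sup>2" by (intro power_strict_mono) auto
        then show "(cmod (\<phi> j (u k) - \<phi> j (u n)))\<^sup>2 < d / (real m + 1)"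
          using d by (simp add: d'_def)
      qed
    qed
    then obtain N1 where N1: "\<And>k n j. k \<ge> N1 \<Longrightarrow> n \<ge> N1 \<Longrightarrow> j < m \<Longrightarrow> (cmod (\<phi> j (u k) - \<phi> j (u n)))\<^sup>2 < d / (real m + 1)"
      by blast
    have Ld: "L k n \<le> d" "0 \<le> L k n" if "k \<ge> N1" "n \<ge> N1" for k n
    proof -
      have "L k n \<le> (\<Sum>j<m. d / (real m + 1))" unfolding L_def
        using N1[OF that] by (intro sum_mono less_imp_le) auto
      also have "\<dots> = d * (real m / (real m + 1))" by simp
      also have "\<dots> \<le> d * 1" using d by (intro mult_left_mono) auto
      finally show "L k n \<le> d" by simp
      show "0 \<le> L k n" by (simp add: L_def sum_nonneg)
    qed
    obtain N2 :: nat where N2: "8 * K / e < real N2" using reals_Archimedean2 by blast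
    have rN: "2 / real (Suc k) \<le> e / (4 * K)" if "k \<ge> N2" for k
    proof -
      have "8 * K / e < real (Suc k)" using N2 that by linarith
      then show ?thesis using e K by (simp add: field_simps)
    qed
    show ?thesis
    proof (intro exI[of _ "max N1 N2"] allI impI)
      fix k n assume kn: "max N1 N2 \<le> k" "max N1 N2 \<le> n"
      have "q (u k - u n) + A (u k - u n) \<le> (ep + 1) * A (u k - u n) + C * L k n"
        using est(2)[of k n] by (simp add: algebra_simps)
      also have "\<dots> \<le> (ep + 1) * (2 * (mu * C * L k n + (2 / real (Suc k) + 2 / real (Suc n)))) + C * L k n"
        using est(1)[of k n] ep by (intro add_right_mono mult_left_mono) auto
      also have "\<dots> = (K * mu * C + C) * L k n + K * (2 / real (Suc k) + 2 / real (Suc n))"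
        by (simp add: K_def algebra_simps add_divide_distrib)
      also have "\<dots> \<le> (K * mu * C + C) * d + K * (e / (4 * K) + e / (4 * K))"
        using Ld[of k n] kn rN[of k] rN[of n] K mu0 C
        by (intro add_mono mult_left_mono) auto
      also have "\<dots> < K2 * d + K * (e / (4 * K) + e / (4 * K))"
        using d by (simp add: K2_def)
      also have "\<dots> = e" using K K2 by (simp add: d_def field_simps)
      finally show "q (u k - u n) + A (u k - u n) < e" .
    qed
  qed
  obtain l where l: "l \<in> V" "(\<lambda>n. q (u n - l)) \<longlonglongrightarrow> 0" "(\<lambda>n. A (u n - l)) \<longlonglongrightarrow> 0"
    using form_complete[of u] V'V[OF u(1)] Cauchy unfolding q_def A_def by blast
  have lV': "l \<in> V'"
  proof -
    have "ip l (e j) = 0" if j: "j \<in> J" for j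
    proof -
      have "(cmod (ip l (e j)))\<^sup>2 \<le> q (u n - l) * q (e j)" for n
      proof -
        have "ip (u n - l) (e j) = - ip l (e j)"
          using u(1)[of n] j e l(1) V'V[OF u(1)[of n]] by (simp add: ip.form_diff V')
        then show ?thesis
          using ip.form_Cauchy_Schwarz[of "u n - l" "e j"] e[OF j] ip.subspace_diff[OF ip.subspace_S V'V[OF u(1)] l(1)]
          by (simp add: q_def)
      qed
      moreover have "(\<lambda>n. q (u n - l) * q (e j)) \<longlonglongrightarrow> 0 * q (e j)"
        by (intro tendsto_intros l)
      ultimately have "(cmod (ip l (e j)))\<^sup>2 \<le> 0"
        by (intro LIMSEQ_le_const[of _ 0]) auto
      then show ?thesis by simp
    qed
    then show ?thesis using l by (simp add: V')
  qed
  have ul: "u n - l \<in> V'" "u n - l \<in> V" for n using ip.subspace_diff[OF subV' u(1) lV'] V'V by auto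
  have "q l > 0"
  proof (rule ccontr)
    assume "\<not> q l > 0"
    then have ql: "q l = 0" using q0[OF l(1)] by simp
    have "1 \<le> 2 * q (u n - l)" for n
      using ip.form_diag_add_le[OF ul(2)[of n] l(1)] u(2)[of n] ql by (simp add: q_def)
    moreover have "(\<lambda>n. 2 * q (u n - l)) \<longlonglongrightarrow> 2 * 0" by (intro tendsto_intros l)
    ultimately have "1 \<le> 2 * (0::real)" using LIMSEQ_le_const by blast
    then show False by simp
  qed
  define b where "b x y = a x y - of_real mu * ip x y" for x y
  interpret b: semi_inner_product sc V' b
  proof
    show "ip.subspace V'" by (rule subV')
    fix u v w c assume "u \<in> V'" "v \<in> V'"
    note uv = V'V[OF this(1)] V'V[OF this(2)]
    { assume "w \<in> V'"
      then show "b (u + v) w = b u w + b v w"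
        using uv V'V by (simp add: b_def a.form_add ip.form_add algebra_simps) }
    show "b (sc c u) v = c * b u v"
      using uv by (simp add: b_def a.form_scale ip.form_scale algebra_simps)
    show "b v u = cnj (b u v)"
      using a.form_cnj[OF uv] ip.form_cnj[OF uv] by (simp add: b_def)
  next
    fix u assume "u \<in> V'"
    then show "0 \<le> Re (b u u)" using ray[of u] by (simp add: b_def q_def A_def)
  qed
  have bq: "Re (b x x) = A x - mu * q x" for x by (simp add: b_def A_def q_def)
  have "Re (b l l) \<le> 0"
  proof -
    have "Re (b l l) \<le> 2 * (1 / real (Suc n)) + 2 * A (u n - l)" for n
    proof -
      have "Re (b l l) = Re (b (u n - (u n - l)) (u n - (u n - l)))" by simp
      also have "\<dots> \<le> 2 * Re (b (u n) (u n)) + 2 * Re (b (u n - l) (u n - l))"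
        using b.form_diag_add[OF u(1)[of n] ul(1)[of n]] b.form_diag_diff[OF u(1)[of n] ul(1)[of n]]
          b.form_nonneg[OF ip.subspace_add[OF subV' u(1)[of n] ul(1)[of n]]] by simp
      also have "\<dots> \<le> 2 * (1 / real (Suc n)) + 2 * A (u n - l)"
        using uA[of n] u(2)[of n] mult_nonneg_nonneg[OF mu0 q0[OF ul(2)[of n]]] by (simp add: bq)
      finally show ?thesis .
    qed
    moreover have "(\<lambda>n. 2 * (1 / real (Suc n)) + 2 * A (u n - l)) \<longlonglongrightarrow> 2 * 0 + 2 * 0"
      by (intro tendsto_intros l) (use LIMSEQ_inverse_real_of_nat in \<open>simp add: inverse_eq_divide\<close>)
    ultimately show ?thesis by (intro LIMSEQ_le_const[of _ 0]) auto
  qed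
  then have b0: "Re (b l l) = 0" using b.form_nonneg[OF lV'] by simp
  have "a l v = of_real mu * ip l v" if "v \<in> V'" for v
    using b.form_eq_0_if_diag_eq_0[OF lV' that b0] by (simp add: b_def)
  then show ?thesis using mulam lV' \<open>q l > 0\<close> unfolding q_def by blast
qed

text \<open>Independence of classes modulo null vectors of \<open>ip\<close>. It is a property of
  the family and not of its range, so a repeated vector is excluded.\<close>

definition independent_family :: "'i set \<Rightarrow> ('i \<Rightarrow> 'v) \<Rightarrow> bool" where
  "independent_family I u \<longleftrightarrow> (\<forall>i\<in>I. u i \<in> V) \<and>
     (\<forall>c. Re (ip (\<Sum>i\<in>I. sc (c i) (u i)) (\<Sum>i\<in>I. sc (c i) (u i))) = 0 \<longrightarrow> (\<forall>i\<in>I. c i = 0))"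

lemma a_eq_0_if_null: "u \<in> V \<Longrightarrow> v \<in> V \<Longrightarrow> Re (ip u u) = 0 \<Longrightarrow> a u v = 0"
  using a_null a.form_eq_0_if_diag_eq_0 by blast

text \<open>There are fewer conditions than unknowns, so a nontrivial combination of the
  \<open>w i\<close> is orthogonal to all \<open>e j\<close> and the constrained infimum of the
  Rayleigh quotient is at most \<open>lam\<close>. The minimiser solves the equation against the
  orthogonal complement of the \<open>e j\<close> only. Against the \<open>e j\<close> both sides
  vanish because these are eigenvectors, and together with the complement they span
  \<open>V\<close>.\<close>

lemma min_max_new_eigvec:
  assumes I: "finite I" "independent_family I w"
    and le: "\<And>c. Re (a (\<Sum>i\<in>I. sc (c i) (w i)) (\<Sum>i\<in>I. sc (c i) (w i)))
        \<le> lam * Re (ip (\<Sum>i\<in>I. sc (c i) (w i)) (\<Sum>i\<in>I. sc (c i) (w i)))"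
    and J: "finite J" "independent_family J e" "\<And>j. j \<in> J \<Longrightarrow> eigvec (t j) (e j)"
    and card: "card J < card I"
  shows "\<exists>mu\<le>lam. \<exists>u. eigvec mu u \<and> Re (ip u u) > 0 \<and> (\<forall>j\<in>J. ip u (e j) = 0)"
proof -
  have eV: "e j \<in> V" if "j \<in> J" for j using J that by (simp add: independent_family_def)
  have wV: "w j \<in> V" if "j \<in> I" for j using I that by (simp add: independent_family_def)
  define V' where "V' = {v\<in>V. \<forall>j\<in>J. ip v (e j) = 0}"
  obtain c where c: "\<exists>i\<in>I. c i \<noteq> 0" "\<forall>j\<in>J. (\<Sum>i\<in>I. c i * ip (w i) (e j)) = 0"
    using homogeneous_system_nontrivial_solution[OF J(1) I(1) card, of "\<lambda>i j. ip (w i) (e j)"] by blast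
  define x where "x = (\<Sum>i\<in>I. sc (c i) (w i))"
  have xV: "x \<in> V" unfolding x_def by (intro ip.lincomb_mem wV)
  have "x \<in> V'"
    using c(2) I(1) wV eV xV by (auto simp: V'_def x_def ip.form_lincomb)
  moreover have "Re (ip x x) > 0"
    using c(1) I(2) ip.form_nonneg[OF xV] unfolding independent_family_def x_def
    by (metis order_le_less)
  moreover have "Re (a x x) \<le> lam * Re (ip x x)" unfolding x_def by (rule le)
  ultimately obtain mu u where u: "mu \<le> lam" "u \<in> V'" "Re (ip u u) > 0"
    "\<And>v. v \<in> V' \<Longrightarrow> a u v = of_real mu * ip u v"
    using constrained_minimizer[OF V'_def eV] by blast
  have uV: "u \<in> V" and uJ: "\<And>j. j \<in> J \<Longrightarrow> ip u (e j) = 0" using u(2) by (auto simp: V'_def)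
  have ae: "a u (e j) = 0" if "j \<in> J" for j
  proof -
    have "a (e j) u = of_real (t j) * ip (e j) u" using J(3)[OF that] uV by (simp add: eigvec_def)
    then show ?thesis
      using a.form_cnj[OF eV[OF that] uV] ip.form_cnj[OF uV eV[OF that]] uJ[OF that] by simp
  qed
  have "a u v = of_real mu * ip u v" if v: "v \<in> V" for v
  proof -
    \<comment> \<open>Projection of \<open>v\<close> onto the complement without Gram-Schmidt:
      \<open>card J + 1\<close> coefficients face \<open>card J\<close> orthogonality conditions.
      The coefficient at \<open>None\<close> belongs to \<open>v\<close>; it cannot vanish, as the
      \<open>e j\<close> are independent modulo null vectors, and dividing by it gives
      \<open>z\<close>.\<close>
    define J' where "J' = insert None (Some ` J)"
    define g where "g k = (case k of None \<Rightarrow> v | Some j \<Rightarrow> e j)" for k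
    have gV: "g k \<in> V" if "k \<in> J'" for k using that v eV by (auto simp: J'_def g_def)
    have "card J < card J'" using J(1) by (simp add: J'_def card_image)
    then obtain d where d: "\<exists>i\<in>J'. d i \<noteq> 0" "\<forall>j\<in>J. (\<Sum>i\<in>J'. d i * ip (g i) (e j)) = 0"
      using homogeneous_system_nontrivial_solution[of J J' "\<lambda>i j. ip (g i) (e j)"] J(1)
      by (auto simp: J'_def)
    define y where "y = (\<Sum>j\<in>J. sc (d (Some j)) (e j))"
    have yV: "y \<in> V" unfolding y_def by (intro ip.lincomb_mem eV)
    have s: "(\<Sum>i\<in>J'. d i * ip (g i) x) = d None * ip v x + (\<Sum>j\<in>J. d (Some j) * ip (e j) x)" for x
      using J(1) by (simp add: J'_def g_def sum.insert sum.reindex)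
    have orth: "ip (sc (d None) v + y) (e j) = 0" if "j \<in> J" for j
      using d(2) that s[of "e j"] v eV yV ip.subspace_scale[OF ip.subspace_S v]
      by (simp add: ip.form_add ip.form_scale y_def ip.form_lincomb J(1))
    have "d None \<noteq> 0"
    proof
      assume d0: "d None = 0"
      have "ip y (e j) = 0" if "j \<in> J" for j using orth[OF that] d0 by simp
      then have "ip y y = 0"
        using ip.form_lincomb[of J e y, OF J(1) eV yV, where c = "\<lambda>j. d (Some j)"] ip.form_cnj[OF yV eV]
        by (simp add: y_def[symmetric])
      then have "\<forall>j\<in>J. d (Some j) = 0"
        using conjunct2[OF J(2)[unfolded independent_family_def], rule_format, of "\<lambda>j. d (Some j)"]
        by (simp add: y_def)
      then show False using d(1) d0 by (auto simp: J'_def)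
    qed
    define z where "z = v + sc (1 / d None) y"
    have cz: "sc (1 / d None) y \<in> V" by (rule ip.subspace_scale[OF ip.subspace_S yV])
    then have zV: "z \<in> V" unfolding z_def by (rule ip.subspace_add[OF ip.subspace_S v])
    have "z \<in> V'"
    proof -
      have "ip z (e j) = 0" if "j \<in> J" for j
        using orth[OF that] v yV cz eV[OF that] \<open>d None \<noteq> 0\<close> ip.subspace_scale[OF ip.subspace_S v]
        by (simp add: z_def ip.form_add ip.form_scale field_simps)
      then show ?thesis using zV by (simp add: V'_def)
    qed
    then have 1: "a u z = of_real mu * ip u z" by (rule u(4))
    have ipy: "ip u y = 0"
      using ip.form_cnj[OF yV uV] ip.form_lincomb[of J e u, OF J(1) eV uV, where c = "\<lambda>j. d (Some j)"] ip.form_cnj[OF uV eV] uJ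
      by (simp add: y_def[symmetric])
    have ay: "a u y = 0"
      using a.form_cnj[OF yV uV] a.form_lincomb[of J e u, OF J(1) eV uV, where c = "\<lambda>j. d (Some j)"] a.form_cnj[OF uV eV] ae
      by (simp add: y_def[symmetric])
    show ?thesis using 1 v yV cz uV
      by (simp add: z_def a.form_add_right ip.form_add_right a.form_scale_right ip.form_scale_right ipy ay)
  qed
  then have "eigvec mu u" using uV by (simp add: eigvec_def)
  then show ?thesis using u(1,3) uJ by blast
qed

end

section \<open>Families of eigenvectors and the trial space\<close>

context compact_form
begin

text \<open>The eigenvalue equation is tested within the family only. Dirichlet eigenvectors satisfy
  it against Dirichlet test functions, in general not against all of \<open>V\<close>, and this weak
  form is enough for orthogonality and for the Rayleigh bound.\<close>

definition eigen_family :: "'i set \<Rightarrow> ('i \<Rightarrow> real) \<Rightarrow> ('i \<Rightarrow> 'v) \<Rightarrow> bool" where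
  "eigen_family J t e \<longleftrightarrow> (\<forall>i\<in>J. e i \<in> V \<and> (\<forall>j\<in>J. a (e i) (e j) = of_real (t i) * ip (e i) (e j)))"

lemma eigen_family_orthogonal:
  assumes "eigen_family J t e" "i \<in> J" "j \<in> J" "t i \<noteq> t j"
  shows "ip (e i) (e j) = 0"
proof -
  have V: "e i \<in> V" "e j \<in> V" and 1: "a (e i) (e j) = of_real (t i) * ip (e i) (e j)"
    and 2: "a (e j) (e i) = of_real (t j) * ip (e j) (e i)" using assms by (auto simp: eigen_family_def)
  have "a (e i) (e j) = of_real (t j) * ip (e i) (e j)"
    using 2 a.form_cnj[OF V(2,1)] ip.form_cnj[OF V(2,1)] by simp
  with 1 show ?thesis using assms(4) by auto
qed

definition eigen_part :: "'i set \<Rightarrow> ('i \<Rightarrow> real) \<Rightarrow> ('i \<Rightarrow> 'v) \<Rightarrow> ('i \<Rightarrow> complex) \<Rightarrow> real \<Rightarrow> 'v" where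
  "eigen_part J t e c s = (\<Sum>j\<in>{j\<in>J. t j = s}. sc (c j) (e j))"

lemma eigen_part_props:
  assumes J: "finite J" and E: "eigen_family J t e"
  shows "eigen_part J t e c s \<in> V"
    and "(\<Sum>j\<in>J. sc (c j) (e j)) = (\<Sum>s\<in>t ` J. eigen_part J t e c s)"
    and "s \<noteq> s' \<Longrightarrow> ip (eigen_part J t e c s) (eigen_part J t e c s') = 0"
    and "a (eigen_part J t e c s) (eigen_part J t e c s') = of_real s * ip (eigen_part J t e c s) (eigen_part J t e c s')"
proof -
  have eV: "e j \<in> V" if "j \<in> J" for j using E that by (simp add: eigen_family_def)
  show xV: "eigen_part J t e c s \<in> V" for s unfolding eigen_part_def by (intro ip.lincomb_mem) (auto intro: eV)
  show "(\<Sum>j\<in>J. sc (c j) (e j)) = (\<Sum>s\<in>t ` J. eigen_part J t e c s)"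
    unfolding eigen_part_def by (rule sum.image_gen[OF J])
  have fin: "finite {j\<in>J. t j = s}" for s using J by simp
  have ipe: "ip (e i) (eigen_part J t e c s) = cnj (\<Sum>j\<in>{j\<in>J. t j = s}. c j * ip (e j) (e i))" if "i \<in> J" for i s
    using ip.form_cnj[OF xV[of s] eV[OF that]] ip.form_lincomb[OF fin[of s], of e "e i" c] eV that
    by (simp add: eigen_part_def)
  have ae: "a (e i) (eigen_part J t e c s) = of_real (t i) * ip (e i) (eigen_part J t e c s)" if i: "i \<in> J" for i s
  proof -
    have "a (e i) (eigen_part J t e c s) = cnj (\<Sum>j\<in>{j\<in>J. t j = s}. c j * a (e j) (e i))"
      using a.form_cnj[OF xV[of s] eV[OF i]] a.form_lincomb[OF fin[of s], of e "e i" c] eV i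
      by (simp add: eigen_part_def)
    also have "\<dots> = cnj (\<Sum>j\<in>{j\<in>J. t j = s}. of_real (t i) * (c j * ip (e j) (e i)))"
    proof (intro arg_cong[where f = cnj] sum.cong refl)
      fix j assume "j \<in> {j\<in>J. t j = s}"
      then have j: "j \<in> J" by simp
      have "a (e j) (e i) = of_real (t j) * ip (e j) (e i)" using E i j by (simp add: eigen_family_def)
      also have "\<dots> = of_real (t i) * ip (e j) (e i)" using eigen_family_orthogonal[OF E j i] by (cases "t i = t j") auto
      finally show "c j * a (e j) (e i) = of_real (t i) * (c j * ip (e j) (e i))" by simp
    qed
    also have "\<dots> = of_real (t i) * ip (e i) (eigen_part J t e c s)"
      by (simp add: ipe[OF i] sum_distrib_left)
    finally show ?thesis .
  qed
  have 1: "ip (eigen_part J t e c s) y = (\<Sum>i\<in>{j\<in>J. t j = s}. c i * ip (e i) y)"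
    "a (eigen_part J t e c s) y = (\<Sum>i\<in>{j\<in>J. t j = s}. c i * a (e i) y)" if "y \<in> V" for s y
    using ip.form_lincomb[OF fin[of s], of e y c] a.form_lincomb[OF fin[of s], of e y c] eV that by (simp_all add: eigen_part_def)
  show "a (eigen_part J t e c s) (eigen_part J t e c s') = of_real s * ip (eigen_part J t e c s) (eigen_part J t e c s')"
    by (simp add: 1[OF xV] ae sum_distrib_left mult.left_commute)
  assume s: "s \<noteq> s'"
  have "ip (e i) (eigen_part J t e c s') = 0" if "i \<in> J" "t i = s" for i
  proof -
    have "ip (e j) (e i) = 0" if "j \<in> J" "t j = s'" for j
      using eigen_family_orthogonal[OF E, of j i] that \<open>i \<in> J\<close> \<open>t i = s\<close> s by auto
    then show ?thesis using that by (simp add: ipe)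
  qed
  then show "ip (eigen_part J t e c s) (eigen_part J t e c s') = 0" by (simp add: 1[OF xV])
qed

text \<open>Parts with different eigenvalues are orthogonal, so the squared norm of a combination is
  the sum of those of its parts, and independence can be checked for one eigenvalue at a
  time.\<close>

lemma eigen_family_independent:
  assumes J: "finite J" and E: "eigen_family J t e"
    and I: "\<And>s. independent_family {j\<in>J. t j = s} e"
  shows "independent_family J e"
  unfolding independent_family_def
proof (intro conjI ballI allI impI)
  show "e i \<in> V" if "i \<in> J" for i using E that by (simp add: eigen_family_def)
  note P = eigen_part_props[OF J E]
  fix c i assume z: "Re (ip (\<Sum>j\<in>J. sc (c j) (e j)) (\<Sum>j\<in>J. sc (c j) (e j))) = 0" and i: "i \<in> J"
  have "(\<Sum>s\<in>t ` J. Re (ip (eigen_part J t e c s) (eigen_part J t e c s))) = 0"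
    using ip.form_orthogonal_diag_sum[of "t ` J" "eigen_part J t e c"] J P(1,3) z by (simp add: P(2))
  then have "Re (ip (eigen_part J t e c (t i)) (eigen_part J t e c (t i))) = 0"
    using J i ip.form_nonneg[OF P(1)] by (subst (asm) sum_nonneg_eq_0_iff) auto
  then show "c i = 0" using I[of "t i"] i unfolding independent_family_def eigen_part_def by blast
qed

lemma eigen_family_rayleigh:
  assumes J: "finite J" and E: "eigen_family J t e" and le: "\<And>j. j \<in> J \<Longrightarrow> t j \<le> lam"
  shows "Re (a (\<Sum>j\<in>J. sc (c j) (e j)) (\<Sum>j\<in>J. sc (c j) (e j)))
    \<le> lam * Re (ip (\<Sum>j\<in>J. sc (c j) (e j)) (\<Sum>j\<in>J. sc (c j) (e j)))"
proof -
  note P = eigen_part_props[OF J E]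
  have "Re (a (\<Sum>j\<in>J. sc (c j) (e j)) (\<Sum>j\<in>J. sc (c j) (e j))) = (\<Sum>s\<in>t ` J. Re (a (eigen_part J t e c s) (eigen_part J t e c s)))"
    unfolding P(2) by (rule a.form_orthogonal_diag_sum) (use J P in auto)
  also have "\<dots> \<le> (\<Sum>s\<in>t ` J. lam * Re (ip (eigen_part J t e c s) (eigen_part J t e c s)))"
    using le ip.form_nonneg[OF P(1)] by (intro sum_mono) (auto simp: P(4) intro!: mult_right_mono)
  also have "\<dots> = lam * Re (ip (\<Sum>j\<in>J. sc (c j) (e j)) (\<Sum>j\<in>J. sc (c j) (e j)))"
    unfolding P(2) sum_distrib_left[symmetric]
    by (subst ip.form_orthogonal_diag_sum) (use J P in auto)
  finally show ?thesis .
qed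

text \<open>The trial space is spanned by the family \<open>eD\<close>, the eigenspace of \<open>lam\<close> and one further vector \<open>f\<close>;
  the vector \<open>f'\<close> witnesses that \<open>f\<close> does not lie in the span of the others.\<close>

lemma trial_space_new_eigvec:
  fixes lam :: real and JD M :: "nat set"
  defines "b \<equiv> \<lambda>x y. a x y - of_real lam * ip x y"
  assumes JD: "finite JD" "eigen_family JD tD eD" "independent_family JD eD" "\<And>j. j \<in> JD \<Longrightarrow> tD j \<le> lam"
    and M: "finite M" "independent_family M eN" "\<And>j. j \<in> M \<Longrightarrow> eigvec lam (eN j)"
    and f: "f \<in> V" "f' \<in> V" "b f f = 0" "b f f' \<noteq> 0"
      "\<And>j. j \<in> JD \<Longrightarrow> b (eD j) f = 0" "\<And>j. j \<in> JD \<Longrightarrow> b (eD j) f' = 0"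
    and triv: "\<And>c. (\<forall>v\<in>V. b (\<Sum>j\<in>JD. sc (c j) (eD j)) v = 0) \<Longrightarrow> Re (ip (\<Sum>j\<in>JD. sc (c j) (eD j)) (\<Sum>j\<in>JD. sc (c j) (eD j))) = 0"
    and J: "finite J" "independent_family J e" "\<And>j. j \<in> J \<Longrightarrow> eigvec (t j) (e j)"
    and card: "card J < card JD + card M + 1"
  shows "\<exists>mu\<le>lam. \<exists>u. eigvec mu u \<and> Re (ip u u) > 0 \<and> (\<forall>j\<in>J. ip u (e j) = 0)"
proof -
  \<comment> \<open>\<open>Inl\<close> indexes the family \<open>eD\<close>,
    \<open>Inr (Some j)\<close> the eigenspace of \<open>lam\<close>, and \<open>Inr None\<close>
    the extra vector \<open>f\<close>.\<close>
  define I where "I = Inl ` JD \<union> Inr ` (insert None (Some ` M))"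
  define w where "w i = (case i of Inl j \<Rightarrow> eD j | Inr None \<Rightarrow> f | Inr (Some j) \<Rightarrow> eN j)" for i
  have I: "finite I" using JD M by (simp add: I_def)
  have cardI: "card I = card JD + card M + 1"
  proof -
    have "card I = card (Inl ` JD :: (nat + nat option) set) + card (Inr ` (insert None (Some ` M)) :: (nat + nat option) set)"
      unfolding I_def using JD M by (intro card_Un_disjoint) auto
    also have "\<dots> = card JD + card (insert None (Some ` M))"
      by (simp only: card_image[OF inj_on_subset[OF inj_Inl subset_UNIV]] card_image[OF inj_on_subset[OF inj_Inr subset_UNIV]])
    also have "card (insert None (Some ` M)) = card M + 1" using M by (simp add: card_image)
    finally show ?thesis by simp
  qed
  have eDV: "eD j \<in> V" if "j \<in> JD" for j using JD that by (simp add: independent_family_def)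
  have eNV: "eN j \<in> V" if "j \<in> M" for j using M that by (simp add: independent_family_def)
  have sumI: "(\<Sum>i\<in>I. sc (c i) (w i)) = (\<Sum>j\<in>JD. sc (c (Inl j)) (eD j)) + (sc (c (Inr None)) f + (\<Sum>j\<in>M. sc (c (Inr (Some j))) (eN j)))" for c
  proof -
    have "(\<Sum>i\<in>I. sc (c i) (w i)) = (\<Sum>i\<in>Inl ` JD. sc (c i) (w i)) + (\<Sum>i\<in>Inr ` (insert None (Some ` M)). sc (c i) (w i))"
      unfolding I_def using JD M by (intro sum.union_disjoint) auto
    also have "(\<Sum>i\<in>Inl ` JD. sc (c i) (w i)) = (\<Sum>j\<in>JD. sc (c (Inl j)) (eD j))"
      by (simp add: sum.reindex w_def)
    also have "(\<Sum>i\<in>Inr ` (insert None (Some ` M)). sc (c i) (w i)) = (\<Sum>i\<in>insert None (Some ` M). sc (c (Inr i)) (w (Inr i)))"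
      by (subst sum.reindex) (auto simp: inj_on_def)
    also have "\<dots> = sc (c (Inr None)) f + (\<Sum>j\<in>M. sc (c (Inr (Some j))) (eN j))"
      using M by (simp add: sum.reindex w_def)
    finally show ?thesis .
  qed
  interpret b: hermitian_form sc V b
  proof
    show "ip.subspace V" by (rule ip.subspace_S)
    fix u v w c assume uv: "u \<in> V" "v \<in> V"
    { assume "w \<in> V"
      then show "b (u + v) w = b u w + b v w"
        using uv by (simp add: b_def a.form_add ip.form_add algebra_simps) }
    show "b (sc c u) v = c * b u v"
      using uv by (simp add: b_def a.form_scale ip.form_scale algebra_simps)
    show "b v u = cnj (b u v)"
      using a.form_cnj[OF uv] ip.form_cnj[OF uv] by (simp add: b_def)
  qed
  have bN: "b (eN j) v = 0" if "j \<in> M" "v \<in> V" for j v using M(3)[OF that(1)] that(2) by (simp add: eigvec_def b_def)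
  have bnull: "b z v = 0" if "z \<in> V" "v \<in> V" "Re (ip z z) = 0" for z v
    using a_eq_0_if_null[OF that] ip.form_eq_0_if_diag_eq_0[OF that] by (simp add: b_def)
  have D0: "b (\<Sum>j\<in>JD. sc (c j) (eD j)) f = 0" "b (\<Sum>j\<in>JD. sc (c j) (eD j)) f' = 0" for c
    using b.form_lincomb[OF JD(1) eDV f(1)] b.form_lincomb[OF JD(1) eDV f(2)] f(5,6) by simp_all
  have N0: "b (\<Sum>j\<in>M. sc (c j) (eN j)) v = 0" if "v \<in> V" for c v
    using b.form_lincomb[OF M(1) eNV that] bN[OF _ that] by simp
  have mem: "(\<Sum>j\<in>JD. sc (c j) (eD j)) \<in> V" "(\<Sum>j\<in>M. sc (c' j) (eN j)) \<in> V" "sc k f \<in> V" for c c' k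
    by (auto intro!: ip.lincomb_mem eDV eNV ip.subspace_scale[OF ip.subspace_S] f)
  have indep: "independent_family I w"
    unfolding independent_family_def
  proof (intro conjI allI impI)
    show "\<forall>i\<in>I. w i \<in> V" using eDV eNV f by (auto simp: I_def w_def)
    fix c :: "nat + nat option \<Rightarrow> complex"
    define x where "x = (\<Sum>j\<in>JD. sc (c (Inl j)) (eD j))"
    define k where "k = c (Inr None)"
    define y where "y = (\<Sum>j\<in>M. sc (c (Inr (Some j))) (eN j))"
    have m: "x \<in> V" "y \<in> V" "sc k f \<in> V" "sc k f + y \<in> V" "x + (sc k f + y) \<in> V"
      using mem by (auto simp: x_def y_def intro!: ip.subspace_add[OF ip.subspace_S])
    assume "Re (ip (\<Sum>i\<in>I. sc (c i) (w i)) (\<Sum>i\<in>I. sc (c i) (w i))) = 0"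
    then have z: "Re (ip (x + (sc k f + y)) (x + (sc k f + y))) = 0" unfolding sumI x_def k_def y_def .
    \<comment> \<open>Against \<open>f'\<close> the form kills both \<open>x\<close> and
      \<open>y\<close>, so a null combination has no share of \<open>f\<close>.\<close>
    have "b (x + (sc k f + y)) f' = k * b f f'"
      using m f(1,2) D0(2)[of "\<lambda>j. c (Inl j)"] N0[OF f(2), of "\<lambda>j. c (Inr (Some j))"]
      by (simp add: b.form_add b.form_scale x_def[symmetric] y_def[symmetric])
    then have k0: "k = 0" using bnull[OF m(5) f(2) z] f(4) by simp
    then have z': "Re (ip (x + y) (x + y)) = 0" using z by simp
    have xy: "x + y \<in> V" using m by (intro ip.subspace_add[OF ip.subspace_S])
    \<comment> \<open>Up to a null vector \<open>x\<close> equals \<open>- y\<close>, so it inherits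
      from \<open>y\<close> that \<open>b\<close> vanishes against all of \<open>V\<close>; then
      \<open>triv\<close> makes it null.\<close>
    have "b x v = 0" if v: "v \<in> V" for v
    proof -
      have "b (x + y) v = b x v" using m v N0[OF v, of "\<lambda>j. c (Inr (Some j))"] by (simp add: b.form_add y_def[symmetric])
      then show ?thesis using bnull[OF xy v z'] by simp
    qed
    then have x0: "Re (ip x x) = 0" unfolding x_def by (intro triv) auto
    then have cD: "\<forall>j\<in>JD. c (Inl j) = 0"
      using conjunct2[OF JD(3)[unfolded independent_family_def], rule_format, of "\<lambda>j. c (Inl j)"] by (simp add: x_def)
    then have "x = 0" by (simp add: x_def)
    then have "Re (ip y y) = 0" using z' by simp
    then have "\<forall>j\<in>M. c (Inr (Some j)) = 0"
      using conjunct2[OF M(2)[unfolded independent_family_def], rule_format, of "\<lambda>j. c (Inr (Some j))"] by (simp add: y_def)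
    then show "\<forall>i\<in>I. c i = 0" using cD k0 by (auto simp: I_def k_def)
  qed
  have ray: "Re (a (\<Sum>i\<in>I. sc (c i) (w i)) (\<Sum>i\<in>I. sc (c i) (w i))) \<le> lam * Re (ip (\<Sum>i\<in>I. sc (c i) (w i)) (\<Sum>i\<in>I. sc (c i) (w i)))" for c :: "nat + nat option \<Rightarrow> complex"
  proof -
    define x where "x = (\<Sum>j\<in>JD. sc (c (Inl j)) (eD j))"
    define k where "k = c (Inr None)"
    define y where "y = (\<Sum>j\<in>M. sc (c (Inr (Some j))) (eN j))"
    have m: "x \<in> V" "y \<in> V" "sc k f \<in> V" "sc k f + y \<in> V"
      using mem by (auto simp: x_def y_def intro!: ip.subspace_add[OF ip.subspace_S])
    have yv: "b y v = 0" "b v y = 0" if "v \<in> V" for v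
      using N0[OF that, of "\<lambda>j. c (Inr (Some j))"] b.form_cnj[OF m(2) that] by (simp_all add: y_def[symmetric])
    have "b x (sc k f) = 0"
      using b.form_scale_right[OF f(1) m(1)] D0(1)[of "\<lambda>j. c (Inl j)"] by (simp add: x_def[symmetric])
    then have 1: "b x (sc k f + y) = 0" using m yv by (simp add: b.form_add_right)
    have "b (sc k f) (sc k f) = 0"
      using b.form_scale[OF f(1) m(3)] b.form_scale_right[OF f(1) f(1)] f(3) by simp
    then have 2: "Re (b (sc k f + y) (sc k f + y)) = 0" using b.form_diag_add[OF m(3,2)] yv m by simp
    \<comment> \<open>All cross terms and the diagonal terms of \<open>f\<close> and
      \<open>y\<close> vanish. Only the part in the span of \<open>eD\<close> is left, where the
      Rayleigh bound applies.\<close>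
    have "Re (b (x + (sc k f + y)) (x + (sc k f + y))) = Re (b x x)"
      using b.form_diag_add[OF m(1,4)] 1 2 by simp
    also have "\<dots> \<le> 0"
      using eigen_family_rayleigh[OF JD(1,2,4), of "\<lambda>j. c (Inl j)"] by (simp add: b_def x_def)
    finally show ?thesis unfolding sumI by (simp add: b_def x_def k_def y_def)
  qed
  have "card J < card I" using card unfolding cardI .
  with I indep ray J show ?thesis by (rule min_max_new_eigvec)
qed

end

section \<open>Test functions\<close>

lemma smooth_fun_differentiable: "smooth_fun f \<Longrightarrow> f differentiable (at x)"
  by (erule smooth_fun.cases) simp

lemma smooth_fun_frechet_derivative:
  "smooth_fun f \<Longrightarrow> b \<in> Basis \<Longrightarrow> smooth_fun (\<lambda>x. frechet_derivative f (at x) b)"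
  by (erule smooth_fun.cases) simp

lemma smooth_fun_has_derivative:
  "smooth_fun f \<Longrightarrow> (f has_derivative frechet_derivative f (at x)) (at x)"
  using smooth_fun_differentiable frechet_derivative_works by blast

lemma smooth_fun_continuous_on: "smooth_fun f \<Longrightarrow> continuous_on S f"
  by (meson continuous_at_imp_continuous_on differentiable_imp_continuous_within smooth_fun_differentiable)

lemma has_derivative_translate:
  "(f has_derivative f') (at (x + c)) \<Longrightarrow> ((\<lambda>x. f (x + c)) has_derivative f') (at x)"
  by (rule has_derivative_compose[where f = "\<lambda>x. x + c" and f' = "\<lambda>h. h", simplified o_def])
     (auto intro!: derivative_eq_intros)

lemma smooth_fun_translate:
  assumes "smooth_fun f"
  shows "smooth_fun (\<lambda>x. f (x + c))"
proof -
  have "\<exists>f. g = (\<lambda>x. f (x + c)) \<and> smooth_fun f" if "g = (\<lambda>x. f (x + c))" for g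
    using that assms by blast
  then show ?thesis
  proof (rule smooth_fun.coinduct[of "\<lambda>g. \<exists>f. g = (\<lambda>x. f (x + c)) \<and> smooth_fun f"])
    show "(\<lambda>x. f (x + c)) = (\<lambda>x. f (x + c))" ..
  next
    fix g assume "\<exists>f. g = (\<lambda>x. f (x + c)) \<and> smooth_fun f"
    then obtain f where g: "g = (\<lambda>x. f (x + c))" and f: "smooth_fun f" by blast
    have d: "(g has_derivative frechet_derivative f (at (x + c))) (at x)" for x
      unfolding g by (rule has_derivative_translate[OF smooth_fun_has_derivative[OF f]])
    then have e: "frechet_derivative g (at x) = frechet_derivative f (at (x + c))" for x
      by (metis frechet_derivative_at)
    show "\<exists>f. g = f \<and> (\<forall>x. f differentiable at x) \<and>
      (\<forall>b\<in>Basis. (\<exists>fa. (\<lambda>x. frechet_derivative f (at x) b) = (\<lambda>x. fa (x + c)) \<and> smooth_fun fa)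
         \<or> smooth_fun (\<lambda>x. frechet_derivative f (at x) b))"
    proof (intro exI[of _ g] conjI allI ballI refl)
      show "g differentiable at x" for x using d differentiable_def by blast
      fix b :: 'a assume b: "b \<in> Basis"
      show "(\<exists>fa. (\<lambda>x. frechet_derivative g (at x) b) = (\<lambda>x. fa (x + c)) \<and> smooth_fun fa)
         \<or> smooth_fun (\<lambda>x. frechet_derivative g (at x) b)"
        by (intro disjI1 exI[of _ "\<lambda>x. frechet_derivative f (at x) b"])
           (simp add: e smooth_fun_frechet_derivative[OF f b])
    qed
  qed
qed

section \<open>Smooth cutoff functions on boxes\<close>

definition flat :: "nat \<Rightarrow> real \<Rightarrow> real" where
  "flat m t = (if t \<le> 0 then 0 else exp (- inverse t) * inverse t ^ m)"

lemma flat_tendsto_0: "(flat m \<longlongrightarrow> 0) (at 0)"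
proof -
  have "((\<lambda>s::real. exp (- s) * s ^ m) \<longlongrightarrow> 0) at_top"
    using tendsto_power_div_exp_0[of m] by (simp add: exp_minus field_simps)
  from filterlim_compose[OF this filterlim_inverse_at_top_right]
  have "((\<lambda>t::real. exp (- inverse t) * inverse t ^ m) \<longlongrightarrow> 0) (at_right 0)" .
  then have r: "(flat m \<longlongrightarrow> 0) (at_right 0)"
    by (rule Lim_transform_eventually) (auto simp: eventually_at_right_field flat_def intro: exI[of _ 1])
  have "(flat m \<longlongrightarrow> 0) (at_left 0)"
    by (rule Lim_transform_eventually[OF tendsto_const[of 0]])
      (auto simp: eventually_at_left_field flat_def intro: exI[of _ "-1"])
  with r show ?thesis by (simp add: filterlim_split_at)
qed

text \<open>The powers of \<open>inverse t\<close> are carried along because differentiation raises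
  them. Up to linear combinations the family \<open>flat m\<close> is closed under derivatives, as
  the coinductive notion of smoothness demands.\<close>

lemma flat_has_real_derivative:
  "(flat m has_real_derivative (flat (m + 2) t - real m * flat (m + 1) t)) (at t)"
proof -
  consider "t > 0" | "t < 0" | "t = 0" by linarith
  then show ?thesis
  proof cases
    case 1
    have "((\<lambda>t. exp (- inverse t) * inverse t ^ m) has_real_derivative
       (flat (m + 2) t - real m * flat (m + 1) t)) (at t)"
      using 1 by (cases m) (auto intro!: derivative_eq_intros simp: flat_def field_simps power2_eq_square, metis One_nat_def power_eq_if)
    then show ?thesis
      by (rule has_field_derivative_transform_within_open[of _ _ _ "{0<..}"]) (use 1 in \<open>auto simp: flat_def\<close>)
  next
    case 2
    have "((\<lambda>t. 0) has_real_derivative (flat (m + 2) t - real m * flat (m + 1) t)) (at t)"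
      using 2 by (simp add: flat_def)
    then show ?thesis
      by (rule has_field_derivative_transform_within_open[of _ _ _ "{..<0}"]) (use 2 in \<open>auto simp: flat_def\<close>)
  next
    case 3
    \<comment> \<open>At the origin the difference quotient is itself a member of the family, and it
      tends to 0.\<close>
    have "(\<lambda>h. (flat m (0 + h) - flat m 0) / h) = flat (Suc m)"
      by (auto simp: flat_def fun_eq_iff field_simps)
    then show ?thesis using flat_tendsto_0[of "Suc m"] 3
      by (simp add: DERIV_def flat_def)
  qed
qed

text \<open>A class of functions that is closed under partial derivatives, so that smoothness of its members
  follows by coinduction.\<close>

inductive flat_alg :: "(real^'d::finite \<Rightarrow> real) \<Rightarrow> bool" where
  flat_alg_const: "flat_alg (\<lambda>x. c)"
| flat_alg_flat: "flat_alg (\<lambda>x. flat m (\<alpha> * x $ k + \<beta>))"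
| flat_alg_add: "flat_alg f \<Longrightarrow> flat_alg g \<Longrightarrow> flat_alg (\<lambda>x. f x + g x)"
| flat_alg_mult: "flat_alg f \<Longrightarrow> flat_alg g \<Longrightarrow> flat_alg (\<lambda>x. f x * g x)"

lemma flat_alg_derivative:
  fixes f :: "real^'d::finite \<Rightarrow> real"
  assumes "flat_alg f"
  shows "\<exists>f'. (\<forall>x. (f has_derivative f' x) (at x)) \<and> (\<forall>b. flat_alg (\<lambda>x. f' x b))"
  using assms
proof induction
  case (flat_alg_const c)
  show ?case by (intro exI[of _ "\<lambda>x h. 0"]) (auto intro: flat_alg.intros)
next
  case (flat_alg_flat m \<alpha> k \<beta>)
  let ?f' = "\<lambda>(x::real^'d) (h::real^'d). (flat (m + 2) (\<alpha> * x $ k + \<beta>) + (- real m) * flat (m + 1) (\<alpha> * x $ k + \<beta>)) * (\<alpha> * h $ k)"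
  have "((\<lambda>x. flat m (\<alpha> * x $ k + \<beta>)) has_derivative ?f' x) (at x)" for x :: "real^'d"
  proof -
    have 1: "((\<lambda>x. \<alpha> * x $ k + \<beta>) has_derivative (\<lambda>h. \<alpha> * h $ k)) (at x)"
      by (auto intro!: derivative_eq_intros bounded_linear_imp_has_derivative bounded_linear_vec_nth)
    have 2: "(flat m has_derivative (\<lambda>h. h * (flat (m + 2) t - real m * flat (m + 1) t))) (at t)" for t
      using flat_has_real_derivative[of m t] by (simp add: has_field_derivative_def mult_commute_abs)
    show ?thesis
      using has_derivative_compose[OF 1 2] by (simp add: algebra_simps)
  qed
  moreover have "flat_alg (\<lambda>x. ?f' x b)" for b :: "real^'d" by (intro flat_alg.intros)
  ultimately show ?case by (intro exI[of _ ?f']) auto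
next
  case (flat_alg_add f g)
  then obtain f' g' where "\<forall>x. (f has_derivative f' x) (at x)" "\<forall>b. flat_alg (\<lambda>x. f' x b)"
    "\<forall>x. (g has_derivative g' x) (at x)" "\<forall>b. flat_alg (\<lambda>x. g' x b)" by blast
  then show ?case
    by (intro exI[of _ "\<lambda>x h. f' x h + g' x h"]) (auto intro: flat_alg.intros has_derivative_add)
next
  case (flat_alg_mult f g)
  then obtain f' g' where "\<forall>x. (f has_derivative f' x) (at x)" "\<forall>b. flat_alg (\<lambda>x. f' x b)"
    "\<forall>x. (g has_derivative g' x) (at x)" "\<forall>b. flat_alg (\<lambda>x. g' x b)" by blast
  then show ?case using flat_alg_mult.hyps
    by (intro exI[of _ "\<lambda>x h. f x * g' x h + f' x h * g x"] conjI allI has_derivative_mult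
        flat_alg.flat_alg_add flat_alg.flat_alg_mult) auto
qed

lemma flat_alg_smooth: "flat_alg f \<Longrightarrow> smooth_fun f"
proof (coinduction arbitrary: f rule: smooth_fun.coinduct)
  case (smooth_fun f)
  then obtain f' where f': "\<And>x. (f has_derivative f' x) (at x)" "\<And>b. flat_alg (\<lambda>x. f' x b)"
    using flat_alg_derivative by blast
  then have "frechet_derivative f (at x) = f' x" for x by (metis frechet_derivative_at)
  then show ?case using f' by (auto simp: differentiable_def)
qed

lemma flat_alg_prod: "finite K \<Longrightarrow> (\<And>k. k \<in> K \<Longrightarrow> flat_alg (f k)) \<Longrightarrow> flat_alg (\<lambda>x. \<Prod>k\<in>K. f k x)"
  by (induction K rule: finite_induct) (auto intro: flat_alg.intros)

text \<open>The two arguments are \<open>n * (x $ k - a $ k) - 1\<close> and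
  \<open>n * (b $ k - x $ k) - 1\<close>. The shift by 1 keeps the support at distance
  \<open>1 / n\<close> from the faces, and as \<open>n\<close> grows the products tend to the
  indicator of the open box while staying between 0 and 1.\<close>

definition box_bump :: "real^'d \<Rightarrow> real^'d \<Rightarrow> nat \<Rightarrow> real^'d::finite \<Rightarrow> real" where
  "box_bump a b n x = (\<Prod>k\<in>UNIV. flat 0 (real n * x $ k + (- real n * a $ k - 1)) * flat 0 (- real n * x $ k + (real n * b $ k - 1)))"

lemma flat0_bounds: "0 \<le> flat 0 t" "flat 0 t \<le> 1" "flat 0 t \<noteq> 0 \<longleftrightarrow> t > 0"
  by (auto simp: flat_def)

lemma box_bump_bounds: "0 \<le> box_bump a b n x" "box_bump a b n x \<le> 1"
  unfolding box_bump_def by (auto intro!: prod_nonneg prod_le_1 mult_nonneg_nonneg mult_le_one simp: flat0_bounds)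

lemma smooth_fun_box_bump: "smooth_fun (box_bump a b n)"
  unfolding box_bump_def by (intro flat_alg_smooth flat_alg_prod flat_alg.intros) auto

lemma test_fun_box_bump:
  assumes "box a b \<subseteq> \<Omega>"
  shows "test_fun \<Omega> (box_bump a b n)"
proof -
  define K where "K = {x. \<forall>k. real n * (x $ k - a $ k) \<ge> 1 \<and> real n * (b $ k - x $ k) \<ge> 1}"
  have sub: "{x. box_bump a b n x \<noteq> 0} \<subseteq> K"
    by (auto simp: box_bump_def K_def flat0_bounds prod_zero_iff algebra_simps less_imp_le)
  have "closed K"
    unfolding K_def by (intro closed_Collect_all closed_Collect_conj closed_Collect_le continuous_intros)
  with sub have c: "closure {x. box_bump a b n x \<noteq> 0} \<subseteq> K" by (rule closure_minimal)
  have Kb: "K \<subseteq> box a b"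
  proof
    fix x assume x: "x \<in> K"
    have "a $ k < x $ k \<and> x $ k < b $ k" for k
    proof -
      have "real n * (x $ k - a $ k) > 0" "real n * (b $ k - x $ k) > 0" using x by (auto simp: K_def intro: less_le_trans[OF zero_less_one])
      then show ?thesis by (simp add: zero_less_mult_iff)
    qed
    then show "x \<in> box a b" by (simp add: mem_box_cart)
  qed
  have "bounded (closure {x. box_bump a b n x \<noteq> 0})"
    using c Kb bounded_box bounded_subset by (metis subset_trans)
  then have "compact (closure {x. box_bump a b n x \<noteq> 0})" by (simp add: compact_eq_bounded_closed)
  then show ?thesis using smooth_fun_box_bump c Kb assms by (auto simp: test_fun_def)
qed

lemma box_bump_tendsto: "(\<lambda>n. box_bump a b n x) \<longlonglongrightarrow> indicat_real (box a b) x"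
proof -
  have 1: "(\<lambda>n. flat 0 (real n * s - 1)) \<longlonglongrightarrow> (if s > 0 then 1 else 0)" for s
  proof (cases "s > 0")
    case True
    have lim: "filterlim (\<lambda>n. real n * s - 1) at_top sequentially"
      using filterlim_tendsto_pos_mult_at_top[OF tendsto_const True filterlim_real_sequentially]
        filterlim_tendsto_add_at_top[OF tendsto_const[of "-1"]] by (force simp: mult.commute)
    have "(\<lambda>n. exp (- inverse (real n * s - 1))) \<longlonglongrightarrow> exp (- 0)"
      by (intro tendsto_intros filterlim_compose[OF tendsto_inverse_0_at_top lim] tendsto_inverse_0_at_top lim)
    then have "(\<lambda>n. exp (- inverse (real n * s - 1))) \<longlonglongrightarrow> 1" by simp
    moreover have "eventually (\<lambda>n. real n * s - 1 > 0) sequentially"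
      using lim unfolding filterlim_at_top_dense by blast
    then have "eventually (\<lambda>n. exp (- inverse (real n * s - 1)) = flat 0 (real n * s - 1)) sequentially"
      by eventually_elim (simp add: flat_def)
    ultimately have "(\<lambda>n. flat 0 (real n * s - 1)) \<longlonglongrightarrow> 1" by (rule Lim_transform_eventually)
    with True show ?thesis by simp
  next
    case False
    then have "real n * s \<le> 0" for n by (simp add: mult_nonneg_nonpos)
    then have "flat 0 (real n * s - 1) = 0" for n by (simp add: flat_def) (smt (verit))
    then show ?thesis using False by simp
  qed
  have "(\<lambda>n. \<Prod>k\<in>UNIV. flat 0 (real n * (x $ k - a $ k) - 1) * flat 0 (real n * (b $ k - x $ k) - 1))
    \<longlonglongrightarrow> (\<Prod>k\<in>UNIV. (if x $ k - a $ k > 0 then 1 else 0) * (if b $ k - x $ k > 0 then 1 else 0))"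
    by (intro tendsto_prod tendsto_mult 1)
  also have "(\<Prod>k\<in>UNIV. (if x $ k - a $ k > 0 then 1 else 0) * (if b $ k - x $ k > 0 then 1 else (0::real)))
     = indicat_real (box a b) x"
    by (auto simp: indicator_def mem_box_cart)
  also have "(\<lambda>n. \<Prod>k\<in>UNIV. flat 0 (real n * (x $ k - a $ k) - 1) * flat 0 (real n * (b $ k - x $ k) - 1))
     = (\<lambda>n. box_bump a b n x)"
    by (simp add: box_bump_def algebra_simps)
  finally show ?thesis .
qed

section \<open>The fundamental lemma of the calculus of variations\<close>

lemma test_fun_continuous_on: "test_fun \<Omega> \<phi> \<Longrightarrow> continuous_on S \<phi>"
  by (simp add: test_fun_def smooth_fun_continuous_on)

text \<open>Cutoff functions increase the reach of the hypothesis to indicators of boxes by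
  dominated convergence. Boxes are closed under intersection and generate the Borel sets, so the
  integral of \<open>g\<close> vanishes over every Borel part of a box in the domain, which forces
  \<open>g\<close> to vanish there almost everywhere; countably many boxes exhaust the open
  set.\<close>

lemma fundamental_lemma_lborel:
  fixes g :: "real^'d::finite \<Rightarrow> complex"
  assumes "open \<Omega>" and g: "integrable lborel g"
    and zero: "\<And>\<phi>. test_fun \<Omega> \<phi> \<Longrightarrow> (\<integral>x. g x * complex_of_real (\<phi> x) \<partial>lborel) = 0"
  shows "AE x in lborel. x \<in> \<Omega> \<longrightarrow> g x = 0"
proof -
  have gm[measurable]: "g \<in> borel_measurable borel" using g by auto
  have box0: "(\<integral>x. indicat_real (box a b) x *\<^sub>R g x \<partial>lborel) = 0" if ab: "box a b \<subseteq> \<Omega>" for a b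
  proof -
    have "(\<lambda>n. \<integral>x. g x * complex_of_real (box_bump a b n x) \<partial>lborel)
      \<longlonglongrightarrow> (\<integral>x. indicat_real (box a b) x *\<^sub>R g x \<partial>lborel)"
    proof (rule integral_dominated_convergence[where w = "\<lambda>x. norm (g x)"])
      show "AE x in lborel. (\<lambda>n. g x * complex_of_real (box_bump a b n x)) \<longlonglongrightarrow> indicat_real (box a b) x *\<^sub>R g x"
      proof (intro AE_I2)
        fix x
        have "(\<lambda>n. g x * complex_of_real (box_bump a b n x)) \<longlonglongrightarrow> g x * of_real (indicat_real (box a b) x)"
          by (intro tendsto_intros box_bump_tendsto)
        then show "(\<lambda>n. g x * complex_of_real (box_bump a b n x)) \<longlonglongrightarrow> indicat_real (box a b) x *\<^sub>R g x"
          by (simp add: scaleR_conv_of_real mult.commute)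
      qed
      show "(\<lambda>x. g x * complex_of_real (box_bump a b n x)) \<in> borel_measurable lborel" for n
        using borel_measurable_continuous_onI[OF smooth_fun_continuous_on[OF smooth_fun_box_bump[of a b n]]] by simp
      show "AE x in lborel. norm (g x * complex_of_real (box_bump a b n x)) \<le> norm (g x)" for n
        using box_bump_bounds[of a b n] by (auto simp: norm_mult intro!: AE_I2 mult_left_le)
    qed (use g in \<open>auto intro: borel_measurable_scaleR\<close>)
    then show ?thesis using zero[OF test_fun_box_bump[OF ab]] by (simp add: LIMSEQ_const_iff)
  qed
  have gA: "integrable lborel (\<lambda>x. indicat_real A x *\<^sub>R g x)" if "A \<in> sets borel" for A
    using that g by (intro integrable_mult_indicator) auto
  have AEbox: "AE x in lborel. indicat_real (box a b) x *\<^sub>R g x = 0" if ab: "box a b \<subseteq> \<Omega>" for a b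
  proof (rule sigma_finite_measure.density_zero)
    show "sigma_finite_measure (lborel :: (real^'d) measure)" by (rule lborel.sigma_finite_measure_axioms)
    show "integrable lborel (\<lambda>x. indicat_real (box a b) x *\<^sub>R g x)" by (rule gA) simp
    fix A :: "(real^'d) set" assume "A \<in> sets lborel"
    then have A: "A \<in> sigma_sets UNIV (range (\<lambda>(a, b). box a b))" by (simp add: borel_eq_box)
    define I where "I A = (\<integral>x. indicat_real (A \<inter> box a b) x *\<^sub>R g x \<partial>lborel)" for A
    have "I A = 0"
    proof (rule sigma_sets_induct_disjoint[OF _ _ A, of "\<lambda>A. I A = 0"])
      show "Int_stable (range (\<lambda>(a, b). box a b :: (real^'d) set))"
        by (auto simp: Int_stable_def box_Int_box)
    next
      fix A assume "A \<in> range (\<lambda>(a, b). box a b :: (real^'d) set)"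
      then obtain c d where "A = box c d" by auto
      then obtain e f where "A \<inter> box a b = box e f" using box_Int_box by blast
      then show "I A = 0" using box0[of e f] ab by (auto simp: I_def)
    next
      show "I {} = 0" by (simp add: I_def)
    next
      fix A :: "(real^'d) set" assume "A \<in> sigma_sets UNIV (range (\<lambda>(a, b). box a b))" "I A = 0"
      then have [measurable]: "A \<in> sets borel" by (simp add: borel_eq_box)
      have "indicat_real ((UNIV - A) \<inter> box a b) x *\<^sub>R g x
        = indicat_real (box a b) x *\<^sub>R g x - indicat_real (A \<inter> box a b) x *\<^sub>R g x" for x
        by (auto simp: indicator_def)
      then have "I (UNIV - A) = (\<integral>x. indicat_real (box a b) x *\<^sub>R g x \<partial>lborel) - I A"
        unfolding I_def using gA by (simp add: Bochner_Integration.integral_diff)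
      then show "I (UNIV - A) = 0" using box0[OF ab] \<open>I A = 0\<close> by simp
    next
      fix A :: "nat \<Rightarrow> (real^'d) set"
      assume A: "disjoint_family A" "range A \<subseteq> sigma_sets UNIV (range (\<lambda>(a, b). box a b))" "\<And>i. I (A i) = 0"
      have [measurable]: "A i \<in> sets borel" for i using A(2) by (auto simp: borel_eq_box)
      have "I (\<Union>i. A i) = (\<integral>x\<in>(\<Union>i. A i \<inter> box a b). g x \<partial>lborel)"
        by (simp add: I_def set_lebesgue_integral_def Int_UN_distrib2)
      also have "\<dots> = (\<Sum>i. (\<integral>x\<in>A i \<inter> box a b. g x \<partial>lborel))"
        using A(1) by (intro lebesgue_integral_countable_add)
          (auto simp: disjoint_family_on_def set_integrable_def intro!: gA)
      also have "\<dots> = 0" using A(3) by (simp add: I_def set_lebesgue_integral_def)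
      finally show "I (\<Union>i. A i) = 0" .
    qed auto
    then show "set_lebesgue_integral lborel A (\<lambda>x. indicat_real (box a b) x *\<^sub>R g x) = 0"
      by (simp add: set_lebesgue_integral_def I_def indicator_inter_arith)
  qed
  obtain D :: "(real^'d) set set" where D: "countable D" "\<And>X. X \<in> D \<Longrightarrow> X \<subseteq> \<Omega> \<and> (\<exists>a b. X = box a b)" "\<Union>D = \<Omega>"
    using open_countable_Union_open_box[OF assms(1)] by (metis PowD subsetD)
  have "AE x in lborel. \<forall>X\<in>D. indicat_real X x *\<^sub>R g x = 0"
    using D(1,2) AEbox by (subst AE_ball_countable) (auto simp del: scaleR_eq_0_iff, metis)
  then show ?thesis
  proof eventually_elim
    case (elim x)
    then show ?case using D(3) by (auto simp: indicator_def)
  qed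
qed

section \<open>Weak derivatives\<close>

abbreviation L2_sq :: "(real^'d::finite) set \<Rightarrow> (real^'d \<Rightarrow> complex) \<Rightarrow> real" where
  "L2_sq \<Omega> f \<equiv> integral\<^sup>L (lebesgue_on \<Omega>) (\<lambda>x. (cmod (f x))\<^sup>2)"

text \<open>Bridge between two measures: the definitions integrate over \<open>lebesgue_on\<close>,
  whereas translation invariance and Fubini are used for \<open>lborel\<close>.\<close>

lemma integral_lebesgue_on_eq_lborel:
  fixes F :: "'a::euclidean_space \<Rightarrow> 'b::{banach, second_countable_topology}"
  assumes "\<Omega> \<in> sets borel" "F \<in> borel_measurable borel" "\<And>x. x \<notin> \<Omega> \<Longrightarrow> F x = 0"
  shows "integrable (lebesgue_on \<Omega>) F \<longleftrightarrow> integrable lborel F"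
    "integral\<^sup>L (lebesgue_on \<Omega>) F = integral\<^sup>L lborel F"
proof -
  have e: "(\<lambda>x. indicat_real \<Omega> x *\<^sub>R F x) = F" using assms(3) by (auto simp: indicator_def)
  have O: "\<Omega> \<inter> space lebesgue \<in> sets lebesgue" using assms(1) by simp
  show "integrable (lebesgue_on \<Omega>) F \<longleftrightarrow> integrable lborel F"
    using integrable_restrict_space[OF O, of F] assms(2) by (simp add: e integrable_completion)
  show "integral\<^sup>L (lebesgue_on \<Omega>) F = integral\<^sup>L lborel F"
    using integral_restrict_space[OF O, of F] assms(2) by (simp add: e integral_completion)
qed

lemma AE_lebesgue_on_iff:
  "\<Omega> \<in> sets borel \<Longrightarrow> (AE x in lebesgue_on \<Omega>. P x) \<longleftrightarrow> (AE x in lborel. x \<in> \<Omega> \<longrightarrow> P x)"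
  by (subst AE_restrict_space_iff) (auto simp: AE_completion_iff)

text \<open>Translates of a function, viewed jointly in the point and the shift, have to be
  measurable on a product of Borel spaces, and Lebesgue measurability does not ensure this. Hence
  the passage to a Borel function extended by 0; real and imaginary part are replaced
  separately.\<close>

lemma borel_representative:
  fixes h :: "'a::euclidean_space \<Rightarrow> complex"
  assumes O: "\<Omega> \<in> sets borel" and h: "h \<in> borel_measurable (lebesgue_on \<Omega>)"
  obtains h' where "h' \<in> borel_measurable borel" "\<And>x. x \<notin> \<Omega> \<Longrightarrow> h' x = 0"
    "AE x in lebesgue_on \<Omega>. h x = h' x"
proof -
  have H: "(\<lambda>x. if x \<in> \<Omega> then h x else 0) \<in> borel_measurable lebesgue"
    using borel_measurable_if_D h O by (simp add: borel_measurable_if lebesgue_on_UNIV_eq)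
  obtain r where r: "r \<in> borel_measurable lborel" "AE x in lborel. Re (if x \<in> \<Omega> then h x else 0) = r x"
    using completion_ex_borel_measurable_real[OF measurable_compose[OF H borel_measurable_Re]] by blast
  obtain i where i: "i \<in> borel_measurable lborel" "AE x in lborel. Im (if x \<in> \<Omega> then h x else 0) = i x"
    using completion_ex_borel_measurable_real[OF measurable_compose[OF H borel_measurable_Im]] by blast
  define h' where "h' x = (if x \<in> \<Omega> then Complex (r x) (i x) else 0)" for x
  have "(\<lambda>x. complex_of_real (r x) + \<i> * complex_of_real (i x)) \<in> borel_measurable borel"
    using r(1) i(1) by simp
  then have "h' \<in> borel_measurable borel"
    unfolding h'_def Complex_eq using O by (intro measurable_If_set) auto
  moreover have "AE x in lborel. x \<in> \<Omega> \<longrightarrow> h x = h' x"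
    using r(2) i(2) by eventually_elim (auto simp: h'_def complex_eq_iff)
  ultimately show ?thesis using that[of h'] O by (simp add: AE_lebesgue_on_iff h'_def)
qed

section \<open>Integration by parts against test functions\<close>

lemma test_fun_eq_0: "test_fun \<Omega> \<phi> \<Longrightarrow> x \<notin> \<Omega> \<Longrightarrow> \<phi> x = 0"
  using closure_subset[of "{x. \<phi> x \<noteq> 0}"] by (auto simp: test_fun_def)

lemma test_fun_smooth: "test_fun \<Omega> \<phi> \<Longrightarrow> smooth_fun \<phi>" by (simp add: test_fun_def)

lemma frechet_derivative_eq_0_off_support:
  assumes "x \<notin> closure {x. \<phi> x \<noteq> 0}"
  shows "frechet_derivative \<phi> (at x) = (\<lambda>_. 0)"
proof -
  have "((\<lambda>_. 0) has_derivative (\<lambda>_. 0)) (at x)" by simp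
  then have "(\<phi> has_derivative (\<lambda>_. 0)) (at x)"
    by (rule has_derivative_transform_within_open[of _ _ _ _ "- closure {x. \<phi> x \<noteq> 0}"])
      (use assms closure_subset[of "{x. \<phi> x \<noteq> 0}"] in auto)
  then show ?thesis by (metis frechet_derivative_at)
qed

lemma pderiv_cl_eq_0_off_support: "x \<notin> closure {x. \<phi> x \<noteq> 0} \<Longrightarrow> pderiv_cl k \<phi> x = 0"
  by (simp add: pderiv_cl_def frechet_derivative_eq_0_off_support)

lemma pderiv_cl_eq_0: "test_fun \<Omega> \<phi> \<Longrightarrow> x \<notin> \<Omega> \<Longrightarrow> pderiv_cl k \<phi> x = 0"
  by (rule pderiv_cl_eq_0_off_support) (auto simp: test_fun_def)

lemma continuous_on_pderiv_cl: "smooth_fun \<phi> \<Longrightarrow> continuous_on S (pderiv_cl k \<phi>)"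
  unfolding pderiv_cl_def
  by (intro smooth_fun_continuous_on smooth_fun_frechet_derivative axis_in_Basis_iff[THEN iffD2]) simp_all

lemma continuous_compact_support_bounded:
  fixes f :: "'a::euclidean_space \<Rightarrow> 'b::real_normed_vector"
  assumes "continuous_on UNIV f" "compact K" "\<And>x. x \<notin> K \<Longrightarrow> f x = 0"
  obtains B where "B \<ge> 0" "\<And>x. norm (f x) \<le> B"
proof -
  have "bounded (f ` K)"
    using assms continuous_on_subset by (intro compact_imp_bounded compact_continuous_image) blast+
  then obtain B where B: "\<And>x. x \<in> K \<Longrightarrow> norm (f x) \<le> B" by (auto simp: bounded_iff)
  have "norm (f x) \<le> max B 0" for x using B[of x] assms(3)[of x] by (cases "x \<in> K") auto
  then show ?thesis using that[of "max B 0"] by auto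
qed

lemma test_fun_bounded:
  assumes "test_fun \<Omega> \<phi>"
  obtains B where "B \<ge> 0" "\<And>x. \<bar>\<phi> x\<bar> \<le> B"
proof -
  have "\<phi> x = 0" if "x \<notin> closure {x. \<phi> x \<noteq> 0}" for x
    using that closure_subset[of "{x. \<phi> x \<noteq> 0}"] by auto
  moreover have "continuous_on UNIV \<phi>" "compact (closure {x. \<phi> x \<noteq> 0})"
    using assms by (simp_all add: test_fun_def smooth_fun_continuous_on)
  ultimately obtain B where "B \<ge> 0" "\<And>x. norm (\<phi> x) \<le> B"
    using continuous_compact_support_bounded by metis
  then show ?thesis using that[of B] by simp
qed

lemma pderiv_cl_bounded:
  assumes "test_fun \<Omega> \<phi>"
  obtains B where "B \<ge> 0" "\<And>x. \<bar>pderiv_cl k \<phi> x\<bar> \<le> B"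
proof -
  have "continuous_on UNIV (pderiv_cl k \<phi>)" "compact (closure {x. \<phi> x \<noteq> 0})"
    using assms by (simp_all add: test_fun_def continuous_on_pderiv_cl)
  then obtain B where "B \<ge> 0" "\<And>x. norm (pderiv_cl k \<phi> x) \<le> B"
    using continuous_compact_support_bounded pderiv_cl_eq_0_off_support by metis
  then show ?thesis using that[of B] by simp
qed

lemma lborel_distr_plus_right: "distr lborel borel (\<lambda>x. x + v) = (lborel :: 'a::euclidean_space measure)"
proof -
  have "(+) v = (\<lambda>x. x + v)" by (simp add: fun_eq_iff add.commute)
  then show ?thesis using lborel_distr_plus[of v] by simp
qed

lemma lborel_integrable_translate:
  fixes f :: "'a::euclidean_space \<Rightarrow> 'b::{banach, second_countable_topology}"
  assumes "f \<in> borel_measurable borel"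
  shows "integrable lborel (\<lambda>x. f (x + v)) \<longleftrightarrow> integrable lborel f"
  using integrable_distr_eq[of "\<lambda>x. x + v" lborel borel f] assms by (simp add: lborel_distr_plus_right)

lemma lborel_integral_translate:
  fixes f :: "'a::euclidean_space \<Rightarrow> 'b::{banach, second_countable_topology}"
  assumes "f \<in> borel_measurable borel"
  shows "(\<integral>x. f (x + v) \<partial>lborel) = (\<integral>x. f x \<partial>lborel)"
  using integral_distr[of "\<lambda>x. x + v" lborel borel f] assms by (simp add: lborel_distr_plus_right)

lemma lborel_nn_integral_translate:
  fixes f :: "'a::euclidean_space \<Rightarrow> ennreal"
  assumes "f \<in> borel_measurable borel"
  shows "(\<integral>\<^sup>+x. f (x + v) \<partial>lborel) = (\<integral>\<^sup>+x. f x \<partial>lborel)"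
  using nn_integral_distr[of "\<lambda>x. x + v" lborel borel f] assms by (simp add: lborel_distr_plus_right)

text \<open>The integral of the difference quotients vanishes by translation invariance.\<close>

lemma integral_directional_derivative_eq_0:
  fixes \<psi> \<psi>' :: "'a::euclidean_space \<Rightarrow> complex"
  assumes K: "compact K" "\<And>x. x \<notin> K \<Longrightarrow> \<psi> x = 0" "\<And>x. x \<notin> K \<Longrightarrow> \<psi>' x = 0"
    and d: "\<And>x. ((\<lambda>t. \<psi> (x + t *\<^sub>R e)) has_vector_derivative \<psi>' x) (at 0)"
    and c: "continuous_on UNIV \<psi>" "continuous_on UNIV \<psi>'"
  shows "(\<integral>x. \<psi>' x \<partial>lborel) = 0"
proof -
  obtain B where B: "B \<ge> 0" "\<And>x. norm (\<psi>' x) \<le> B"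
    using continuous_compact_support_bounded[OF c(2) K(1,3)] by auto
  have [measurable]: "\<psi> \<in> borel_measurable borel" "\<psi>' \<in> borel_measurable borel"
    using c by (auto intro: borel_measurable_continuous_onI)
  define h where "h n = 1 / real (Suc n)" for n
  have h: "h n > 0" "h n \<le> 1" for n by (auto simp: h_def)
  have h0: "h \<longlonglongrightarrow> 0" unfolding h_def using LIMSEQ_inverse_real_of_nat by (simp add: inverse_eq_divide)
  define q where "q n x = (\<psi> (x + h n *\<^sub>R e) - \<psi> x) /\<^sub>R h n" for n x
  have int: "integrable lborel \<psi>"
  proof -
    have "integrable lborel (\<lambda>x. indicator K x *\<^sub>R \<psi> x)"
      using borel_integrable_compact[OF K(1) continuous_on_subset[OF c(1)]] by simp
    also have "(\<lambda>x. indicator K x *\<^sub>R \<psi> x) = \<psi>" using K(2) by (auto simp: indicator_def)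
    finally show ?thesis .
  qed
  have tr: "integrable lborel (\<lambda>x. \<psi> (x + v))" "(\<integral>x. \<psi> (x + v) \<partial>lborel) = (\<integral>x. \<psi> x \<partial>lborel)" for v
    using int by (simp_all add: lborel_integrable_translate lborel_integral_translate)
  have q0: "(\<integral>x. q n x \<partial>lborel) = 0" for n
    unfolding q_def using tr int by (simp add: Bochner_Integration.integral_diff)
  \<comment> \<open>\<open>K'\<close> contains the support of every difference quotient with step at
    most 1, so a multiple of its indicator dominates all of them.\<close>
  define K' where "K' = (\<lambda>(x, t). x - t *\<^sub>R e) ` (K \<times> {0..1::real})"
  have K'I: "x - t *\<^sub>R e \<in> K'" if "x \<in> K" "0 \<le> t" "t \<le> 1" for x t using that by (auto simp: K'_def)
  have K': "compact K'"
    unfolding K'_def by (intro compact_continuous_image compact_Times K(1) compact_Icc)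
      (auto intro!: continuous_intros simp: case_prod_beta)
  have sub: "K \<subseteq> K'" using K'I[of _ 0] by auto
  have lip: "norm (q n x) \<le> B" for n x
  proof -
    have der: "((\<lambda>t. \<psi> (x + t *\<^sub>R e)) has_vector_derivative \<psi>' (x + t *\<^sub>R e)) (at t)" for t
    proof -
      have "((\<lambda>s. s - t) has_vector_derivative 1) (at t)" by (auto intro!: derivative_eq_intros)
      from vector_diff_chain_at[OF this, of "\<lambda>s. \<psi> ((x + t *\<^sub>R e) + s *\<^sub>R e)"] d[of "x + t *\<^sub>R e"]
      show ?thesis by (simp add: o_def algebra_simps)
    qed
    have "norm (\<psi> (x + h n *\<^sub>R e) - \<psi> (x + 0 *\<^sub>R e)) \<le> B * norm (h n - 0)"
    proof (rule differentiable_bound[where S = UNIV and f = "\<lambda>t. \<psi> (x + t *\<^sub>R e)" and f' = "\<lambda>t s. s *\<^sub>R \<psi>' (x + t *\<^sub>R e)"])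
      fix t :: real
      show "((\<lambda>t. \<psi> (x + t *\<^sub>R e)) has_derivative (\<lambda>s. s *\<^sub>R \<psi>' (x + t *\<^sub>R e))) (at t within UNIV)"
        using der[of t] by (simp add: has_vector_derivative_def)
      show "onorm (\<lambda>s. s *\<^sub>R \<psi>' (x + t *\<^sub>R e)) \<le> B"
        by (rule onorm_le) (use mult_right_mono[OF B(2) abs_ge_zero] in \<open>simp add: mult.commute\<close>)
    qed auto
    then show ?thesis using h[of n] 
      by (simp add: q_def divide_le_eq flip: divide_inverse_commute)
  qed
  have dom: "norm (q n x) \<le> indicator K' x * B" for n x
  proof (cases "x \<in> K'")
    case False
    then have "x \<notin> K" "x + h n *\<^sub>R e \<notin> K" using sub h[of n] K'I[of "x + h n *\<^sub>R e" "h n"] by auto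
    then show ?thesis using K(2) False by (simp add: q_def)
  qed (use lip in simp)
  have "(\<lambda>n. \<integral>x. q n x \<partial>lborel) \<longlonglongrightarrow> (\<integral>x. \<psi>' x \<partial>lborel)"
  proof (rule integral_dominated_convergence[where w = "\<lambda>x. indicator K' x * B"])
    show "integrable lborel (\<lambda>x. indicator K' x * B)"
      using borel_integrable_compact[OF K', of "\<lambda>_. B"] by simp
    show "AE x in lborel. (\<lambda>n. q n x) \<longlonglongrightarrow> \<psi>' x"
    proof (intro AE_I2)
      fix x
      have "((\<lambda>s. (\<psi> (x + s *\<^sub>R e) - \<psi> x) /\<^sub>R s) \<longlongrightarrow> \<psi>' x) (at 0)"
      proof (rule LIM_zero_cancel, rule tendsto_norm_zero_cancel)
        have "((\<lambda>s. norm (\<psi> (x + s *\<^sub>R e) - \<psi> x - s *\<^sub>R \<psi>' x) / norm s) \<longlongrightarrow> 0) (at 0)"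
          using d[of x] by (simp add: has_vector_derivative_def has_derivative_at)
        then show "((\<lambda>s. norm ((\<psi> (x + s *\<^sub>R e) - \<psi> x) /\<^sub>R s - \<psi>' x)) \<longlongrightarrow> 0) (at 0)"
        proof (rule Lim_transform_eventually)
          have "norm (\<psi> (x + s *\<^sub>R e) - \<psi> x - s *\<^sub>R \<psi>' x) / norm s
            = norm ((\<psi> (x + s *\<^sub>R e) - \<psi> x) /\<^sub>R s - \<psi>' x)" if "s \<noteq> 0" for s
          proof -
            have "(\<psi> (x + s *\<^sub>R e) - \<psi> x) /\<^sub>R s - \<psi>' x = (\<psi> (x + s *\<^sub>R e) - \<psi> x - s *\<^sub>R \<psi>' x) /\<^sub>R s"
              using that by (simp add: scaleR_diff_right)
            then show ?thesis by (simp add: divide_inverse mult.commute)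
          qed
          then show "\<forall>\<^sub>F s in at 0. norm (\<psi> (x + s *\<^sub>R e) - \<psi> x - s *\<^sub>R \<psi>' x) / norm s
            = norm ((\<psi> (x + s *\<^sub>R e) - \<psi> x) /\<^sub>R s - \<psi>' x)"
            by (auto simp: eventually_at_filter)
        qed
      qed
      moreover have "filterlim h (at 0) sequentially"
        using h0 h by (intro filterlim_atI) (auto intro!: always_eventually simp: order_less_imp_not_eq2)
      ultimately show "(\<lambda>n. q n x) \<longlonglongrightarrow> \<psi>' x" unfolding q_def by (rule filterlim_compose)
    qed
    show "AE x in lborel. norm (q n x) \<le> indicator K' x * B" for n using dom by auto
  qed (auto simp: q_def)
  then show ?thesis by (simp add: q0 LIMSEQ_const_iff)
qed

lemma pderiv_cl_has_vector_derivative: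
  assumes "smooth_fun \<phi>"
  shows "((\<lambda>t. \<phi> (x + t *\<^sub>R axis k 1)) has_vector_derivative pderiv_cl k \<phi> x) (at 0)"
proof -
  have 1: "((\<lambda>t::real. x + t *\<^sub>R axis k 1) has_derivative (\<lambda>t. t *\<^sub>R axis k 1)) (at 0)"
    by (auto intro!: derivative_eq_intros)
  have 2: "(\<phi> has_derivative frechet_derivative \<phi> (at x)) (at (x + 0 *\<^sub>R axis k 1))"
    using smooth_fun_has_derivative[OF assms] by simp
  have "((\<lambda>t. \<phi> (x + t *\<^sub>R axis k 1)) has_derivative (\<lambda>t. frechet_derivative \<phi> (at x) (t *\<^sub>R axis k 1))) (at 0)"
    using has_derivative_compose[OF 1 2] .
  moreover have "linear (frechet_derivative \<phi> (at x))"
    using smooth_fun_has_derivative[OF assms] has_derivative_linear by blast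
  ultimately show ?thesis
    by (simp add: has_vector_derivative_def pderiv_cl_def linear_cmul)
qed

text \<open>The product of \<open>f\<close> with the test function has compact support, so the
  integral of its derivative along the axis is 0.\<close>

lemma integration_by_parts_test_fun:
  fixes f f' :: "real^'d::finite \<Rightarrow> complex"
  assumes \<phi>: "test_fun \<Omega> \<phi>"
    and d: "\<And>x. ((\<lambda>t. f (x + t *\<^sub>R axis k 1)) has_vector_derivative f' x) (at 0)"
    and c: "continuous_on UNIV f" "continuous_on UNIV f'"
  shows "(\<integral>x. f x * complex_of_real (pderiv_cl k \<phi> x) \<partial>lborel) = - (\<integral>x. f' x * complex_of_real (\<phi> x) \<partial>lborel)"
proof -
  define K where "K = closure {x. \<phi> x \<noteq> 0}"
  have K: "compact K" using \<phi> by (simp add: test_fun_def K_def)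
  have z: "\<phi> x = 0" "pderiv_cl k \<phi> x = 0" if "x \<notin> K" for x
    using that closure_subset[of "{x. \<phi> x \<noteq> 0}"] pderiv_cl_eq_0_off_support by (auto simp: K_def)
  note c' = test_fun_continuous_on[OF \<phi>, of UNIV] continuous_on_pderiv_cl[OF test_fun_smooth[OF \<phi>], of UNIV k]
  have i1: "integrable lborel g" if "continuous_on UNIV g" "\<And>x. x \<notin> K \<Longrightarrow> g x = 0" for g :: "real^'d \<Rightarrow> complex"
  proof -
    have "integrable lborel (\<lambda>x. indicator K x *\<^sub>R g x)"
      using borel_integrable_compact[OF K continuous_on_subset[OF that(1)]] by simp
    also have "(\<lambda>x. indicator K x *\<^sub>R g x) = g" using that(2) by (auto simp: indicator_def)
    finally show ?thesis .
  qed
  have "(\<integral>x. f x * complex_of_real (pderiv_cl k \<phi> x) + f' x * complex_of_real (\<phi> x) \<partial>lborel) = 0"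
  proof (rule integral_directional_derivative_eq_0[OF K, where \<psi> = "\<lambda>x. f x * complex_of_real (\<phi> x)" and e = "axis k 1"])
    fix x
    have "((\<lambda>t. complex_of_real (\<phi> (x + t *\<^sub>R axis k 1))) has_vector_derivative complex_of_real (pderiv_cl k \<phi> x)) (at 0)"
      using pderiv_cl_has_vector_derivative[OF test_fun_smooth[OF \<phi>]]
      by (rule bounded_linear.has_vector_derivative[OF bounded_linear_of_real])
    from has_vector_derivative_mult[OF d[of x] this]
    show "((\<lambda>t. f (x + t *\<^sub>R axis k 1) * complex_of_real (\<phi> (x + t *\<^sub>R axis k 1))) has_vector_derivative
       f x * complex_of_real (pderiv_cl k \<phi> x) + f' x * complex_of_real (\<phi> x)) (at 0)" by simp
  qed (use z in \<open>auto intro!: continuous_intros c c'\<close>)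
  moreover have "integrable lborel (\<lambda>x. f x * complex_of_real (pderiv_cl k \<phi> x))"
    "integrable lborel (\<lambda>x. f' x * complex_of_real (\<phi> x))"
    using z by (auto intro!: i1 continuous_intros c c')
  ultimately show ?thesis by (simp add: add_eq_0_iff2)
qed

lemma is_weak_deriv_classical:
  fixes f f' :: "real^'d::finite \<Rightarrow> complex"
  assumes O: "open \<Omega>"
    and d: "\<And>x. ((\<lambda>t. f (x + t *\<^sub>R axis k 1)) has_vector_derivative f' x) (at 0)"
    and c: "continuous_on UNIV f" "continuous_on UNIV f'"
  shows "is_weak_deriv \<Omega> k f f'"
  unfolding is_weak_deriv_def
proof (intro allI impI)
  fix \<phi> assume \<phi>: "test_fun \<Omega> \<phi>"
  have "continuous_on UNIV (\<lambda>x. f x * complex_of_real (pderiv_cl k \<phi> x))"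
    "continuous_on UNIV (\<lambda>x. f' x * complex_of_real (\<phi> x))"
    by (auto intro!: continuous_intros c test_fun_continuous_on[OF \<phi>] continuous_on_pderiv_cl test_fun_smooth[OF \<phi>])
  then have "(\<lambda>x. f x * complex_of_real (pderiv_cl k \<phi> x)) \<in> borel_measurable borel"
    "(\<lambda>x. f' x * complex_of_real (\<phi> x)) \<in> borel_measurable borel"
    by (auto intro: borel_measurable_continuous_onI)
  then show "integral\<^sup>L (lebesgue_on \<Omega>) (\<lambda>x. f x * complex_of_real (pderiv_cl k \<phi> x))
      = - integral\<^sup>L (lebesgue_on \<Omega>) (\<lambda>x. f' x * complex_of_real (\<phi> x))"
    using integration_by_parts_test_fun[OF \<phi> d c] test_fun_eq_0[OF \<phi>] pderiv_cl_eq_0[OF \<phi>] O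
    by (subst (1 2) integral_lebesgue_on_eq_lborel(2)) auto
qed

section \<open>Square integrable functions and uniqueness of weak derivatives\<close>

lemma L2_measurable: "L2 \<Omega> f \<Longrightarrow> f \<in> borel_measurable (lebesgue_on \<Omega>)"
  by (simp add: L2_def)

lemma L2_integrable_mult:
  fixes f g :: "real^'d::finite \<Rightarrow> complex"
  assumes "L2 \<Omega> f" "L2 \<Omega> g"
  shows "integrable (lebesgue_on \<Omega>) (\<lambda>x. f x * g x)"
proof (rule Bochner_Integration.integrable_bound)
  show "integrable (lebesgue_on \<Omega>) (\<lambda>x. (norm (f x))\<^sup>2 + (norm (g x))\<^sup>2)"
    using assms by (simp add: L2_def)
  show "(\<lambda>x. f x * g x) \<in> borel_measurable (lebesgue_on \<Omega>)"
    using assms by (intro borel_measurable_times L2_measurable)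
  have "norm (f x * g x) \<le> norm ((norm (f x))\<^sup>2 + (norm (g x))\<^sup>2)" for x
  proof -
    have "0 \<le> norm (f x) * norm (g x)" by simp
    then have "norm (f x) * norm (g x) \<le> (norm (f x))\<^sup>2 + (norm (g x))\<^sup>2"
      using sum_squares_bound[of "norm (f x)" "norm (g x)"] by linarith
    then show ?thesis by (simp add: norm_mult)
  qed
  then show "AE x in lebesgue_on \<Omega>. norm (f x * g x) \<le> norm ((norm (f x))\<^sup>2 + (norm (g x))\<^sup>2)" by simp
qed

lemma L2_cnj: "L2 \<Omega> f \<Longrightarrow> L2 \<Omega> (\<lambda>x. cnj (f x))"
  using measurable_compose[of f "lebesgue_on \<Omega>" borel cnj borel]
    borel_measurable_continuous_onI[OF continuous_on_cnj[OF continuous_on_id]]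
  by (simp add: L2_def)

lemma L2_scale: "L2 \<Omega> f \<Longrightarrow> L2 \<Omega> (\<lambda>x. c * f x :: complex)"
  using borel_measurable_times[OF borel_measurable_const[of c] L2_measurable]
  by (simp add: L2_def norm_mult power_mult_distrib)

lemma L2_add:
  fixes f g :: "real^'d::finite \<Rightarrow> 'b::euclidean_space"
  assumes "L2 \<Omega> f" "L2 \<Omega> g"
  shows "L2 \<Omega> (\<lambda>x. f x + g x)"
  unfolding L2_def
proof
  show m: "(\<lambda>x. f x + g x) \<in> borel_measurable (lebesgue_on \<Omega>)"
    using assms by (intro borel_measurable_add L2_measurable)
  show "integrable (lebesgue_on \<Omega>) (\<lambda>x. (norm (f x + g x))\<^sup>2)"
  proof (rule Bochner_Integration.integrable_bound)
    show "integrable (lebesgue_on \<Omega>) (\<lambda>x. 2 * (norm (f x))\<^sup>2 + 2 * (norm (g x))\<^sup>2)"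
      using assms by (simp add: L2_def)
    have "(norm (f x + g x))\<^sup>2 \<le> 2 * (norm (f x))\<^sup>2 + 2 * (norm (g x))\<^sup>2" for x
    proof -
      have "(norm (f x + g x))\<^sup>2 \<le> (norm (f x) + norm (g x))\<^sup>2"
        by (intro power_mono norm_triangle_ineq) simp
      also have "\<dots> \<le> 2 * (norm (f x))\<^sup>2 + 2 * (norm (g x))\<^sup>2"
        using sum_squares_bound[of "norm (f x)" "norm (g x)"] by (simp add: power2_sum)
      finally show ?thesis .
    qed
    then show "AE x in lebesgue_on \<Omega>. norm ((norm (f x + g x))\<^sup>2) \<le> norm (2 * (norm (f x))\<^sup>2 + 2 * (norm (g x))\<^sup>2)"
      by simp
  qed (use m in measurable)
qed

lemma L2_uminus: "L2 \<Omega> f \<Longrightarrow> L2 \<Omega> (\<lambda>x. - f x)"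
  by (simp add: L2_def)

lemma L2_diff: "L2 \<Omega> f \<Longrightarrow> L2 \<Omega> g \<Longrightarrow> L2 \<Omega> (\<lambda>x. f x - g x)"
  using L2_add[of \<Omega> f "\<lambda>x. - g x"] by (simp add: L2_uminus)

lemma L2_sum: "finite I \<Longrightarrow> (\<And>i. i \<in> I \<Longrightarrow> L2 \<Omega> (f i)) \<Longrightarrow> L2 \<Omega> (\<lambda>x. \<Sum>i\<in>I. f i x)"
  by (induction I rule: finite_induct) (simp add: L2_def, simp add: L2_add)

lemma L2_bounded:
  fixes f :: "real^'d::finite \<Rightarrow> 'b::euclidean_space"
  assumes "bounded \<Omega>" "open \<Omega>" "f \<in> borel_measurable (lebesgue_on \<Omega>)" "\<And>x. x \<in> \<Omega> \<Longrightarrow> norm (f x) \<le> B"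
  shows "L2 \<Omega> f"
proof -
  have fin: "finite_measure (lebesgue_on \<Omega>)"
    using assms(1,2) by (intro finite_measure_lebesgue_on) (simp add: lmeasurable_open)
  have "integrable (lebesgue_on \<Omega>) (\<lambda>x. (norm (f x))\<^sup>2)"
  proof (rule finite_measure.integrable_const_bound[OF fin, of _ "B\<^sup>2"])
    show "AE x in lebesgue_on \<Omega>. norm ((norm (f x))\<^sup>2) \<le> B\<^sup>2"
      using assms(4) by (intro AE_I2) (auto intro!: power_mono)
  qed (use assms(3) in measurable)
  then show ?thesis using assms by (simp add: L2_def)
qed

lemma L2_integrable:
  fixes f :: "real^'d::finite \<Rightarrow> complex"
  assumes "bounded \<Omega>" "open \<Omega>" "L2 \<Omega> f"
  shows "integrable (lebesgue_on \<Omega>) f"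
  using L2_integrable_mult[OF assms(3) L2_bounded[OF assms(1,2), of "\<lambda>_. 1" 1]] by simp

lemma L2_test_fun:
  assumes "bounded \<Omega>" "open \<Omega>" "test_fun \<Omega> \<phi>"
  shows "L2 \<Omega> (\<lambda>x. complex_of_real (\<phi> x))" "L2 \<Omega> (\<lambda>x. complex_of_real (pderiv_cl k \<phi> x))"
proof -
  obtain B where "\<And>x. \<bar>\<phi> x\<bar> \<le> B" using test_fun_bounded[OF assms(3)] by blast
  moreover have "continuous_on \<Omega> (\<lambda>x. complex_of_real (\<phi> x))"
    by (intro continuous_intros test_fun_continuous_on[OF assms(3)])
  ultimately show "L2 \<Omega> (\<lambda>x. complex_of_real (\<phi> x))"
    using assms by (intro L2_bounded[of _ _ B] continuous_imp_measurable_on_sets_lebesgue) auto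
  obtain B where "\<And>x. \<bar>pderiv_cl k \<phi> x\<bar> \<le> B" using pderiv_cl_bounded[OF assms(3)] by blast
  moreover have "continuous_on \<Omega> (\<lambda>x. complex_of_real (pderiv_cl k \<phi> x))"
    by (intro continuous_intros continuous_on_pderiv_cl test_fun_smooth[OF assms(3)])
  ultimately show "L2 \<Omega> (\<lambda>x. complex_of_real (pderiv_cl k \<phi> x))"
    using assms by (intro L2_bounded[of _ _ B] continuous_imp_measurable_on_sets_lebesgue) auto
qed

lemma AE_eq_0_if_orthogonal_test_funs:
  fixes h :: "real^'d::finite \<Rightarrow> complex"
  assumes O: "bounded \<Omega>" "open \<Omega>" and h: "L2 \<Omega> h"
    and zero: "\<And>\<phi>. test_fun \<Omega> \<phi> \<Longrightarrow> integral\<^sup>L (lebesgue_on \<Omega>) (\<lambda>x. h x * complex_of_real (\<phi> x)) = 0"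
  shows "AE x in lebesgue_on \<Omega>. h x = 0"
proof -
  have Ob: "\<Omega> \<in> sets borel" using O by simp
  obtain h' where h': "h' \<in> borel_measurable borel" "\<And>x. x \<notin> \<Omega> \<Longrightarrow> h' x = 0"
    "AE x in lebesgue_on \<Omega>. h x = h' x" using borel_representative[OF Ob L2_measurable[OF h]] by blast
  have hm: "h' \<in> borel_measurable (lebesgue_on \<Omega>)"
    using h'(1) by (intro measurable_restrict_space1 measurable_completion) simp
  have "integrable (lebesgue_on \<Omega>) h'"
    using L2_integrable[OF O h] h'(3) hm L2_measurable[OF h] by (subst integrable_cong_AE[of h' _ h]) auto
  then have int: "integrable lborel h'"
    using integral_lebesgue_on_eq_lborel(1)[OF Ob h'(1,2)] by simp
  have "AE x in lborel. x \<in> \<Omega> \<longrightarrow> h' x = 0"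
  proof (rule fundamental_lemma_lborel[OF O(2) int])
    fix \<phi> assume \<phi>: "test_fun \<Omega> \<phi>"
    have pm: "\<phi> \<in> borel_measurable borel"
      by (intro borel_measurable_continuous_onI test_fun_continuous_on[OF \<phi>])
    then have pm': "(\<lambda>x. complex_of_real (\<phi> x)) \<in> borel_measurable (lebesgue_on \<Omega>)"
      by (intro measurable_restrict_space1 measurable_completion) simp
    have "(\<integral>x. h' x * complex_of_real (\<phi> x) \<partial>lborel) = integral\<^sup>L (lebesgue_on \<Omega>) (\<lambda>x. h' x * complex_of_real (\<phi> x))"
      using h' Ob pm by (subst integral_lebesgue_on_eq_lborel(2)) auto
    also have "\<dots> = integral\<^sup>L (lebesgue_on \<Omega>) (\<lambda>x. h x * complex_of_real (\<phi> x))"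
      using h'(3) hm pm' L2_measurable[OF h] by (intro integral_cong_AE) auto
    finally show "(\<integral>x. h' x * complex_of_real (\<phi> x) \<partial>lborel) = 0" using zero[OF \<phi>] by simp
  qed
  then have "AE x in lebesgue_on \<Omega>. h' x = 0" using Ob by (simp add: AE_lebesgue_on_iff)
  with h'(3) show ?thesis by eventually_elim simp
qed

lemma is_weak_deriv_lincomb:
  assumes O: "bounded \<Omega>" "open \<Omega>"
    and L: "L2 \<Omega> f1" "L2 \<Omega> g1" "L2 \<Omega> f2" "L2 \<Omega> g2"
    and w: "is_weak_deriv \<Omega> k f1 g1" "is_weak_deriv \<Omega> k f2 g2"
  shows "is_weak_deriv \<Omega> k (\<lambda>x. c * f1 x + f2 x) (\<lambda>x. c * g1 x + g2 x)"
  unfolding is_weak_deriv_def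
proof (intro allI impI)
  fix \<phi> assume \<phi>: "test_fun \<Omega> \<phi>"
  note i = L2_integrable_mult[OF _ L2_test_fun(1)[OF O \<phi>]] L2_integrable_mult[OF _ L2_test_fun(2)[OF O \<phi>, of k]]
  show "integral\<^sup>L (lebesgue_on \<Omega>) (\<lambda>x. (c * f1 x + f2 x) * complex_of_real (pderiv_cl k \<phi> x)) =
    - integral\<^sup>L (lebesgue_on \<Omega>) (\<lambda>x. (c * g1 x + g2 x) * complex_of_real (\<phi> x))"
    using w \<phi> i[OF L(1)] i[OF L(2)] i[OF L(3)] i[OF L(4)]
    by (simp add: is_weak_deriv_def ring_distribs mult.assoc)
qed

lemma is_weak_deriv_unique:
  assumes O: "bounded \<Omega>" "open \<Omega>"
    and L: "L2 \<Omega> g1" "L2 \<Omega> g2" and w: "is_weak_deriv \<Omega> k f g1" "is_weak_deriv \<Omega> k f g2"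
  shows "AE x in lebesgue_on \<Omega>. g1 x = g2 x"
proof -
  have "AE x in lebesgue_on \<Omega>. g1 x - g2 x = 0"
  proof (rule AE_eq_0_if_orthogonal_test_funs[OF O L2_diff[OF L]])
    fix \<phi> assume \<phi>: "test_fun \<Omega> \<phi>"
    note i = L2_integrable_mult[OF _ L2_test_fun(1)[OF O \<phi>]]
    show "integral\<^sup>L (lebesgue_on \<Omega>) (\<lambda>x. (g1 x - g2 x) * complex_of_real (\<phi> x)) = 0"
      using w \<phi> i[OF L(1)] i[OF L(2)] by (simp add: is_weak_deriv_def left_diff_distrib)
  qed
  then show ?thesis by simp
qed

lemma H1_wd:
  assumes "H1 \<Omega> u"
  shows "L2 \<Omega> (wd \<Omega> k l u)" "is_weak_deriv \<Omega> k (\<lambda>x. u x $ l) (wd \<Omega> k l u)"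
proof -
  have "L2 \<Omega> (wd \<Omega> k l u) \<and> is_weak_deriv \<Omega> k (\<lambda>x. u x $ l) (wd \<Omega> k l u)"
    unfolding wd_def
    using assms someI_ex[of "\<lambda>g. L2 \<Omega> g \<and> is_weak_deriv \<Omega> k (\<lambda>x. u x $ l) g"] by (simp add: H1_def)
  then show "L2 \<Omega> (wd \<Omega> k l u)" "is_weak_deriv \<Omega> k (\<lambda>x. u x $ l) (wd \<Omega> k l u)" by auto
qed

text \<open>\<open>wd\<close> is a choice among representatives and therefore known only up to null
  sets. Concrete weak derivatives are computed through this identification.\<close>

lemma wd_eqI:
  assumes O: "bounded \<Omega>" "open \<Omega>" and g: "L2 \<Omega> g" "is_weak_deriv \<Omega> k (\<lambda>x. u x $ l) g"
  shows "AE x in lebesgue_on \<Omega>. wd \<Omega> k l u x = g x"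
proof -
  have "L2 \<Omega> (wd \<Omega> k l u) \<and> is_weak_deriv \<Omega> k (\<lambda>x. u x $ l) (wd \<Omega> k l u)"
    unfolding wd_def
    using g someI_ex[of "\<lambda>g. L2 \<Omega> g \<and> is_weak_deriv \<Omega> k (\<lambda>x. u x $ l) g"] by blast
  then show ?thesis using is_weak_deriv_unique[OF O _ g(1) _ g(2)] by blast
qed

lemma L2_vec_iff:
  fixes u :: "real^'d::finite \<Rightarrow> complex^'n::finite"
  shows "L2 \<Omega> u \<longleftrightarrow> (\<forall>l. L2 \<Omega> (\<lambda>x. u x $ l))"
proof
  assume u: "L2 \<Omega> u"
  show "\<forall>l. L2 \<Omega> (\<lambda>x. u x $ l)"
  proof
    fix l
    have m: "(\<lambda>x. u x $ l) \<in> borel_measurable (lebesgue_on \<Omega>)"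
      using L2_measurable[OF u] by (rule measurable_compose) (intro borel_measurable_continuous_onI continuous_intros)
    have "integrable (lebesgue_on \<Omega>) (\<lambda>x. (norm (u x $ l))\<^sup>2)"
    proof (rule Bochner_Integration.integrable_bound)
      show "integrable (lebesgue_on \<Omega>) (\<lambda>x. (norm (u x))\<^sup>2)" using u by (simp add: L2_def)
      show "AE x in lebesgue_on \<Omega>. norm ((norm (u x $ l))\<^sup>2) \<le> norm ((norm (u x))\<^sup>2)"
        using Finite_Cartesian_Product.norm_nth_le by (auto intro!: power_mono)
    qed (use m in measurable)
    with m show "L2 \<Omega> (\<lambda>x. u x $ l)" by (simp add: L2_def)
  qed
next
  assume u: "\<forall>l. L2 \<Omega> (\<lambda>x. u x $ l)"
  have e: "(norm (u x))\<^sup>2 = (\<Sum>l\<in>UNIV. (norm (u x $ l))\<^sup>2)" for x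
    by (simp add: norm_vec_def L2_set_def sum_nonneg)
  have "u \<in> borel_measurable (lebesgue_on \<Omega>)"
  proof (rule borel_measurable_euclidean_space[THEN iffD2], rule ballI)
    fix b :: "complex^'n" assume "b \<in> Basis"
    then obtain i and v :: complex where b: "b = axis i v" by (auto simp: Basis_vec_def)
    show "(\<lambda>x. u x \<bullet> b) \<in> borel_measurable (lebesgue_on \<Omega>)"
      using L2_measurable[OF u[rule_format, of i]] by (simp add: b inner_axis)
  qed
  moreover have "integrable (lebesgue_on \<Omega>) (\<lambda>x. (norm (u x))\<^sup>2)"
    unfolding e using u by (intro Bochner_Integration.integrable_sum) (simp add: L2_def)
  ultimately show "L2 \<Omega> u" by (simp add: L2_def)
qed

section \<open>Translations\<close>

text \<open>Cauchy-Schwarz against the indicator of \<open>A\<close>. A Bochner integral that does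
  not exist equals 0, so the estimate in \<open>ennreal\<close> covers nonintegrable
  \<open>f\<close> too, and no finiteness has to be checked where it is applied.\<close>

lemma Cauchy_Schwarz_indicator:
  fixes f :: "'a::euclidean_space \<Rightarrow> complex"
  assumes [measurable]: "A \<in> sets borel" "f \<in> borel_measurable borel"
  shows "ennreal ((cmod (\<integral>x. indicat_real A x *\<^sub>R f x \<partial>lborel))\<^sup>2)
    \<le> emeasure lborel A * (\<integral>\<^sup>+x. indicator A x * ennreal ((cmod (f x))\<^sup>2) \<partial>lborel)"
proof -
  define J where "J = (\<integral>x. indicat_real A x *\<^sub>R f x \<partial>lborel)"
  have "ennreal (cmod J) \<le> (\<integral>\<^sup>+x. ennreal (cmod (indicat_real A x *\<^sub>R f x)) \<partial>lborel)"
  proof (cases "integrable lborel (\<lambda>x. indicat_real A x *\<^sub>R f x)")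
    case True then show ?thesis unfolding J_def by (rule integral_norm_bound_ennreal)
  qed (simp add: J_def not_integrable_integral_eq)
  also have "\<dots> = (\<integral>\<^sup>+x. indicator A x * (indicator A x * ennreal (cmod (f x))) \<partial>lborel)"
    by (intro nn_integral_cong) (auto simp: indicator_def)
  finally have le: "ennreal (cmod J) \<le> (\<integral>\<^sup>+x. indicator A x * (indicator A x * ennreal (cmod (f x))) \<partial>lborel)" .
  have "ennreal ((cmod J)\<^sup>2) = (ennreal (cmod J))\<^sup>2" by (simp add: ennreal_power)
  also have "\<dots> \<le> (\<integral>\<^sup>+x. indicator A x * (indicator A x * ennreal (cmod (f x))) \<partial>lborel)\<^sup>2"
    using le by (rule power_mono) simp
  also have "\<dots> \<le> (\<integral>\<^sup>+x. (indicator A x)\<^sup>2 \<partial>lborel) * (\<integral>\<^sup>+x. (indicator A x * ennreal (cmod (f x)))\<^sup>2 \<partial>lborel)"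
    by (rule Cauchy_Schwarz_nn_integral) measurable
  also have "(\<integral>\<^sup>+x. (indicator A x)\<^sup>2 \<partial>lborel) = (\<integral>\<^sup>+x. indicator A x \<partial>lborel)"
    by (intro nn_integral_cong) (auto simp: indicator_def)
  also have "\<dots> = emeasure lborel A" by simp
  also have "(\<integral>\<^sup>+x. (indicator A x * ennreal (cmod (f x)))\<^sup>2 \<partial>lborel)
    = (\<integral>\<^sup>+x. indicator A x * ennreal ((cmod (f x))\<^sup>2) \<partial>lborel)"
    by (intro nn_integral_cong) (auto simp: indicator_def ennreal_power)
  finally show ?thesis by (simp add: J_def)
qed

lemma pderiv_cl_translate:
  assumes "smooth_fun \<phi>"
  shows "pderiv_cl k (\<lambda>x. \<phi> (x + c)) x = pderiv_cl k \<phi> (x + c)"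
  using frechet_derivative_at[OF has_derivative_translate[OF smooth_fun_has_derivative[OF assms, of "x + c"]]]
  by (simp add: pderiv_cl_def)

lemma test_fun_translate:
  assumes \<phi>: "test_fun S \<phi>" and S: "\<And>x. x \<in> S \<Longrightarrow> x - c \<in> \<Omega>"
  shows "test_fun \<Omega> (\<lambda>x. \<phi> (x + c))"
proof -
  define K where "K = closure {x. \<phi> x \<noteq> 0}"
  have "{x. \<phi> (x + c) \<noteq> 0} = (\<lambda>x. - c + x) ` {x. \<phi> x \<noteq> 0}"
    by (auto simp: image_iff) (metis add.commute add_diff_cancel_left' diff_add_cancel uminus_add_conv_diff)
  then have e: "closure {x. \<phi> (x + c) \<noteq> 0} = (\<lambda>x. - c + x) ` K"
    unfolding K_def by (metis closure_translation)
  have "compact K" "K \<subseteq> S" using \<phi> by (auto simp: test_fun_def K_def)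
  then have "compact ((\<lambda>x. - c + x) ` K)" "(\<lambda>x. - c + x) ` K \<subseteq> \<Omega>"
    using S by (auto intro!: compact_continuous_image continuous_intros)
  then show ?thesis using e \<phi> by (simp add: test_fun_def smooth_fun_translate)
qed

text \<open>The functions live on the whole space so that \<open>u (x + h)\<close> is meaningful for
  every \<open>x\<close>. The derivative is seen only by test functions supported in the set and the
  values outside are arbitrary, which makes restriction to a subset immediate.\<close>

definition weak_grad :: "(real^'d::finite) set \<Rightarrow> (real^'d \<Rightarrow> complex) \<Rightarrow> ('d \<Rightarrow> real^'d \<Rightarrow> complex) \<Rightarrow> bool" where
  "weak_grad \<Omega> u g \<longleftrightarrow> integrable lborel u \<and> (\<forall>k. integrable lborel (g k)) \<and>
     (\<forall>k \<phi>. test_fun \<Omega> \<phi> \<longrightarrow> (\<integral>x. u x * complex_of_real (pderiv_cl k \<phi> x) \<partial>lborel)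
        = - (\<integral>x. g k x * complex_of_real (\<phi> x) \<partial>lborel))"

lemma test_fun_mono: "test_fun S \<phi> \<Longrightarrow> S \<subseteq> \<Omega> \<Longrightarrow> test_fun \<Omega> \<phi>"
  by (auto simp: test_fun_def)

lemma weak_grad_subset: "weak_grad \<Omega> u g \<Longrightarrow> S \<subseteq> \<Omega> \<Longrightarrow> weak_grad S u g"
  by (auto simp: weak_grad_def dest: test_fun_mono)

lemma smooth_fun_has_vector_derivative_line:
  fixes \<phi> :: "real^'d::finite \<Rightarrow> real"
  assumes "smooth_fun \<phi>"
  shows "((\<lambda>t. \<phi> (y - t *\<^sub>R h)) has_vector_derivative - (\<Sum>k\<in>UNIV. h $ k * pderiv_cl k \<phi> (y - t *\<^sub>R h))) (at t within A)"
proof -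
  let ?D = "frechet_derivative \<phi> (at (y - t *\<^sub>R h))"
  have D: "(\<phi> has_derivative ?D) (at (y - t *\<^sub>R h))" by (rule smooth_fun_has_derivative[OF assms])
  have 1: "((\<lambda>t::real. y - t *\<^sub>R h) has_derivative (\<lambda>t. - (t *\<^sub>R h))) (at t within A)"
    by (auto intro!: derivative_eq_intros)
  have "((\<lambda>t. \<phi> (y - t *\<^sub>R h)) has_derivative (\<lambda>t. ?D (- (t *\<^sub>R h)))) (at t within A)"
    by (rule has_derivative_compose[OF 1 D])
  moreover have "?D (- (s *\<^sub>R h)) = s *\<^sub>R - (\<Sum>k\<in>UNIV. h $ k * pderiv_cl k \<phi> (y - t *\<^sub>R h))" for s
  proof -
    have l: "linear ?D" using D has_derivative_linear by blast
    have "?D h = ?D (\<Sum>k\<in>UNIV. h $ k *\<^sub>R axis k 1)"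
      using basis_expansion[of h] by (simp add: scalar_mult_eq_scaleR)
    also have "\<dots> = (\<Sum>k\<in>UNIV. h $ k *\<^sub>R ?D (axis k 1))"
      using l by (simp add: linear_sum linear_cmul)
    finally have "?D h = (\<Sum>k\<in>UNIV. h $ k *\<^sub>R ?D (axis k 1))" .
    then show ?thesis using l by (simp add: linear_neg linear_cmul pderiv_cl_def)
  qed
  ultimately show ?thesis by (simp add: has_vector_derivative_def)
qed

text \<open>Justifies the exchanges of integrals below. By translation invariance the integral of
  the norm over the points does not depend on \<open>t\<close>.\<close>

lemma integrable_line_shift:
  fixes F :: "'a::euclidean_space \<Rightarrow> complex"
  assumes F: "integrable lborel F"
  shows "integrable (lborel \<Otimes>\<^sub>M lborel) (\<lambda>(t::real, x). indicat_real {0..1} t *\<^sub>R F (x + t *\<^sub>R h))"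
proof -
  have [measurable]: "F \<in> borel_measurable borel" using F by auto
  show ?thesis
  proof (rule lborel_pair.Fubini_integrable)
    show "(\<lambda>(t::real, x). indicat_real {0..1} t *\<^sub>R F (x + t *\<^sub>R h)) \<in> borel_measurable (lborel \<Otimes>\<^sub>M lborel)"
      by measurable
    have e: "(\<lambda>t::real. \<integral>y. norm (case (t, y) of (t, x) \<Rightarrow> indicat_real {0..1} t *\<^sub>R F (x + t *\<^sub>R h)) \<partial>lborel)
       = (\<lambda>t. indicat_real {0..1} t * (\<integral>y. norm (F y) \<partial>lborel))"
      using lborel_integral_translate[of "\<lambda>x. norm (F x)"] by (intro ext) simp
    show "integrable lborel (\<lambda>t::real. \<integral>y. norm (case (t, y) of (t, x) \<Rightarrow> indicat_real {0..1} t *\<^sub>R F (x + t *\<^sub>R h)) \<partial>lborel)"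
      unfolding e by simp
    show "AE t::real in lborel. integrable lborel (\<lambda>y. case (t, y) of (t, x) \<Rightarrow> indicat_real {0..1} t *\<^sub>R F (x + t *\<^sub>R h))"
      using F by (simp add: lborel_integrable_translate)
  qed
qed

text \<open>Weak fundamental theorem of calculus along the segments from \<open>x\<close> to
  \<open>x + h\<close>. By \<open>seg\<close> the shifts of a test function on \<open>S\<close>
  along these segments are test functions on the larger set; Fubini and the definition of the weak
  gradient then move the derivative to the test function, where the classical theorem
  applies.\<close>

lemma translation_identity:
  fixes u :: "real^'d::finite \<Rightarrow> complex"
  assumes w: "weak_grad \<Omega> u g" and S: "open S"
    and seg: "\<And>x t. x \<in> S \<Longrightarrow> 0 \<le> t \<Longrightarrow> t \<le> 1 \<Longrightarrow> x + t *\<^sub>R h \<in> \<Omega>"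
  shows "AE x in lborel. x \<in> S \<longrightarrow>
    u (x + h) - u x = (\<integral>t. indicat_real {0..1} t *\<^sub>R (\<Sum>k\<in>UNIV. of_real (h $ k) * g k (x + t *\<^sub>R h)) \<partial>lborel)"
proof -
  define F where "F y = (\<Sum>k\<in>UNIV. complex_of_real (h $ k) * g k y)" for y
  have u: "integrable lborel u" and g: "\<And>k. integrable lborel (g k)" using w by (auto simp: weak_grad_def)
  have F: "integrable lborel F" unfolding F_def using g by simp
  have [measurable]: "u \<in> borel_measurable borel" "F \<in> borel_measurable borel" "\<And>k. g k \<in> borel_measurable borel"
    using u F g by auto
  define P where "P = (\<lambda>(t::real, x). indicat_real {0..1} t *\<^sub>R F (x + t *\<^sub>R h))"
  have P: "integrable (lborel \<Otimes>\<^sub>M lborel) P" unfolding P_def by (rule integrable_line_shift[OF F])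
  then have Pm[measurable]: "P \<in> borel_measurable (lborel \<Otimes>\<^sub>M lborel)" by auto
  define G where "G x = (\<integral>t. P (t, x) \<partial>lborel)" for x
  have G: "integrable lborel G"
    unfolding G_def using lborel_pair.integrable_snd[of "\<lambda>t x. P (t, x)"] P by simp
  have "AE x in lborel. x \<in> S \<longrightarrow> u (x + h) - u x - G x = 0"
  proof (rule fundamental_lemma_lborel[OF S])
    have uh: "integrable lborel (\<lambda>x. u (x + h))" using u by (simp add: lborel_integrable_translate)
    show "integrable lborel (\<lambda>x. u (x + h) - u x - G x)" using uh u G by simp
    fix \<phi> assume \<phi>: "test_fun S \<phi>"
    have sm: "smooth_fun \<phi>" by (rule test_fun_smooth[OF \<phi>])
    have [measurable]: "\<phi> \<in> borel_measurable borel" "\<And>k. pderiv_cl k \<phi> \<in> borel_measurable borel"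
      by (auto intro!: borel_measurable_continuous_onI smooth_fun_continuous_on continuous_on_pderiv_cl sm)
    obtain B where B: "B \<ge> 0" "\<And>x. \<bar>\<phi> x\<bar> \<le> B" using test_fun_bounded[OF \<phi>] by blast
    have mB: "integrable lborel (\<lambda>x. f x * complex_of_real (\<phi> (x + c)))" if f: "integrable lborel f" for f c
    proof (rule Bochner_Integration.integrable_bound[of _ "\<lambda>x. B * norm (f x)"])
      show "(\<lambda>x. f x * complex_of_real (\<phi> (x + c))) \<in> borel_measurable lborel" using f by measurable
      show "AE x in lborel. norm (f x * complex_of_real (\<phi> (x + c))) \<le> norm (B * norm (f x))"
        using B by (auto simp: norm_mult abs_mult mult.commute[of B] intro!: mult_left_mono)
    qed (use f in auto)
    note mB0 = mB[where c = 0, simplified]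
    define D where "D z = (\<Sum>k\<in>UNIV. h $ k * pderiv_cl k \<phi> z)" for z
    have [measurable]: "D \<in> borel_measurable borel" unfolding D_def by measurable
    have Dc: "continuous_on UNIV D" unfolding D_def by (intro continuous_intros continuous_on_pderiv_cl sm)
    obtain B' where B': "B' \<ge> 0" "\<And>x. norm (D x) \<le> B'"
    proof (rule continuous_compact_support_bounded[OF Dc, of "closure {x. \<phi> x \<noteq> 0}"])
      show "compact (closure {x. \<phi> x \<noteq> 0})" using \<phi> by (simp add: test_fun_def)
    qed (auto simp: D_def pderiv_cl_eq_0_off_support intro!: that)
    have Pphi: "integrable (lborel \<Otimes>\<^sub>M lborel) (\<lambda>(t, x). P (t, x) * complex_of_real (\<phi> x))"
    proof (rule Bochner_Integration.integrable_bound[of _ "\<lambda>z. B * norm (P z)"])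
      show "(\<lambda>(t, x). P (t, x) * complex_of_real (\<phi> x)) \<in> borel_measurable (lborel \<Otimes>\<^sub>M lborel)" by measurable
      show "AE z in lborel \<Otimes>\<^sub>M lborel. norm (case z of (t, x) \<Rightarrow> P (t, x) * complex_of_real (\<phi> x)) \<le> norm (B * norm (P z))"
        using B by (auto simp: norm_mult abs_mult mult.commute[of B] intro!: mult_left_mono AE_I2)
    qed (use P in auto)
    define Q where "Q = (\<lambda>(t::real, y). indicat_real {0..1} t *\<^sub>R (u y * complex_of_real (D (y - t *\<^sub>R h))))"
    have Q: "integrable (lborel \<Otimes>\<^sub>M lborel) Q"
    proof (rule Bochner_Integration.integrable_bound)
      show "integrable (lborel \<Otimes>\<^sub>M lborel) (\<lambda>z. B' * norm ((\<lambda>(t::real, x). indicat_real {0..1} t *\<^sub>R u (x + t *\<^sub>R 0)) z))"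
        using integrable_line_shift[OF u, of 0] by (intro integrable_mult_right integrable_norm)
      show "Q \<in> borel_measurable (lborel \<Otimes>\<^sub>M lborel)" unfolding Q_def by measurable
      show "AE z in lborel \<Otimes>\<^sub>M lborel. norm (Q z) \<le> norm (B' * norm ((\<lambda>(t::real, x). indicat_real {0..1} t *\<^sub>R u (x + t *\<^sub>R 0)) z))"
        using B' by (auto simp: Q_def norm_mult abs_mult indicator_def mult.commute[of B'] intro!: mult_left_mono AE_I2)
    qed
    have "(\<integral>x. G x * complex_of_real (\<phi> x) \<partial>lborel) = (\<integral>x. (\<integral>t. P (t, x) * complex_of_real (\<phi> x) \<partial>lborel) \<partial>lborel)"
      unfolding G_def by simp
    also have "\<dots> = (\<integral>t. (\<integral>x. P (t, x) * complex_of_real (\<phi> x) \<partial>lborel) \<partial>lborel)"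
      using lborel_pair.integral_snd[OF Pphi] lborel_pair.integral_fst[OF Pphi] by simp
    \<comment> \<open>For fixed \<open>t\<close> the weak gradient is applied to the test function
      that has been translated along with the substitution
      \<open>y = x + t *\<^sub>R h\<close>.\<close>
    also have "\<dots> = (\<integral>t. - (\<integral>y. Q (t, y) \<partial>lborel) \<partial>lborel)"
    proof (intro Bochner_Integration.integral_cong refl)
      fix t :: real
      show "(\<integral>x. P (t, x) * complex_of_real (\<phi> x) \<partial>lborel) = - (\<integral>y. Q (t, y) \<partial>lborel)"
      proof (cases "t \<in> {0..1}")
        case True
        have tt: "test_fun \<Omega> (\<lambda>x. \<phi> (x + (- t *\<^sub>R h)))"
          by (rule test_fun_translate[OF \<phi>]) (use seg[of _ t] True in auto)
        have gk: "(\<integral>y. g k y * complex_of_real (\<phi> (y + (- t *\<^sub>R h))) \<partial>lborel)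
            = - (\<integral>y. u y * complex_of_real (pderiv_cl k \<phi> (y + (- t *\<^sub>R h))) \<partial>lborel)" for k
        proof -
          have "(\<integral>y. u y * complex_of_real (pderiv_cl k (\<lambda>x. \<phi> (x + (- t *\<^sub>R h))) y) \<partial>lborel)
            = - (\<integral>y. g k y * complex_of_real (\<phi> (y + (- t *\<^sub>R h))) \<partial>lborel)"
            using w tt unfolding weak_grad_def by blast
          then show ?thesis unfolding pderiv_cl_translate[OF sm] by simp
        qed
        have uk: "integrable lborel (\<lambda>y. u y * complex_of_real (pderiv_cl k \<phi> (y - t *\<^sub>R h)))" for k
        proof -
          obtain B2 where B2: "\<And>x. \<bar>pderiv_cl k \<phi> x\<bar> \<le> B2" using pderiv_cl_bounded[OF \<phi>] by metis
          show ?thesis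
          proof (rule Bochner_Integration.integrable_bound[of _ "\<lambda>x. B2 * norm (u x)"])
            show "AE x in lborel. norm (u x * complex_of_real (pderiv_cl k \<phi> (x - t *\<^sub>R h))) \<le> norm (B2 * norm (u x))"
              using B2 by (auto simp: norm_mult abs_mult mult.commute[of "\<bar>B2\<bar>"] intro!: mult_left_mono order_trans[OF B2 abs_ge_self])
          qed (use u in auto)
        qed
        have "(\<integral>x. P (t, x) * complex_of_real (\<phi> x) \<partial>lborel) = (\<integral>x. F (x + t *\<^sub>R h) * complex_of_real (\<phi> ((x + t *\<^sub>R h) + (- t *\<^sub>R h))) \<partial>lborel)"
          using True by (simp add: P_def)
        also have "\<dots> = (\<integral>y. F y * complex_of_real (\<phi> (y + (- t *\<^sub>R h))) \<partial>lborel)"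
          by (rule lborel_integral_translate[of "\<lambda>y. F y * complex_of_real (\<phi> (y + (- t *\<^sub>R h)))"]) measurable
        also have "\<dots> = (\<integral>y. (\<Sum>k\<in>UNIV. of_real (h $ k) * (g k y * complex_of_real (\<phi> (y + (- t *\<^sub>R h))))) \<partial>lborel)"
          by (simp add: F_def sum_distrib_right mult.assoc)
        also have "\<dots> = (\<Sum>k\<in>UNIV. of_real (h $ k) * (\<integral>y. g k y * complex_of_real (\<phi> (y + (- t *\<^sub>R h))) \<partial>lborel))"
          using mB[OF g, where c = "- t *\<^sub>R h"] by (subst Bochner_Integration.integral_sum) auto
        also have "\<dots> = - (\<Sum>k\<in>UNIV. of_real (h $ k) * (\<integral>y. u y * complex_of_real (pderiv_cl k \<phi> (y - t *\<^sub>R h)) \<partial>lborel))"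
          unfolding gk by (simp add: sum_negf)
        also have "\<dots> = - (\<integral>y. (\<Sum>k\<in>UNIV. of_real (h $ k) * (u y * complex_of_real (pderiv_cl k \<phi> (y - t *\<^sub>R h)))) \<partial>lborel)"
          using uk by (subst Bochner_Integration.integral_sum) auto
        also have "\<dots> = - (\<integral>y. Q (t, y) \<partial>lborel)"
          using True by (simp add: Q_def D_def sum_distrib_left mult.left_commute)
        finally show ?thesis .
      qed (simp add: P_def Q_def)
    qed
    also have "\<dots> = - (\<integral>y. (\<integral>t. Q (t, y) \<partial>lborel) \<partial>lborel)"
      using lborel_pair.integral_snd[of "\<lambda>t y. Q (t, y)"] lborel_pair.integral_fst[of "\<lambda>t y. Q (t, y)"] Q by simp
    \<comment> \<open>The integral over \<open>t\<close> is now that of a smooth function along a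
      line and gives an increment of the test function.\<close>
    also have "(\<lambda>y. (\<integral>t. Q (t, y) \<partial>lborel)) = (\<lambda>y. u y * complex_of_real (\<phi> y - \<phi> (y - h)))"
    proof
      fix y
      have "(\<integral>t. Q (t, y) \<partial>lborel) = u y * complex_of_real (\<integral>t. indicat_real {0..1} t *\<^sub>R D (y - t *\<^sub>R h) \<partial>lborel)"
        unfolding integral_complex_of_real[symmetric] integral_mult_right_zero[symmetric]
        by (intro Bochner_Integration.integral_cong) (auto simp: Q_def indicator_def)
      also have "(\<integral>t. indicat_real {0..1} t *\<^sub>R D (y - t *\<^sub>R h) \<partial>lborel) = - \<phi> (y - 1 *\<^sub>R h) - - \<phi> (y - 0 *\<^sub>R h)"
      proof (rule integral_FTC_atLeastAtMost)
        show "continuous_on {0..1} (\<lambda>t. D (y - t *\<^sub>R h))"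
          by (intro continuous_on_compose2[OF Dc] continuous_intros) auto
        fix t :: real
        show "((\<lambda>t. - \<phi> (y - t *\<^sub>R h)) has_vector_derivative D (y - t *\<^sub>R h)) (at t within {0..1})"
          using has_vector_derivative_minus[OF smooth_fun_has_vector_derivative_line[OF sm, of y h t "{0..1}"]]
          by (simp add: D_def)
      qed simp
      finally show "(\<integral>t. Q (t, y) \<partial>lborel) = u y * complex_of_real (\<phi> y - \<phi> (y - h))" by simp
    qed
    finally have GI: "(\<integral>x. G x * complex_of_real (\<phi> x) \<partial>lborel) = - (\<integral>y. u y * complex_of_real (\<phi> y - \<phi> (y - h)) \<partial>lborel)" .
    have "(\<integral>x. u (x + h) * complex_of_real (\<phi> x) \<partial>lborel) = (\<integral>x. u (x + h) * complex_of_real (\<phi> ((x + h) + (- h))) \<partial>lborel)" by simp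
    also have "\<dots> = (\<integral>y. u y * complex_of_real (\<phi> (y + (- h))) \<partial>lborel)"
      by (rule lborel_integral_translate[of "\<lambda>y. u y * complex_of_real (\<phi> (y + (- h)))"]) measurable
    finally have 1: "(\<integral>x. u (x + h) * complex_of_real (\<phi> x) \<partial>lborel) = (\<integral>y. u y * complex_of_real (\<phi> (y - h)) \<partial>lborel)" by simp
    have "(\<integral>x. (u (x + h) - u x - G x) * complex_of_real (\<phi> x) \<partial>lborel)
      = (\<integral>x. u (x + h) * complex_of_real (\<phi> x) \<partial>lborel) - (\<integral>x. u x * complex_of_real (\<phi> x) \<partial>lborel)
        - (\<integral>x. G x * complex_of_real (\<phi> x) \<partial>lborel)"
      using mB0[OF uh] mB0[OF u] mB0[OF G] by (simp add: left_diff_distrib)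
    also have "\<dots> = 0"
      unfolding GI 1 using mB0[OF u] mB[OF u, of "-h"] by (simp add: right_diff_distrib)
    finally show "(\<integral>x. (u (x + h) - u x - G x) * complex_of_real (\<phi> x) \<partial>lborel) = 0" .
  qed
  then show ?thesis by (simp add: G_def P_def F_def)
qed

definition grad_sq :: "('d::finite \<Rightarrow> real^'d \<Rightarrow> complex) \<Rightarrow> real^'d \<Rightarrow> real" where
  "grad_sq g x = (\<Sum>k\<in>UNIV. (cmod (g k x))\<^sup>2)"

text \<open>Square the segment formula by Cauchy-Schwarz in \<open>t\<close> and exchange the
  integrals: for each \<open>t\<close> the shift by \<open>t *\<^sub>R h\<close> maps
  \<open>S\<close> into the larger set, so translation invariance bounds the result by the gradient
  mass of that set.\<close>

lemma translation_bound:
  fixes u :: "real^'d::finite \<Rightarrow> complex"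
  assumes w: "weak_grad \<Omega> u g" and S: "open S" and O: "open \<Omega>"
    and seg: "\<And>x t. x \<in> S \<Longrightarrow> 0 \<le> t \<Longrightarrow> t \<le> 1 \<Longrightarrow> x + t *\<^sub>R h \<in> \<Omega>"
  shows "(\<integral>\<^sup>+x. indicator S x * ennreal ((cmod (u (x + h) - u x))\<^sup>2) \<partial>lborel)
    \<le> ennreal ((norm h)\<^sup>2) * (\<integral>\<^sup>+x. indicator \<Omega> x * ennreal (grad_sq g x) \<partial>lborel)"
proof -
  have g: "\<And>k. integrable lborel (g k)" using w by (auto simp: weak_grad_def)
  then have [measurable]: "\<And>k. g k \<in> borel_measurable borel" by auto
  have [measurable]: "grad_sq g \<in> borel_measurable borel" unfolding grad_sq_def by measurable
  have [measurable]: "S \<in> sets borel" "\<Omega> \<in> sets borel" using S O by auto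
  define F where "F y = (\<Sum>k\<in>UNIV. complex_of_real (h $ k) * g k y)" for y
  have [measurable]: "F \<in> borel_measurable borel" unfolding F_def by measurable
  have F: "(cmod (F y))\<^sup>2 \<le> (norm h)\<^sup>2 * grad_sq g y" for y
  proof -
    have "cmod (F y) \<le> (\<Sum>k\<in>UNIV. \<bar>h $ k\<bar> * \<bar>cmod (g k y)\<bar>)"
      unfolding F_def by (rule order_trans[OF norm_sum]) (simp add: norm_mult)
    also have "\<dots> \<le> L2_set (\<lambda>k. h $ k) UNIV * L2_set (\<lambda>k. cmod (g k y)) UNIV"
      by (rule L2_set_mult_ineq)
    finally have "(cmod (F y))\<^sup>2 \<le> (L2_set (\<lambda>k. h $ k) UNIV * L2_set (\<lambda>k. cmod (g k y)) UNIV)\<^sup>2"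
      by (rule power_mono) simp
    also have "\<dots> = (norm h)\<^sup>2 * grad_sq g y"
      by (simp add: power_mult_distrib L2_set_def norm_vec_def grad_sq_def sum_nonneg)
    finally show ?thesis .
  qed
  have "(\<integral>\<^sup>+x. indicator S x * ennreal ((cmod (u (x + h) - u x))\<^sup>2) \<partial>lborel)
    \<le> (\<integral>\<^sup>+x. indicator S x * (\<integral>\<^sup>+t. indicator {0..1::real} t * ennreal ((cmod (F (x + t *\<^sub>R h)))\<^sup>2) \<partial>lborel) \<partial>lborel)"
  proof (rule nn_integral_mono_AE)
    show "AE x in lborel. indicator S x * ennreal ((cmod (u (x + h) - u x))\<^sup>2)
      \<le> indicator S x * (\<integral>\<^sup>+t. indicator {0..1::real} t * ennreal ((cmod (F (x + t *\<^sub>R h)))\<^sup>2) \<partial>lborel)"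
    proof (rule eventually_mono[OF translation_identity[OF w S, of h]])
      fix x assume elim: "x \<in> S \<longrightarrow> u (x + h) - u x = (\<integral>t. indicat_real {0..1} t *\<^sub>R (\<Sum>k\<in>UNIV. of_real (h $ k) * g k (x + t *\<^sub>R h)) \<partial>lborel)"
      show "indicator S x * ennreal ((cmod (u (x + h) - u x))\<^sup>2)
        \<le> indicator S x * (\<integral>\<^sup>+t. indicator {0..1::real} t * ennreal ((cmod (F (x + t *\<^sub>R h)))\<^sup>2) \<partial>lborel)"
      proof (cases "x \<in> S")
        case True
        then have e: "u (x + h) - u x = (\<integral>t. indicat_real {0..1} t *\<^sub>R F (x + t *\<^sub>R h) \<partial>lborel)"
          using elim by (simp add: F_def)
        show ?thesis
          unfolding e using Cauchy_Schwarz_indicator[of "{0..1::real}" "\<lambda>t. F (x + t *\<^sub>R h)"] True by simp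
      qed simp
    qed (rule seg)
  qed
  also have "\<dots> = (\<integral>\<^sup>+x. (\<integral>\<^sup>+t. indicator S x * (indicator {0..1::real} t * ennreal ((cmod (F (x + t *\<^sub>R h)))\<^sup>2)) \<partial>lborel) \<partial>lborel)"
    by (subst nn_integral_cmult) auto
  also have "\<dots> = (\<integral>\<^sup>+t. (\<integral>\<^sup>+x. indicator S x * (indicator {0..1::real} t * ennreal ((cmod (F (x + t *\<^sub>R h)))\<^sup>2)) \<partial>lborel) \<partial>lborel)"
    by (rule lborel_pair.Fubini') measurable
  also have "\<dots> \<le> (\<integral>\<^sup>+t. indicator {0..1::real} t * (ennreal ((norm h)\<^sup>2) * (\<integral>\<^sup>+x. indicator \<Omega> x * ennreal (grad_sq g x) \<partial>lborel)) \<partial>lborel)"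
  proof (rule nn_integral_mono)
    fix t :: real
    show "(\<integral>\<^sup>+x. indicator S x * (indicator {0..1} t * ennreal ((cmod (F (x + t *\<^sub>R h)))\<^sup>2)) \<partial>lborel)
      \<le> indicator {0..1} t * (ennreal ((norm h)\<^sup>2) * (\<integral>\<^sup>+x. indicator \<Omega> x * ennreal (grad_sq g x) \<partial>lborel))"
    proof (cases "t \<in> {0..1}")
      case True
      have "(\<integral>\<^sup>+x. indicator S x * (indicator {0..1} t * ennreal ((cmod (F (x + t *\<^sub>R h)))\<^sup>2)) \<partial>lborel)
        \<le> (\<integral>\<^sup>+x. ennreal ((norm h)\<^sup>2) * (indicator \<Omega> (x + t *\<^sub>R h) * ennreal (grad_sq g (x + t *\<^sub>R h))) \<partial>lborel)"
        using True seg[of _ t] F by (intro nn_integral_mono) (auto simp: indicator_def ennreal_mult[symmetric] grad_sq_def sum_nonneg intro!: ennreal_leI)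
      also have "\<dots> = ennreal ((norm h)\<^sup>2) * (\<integral>\<^sup>+x. indicator \<Omega> (x + t *\<^sub>R h) * ennreal (grad_sq g (x + t *\<^sub>R h)) \<partial>lborel)"
        by (subst nn_integral_cmult) auto
      also have "(\<integral>\<^sup>+x. indicator \<Omega> (x + t *\<^sub>R h) * ennreal (grad_sq g (x + t *\<^sub>R h)) \<partial>lborel)
         = (\<integral>\<^sup>+x. indicator \<Omega> x * ennreal (grad_sq g x) \<partial>lborel)"
        by (rule lborel_nn_integral_translate[of "\<lambda>x. indicator \<Omega> x * ennreal (grad_sq g x)"]) measurable
      finally show ?thesis using True by simp
    qed simp
  qed
  also have "\<dots> = ennreal ((norm h)\<^sup>2) * (\<integral>\<^sup>+x. indicator \<Omega> x * ennreal (grad_sq g x) \<partial>lborel)"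
    by (subst nn_integral_multc) auto
  finally show ?thesis .
qed

section \<open>Compactness\<close>

text \<open>Not normalised by the volume of \<open>Q\<close>; the volume appears as a factor in
  \<open>poincare_cube\<close>.\<close>

abbreviation mean_sq :: "'a::euclidean_space set \<Rightarrow> ('a \<Rightarrow> complex) \<Rightarrow> ennreal" where
  "mean_sq Q u \<equiv> ennreal ((cmod (\<integral>x. indicat_real Q x *\<^sub>R u x \<partial>lborel))\<^sup>2)"

definition sq_mass :: "'a::euclidean_space set \<Rightarrow> ('a \<Rightarrow> complex) \<Rightarrow> ennreal" where
  "sq_mass A u = (\<integral>\<^sup>+x. indicator A x * ennreal ((cmod (u x))\<^sup>2) \<partial>lborel)"

lemma weak_grad_measurable:
  assumes "weak_grad \<Omega> u g"
  shows "u \<in> borel_measurable borel" "g k \<in> borel_measurable borel"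
proof -
  have "integrable lborel u" "integrable lborel (g k)" using assms by (auto simp: weak_grad_def)
  then show "u \<in> borel_measurable borel" "g k \<in> borel_measurable borel"
    using borel_measurable_integrable[of lborel] by auto
qed

definition grad_mass :: "(real^'d::finite) set \<Rightarrow> ('d \<Rightarrow> real^'d \<Rightarrow> complex) \<Rightarrow> ennreal" where
  "grad_mass A g = (\<integral>\<^sup>+x. indicator A x * ennreal (grad_sq g x) \<partial>lborel)"

lemma norm_sq_add_le: "(norm (a + b))\<^sup>2 \<le> 2 * (norm a)\<^sup>2 + 2 * (norm (b::'a::real_normed_vector))\<^sup>2"
proof -
  have "(norm (a + b))\<^sup>2 \<le> (norm a + norm b)\<^sup>2" by (intro power_mono norm_triangle_ineq) simp
  also have "\<dots> \<le> 2 * (norm a)\<^sup>2 + 2 * (norm b)\<^sup>2"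
    using sum_squares_bound[of "norm a" "norm b"] by (simp add: power2_sum)
  finally show ?thesis .
qed

lemma norm_le_card_cart:
  fixes h :: "real^'d::finite"
  assumes "\<And>k. \<bar>h $ k\<bar> \<le> s"
  shows "norm h \<le> real CARD('d) * s"
  using norm_le_l1_cart[of h] sum_bounded_above[of UNIV "\<lambda>k. \<bar>h $ k\<bar>" s] assms by simp

text \<open>Substitute \<open>y = x + h\<close> and fix \<open>h\<close>. The points
  \<open>x\<close> of the cube with \<open>x + h\<close> in the cube form \<open>S h\<close>, and
  convexity keeps the segments inside, so \<open>translation_bound\<close> applies. Only
  \<open>h\<close> in a cube of side \<open>2 * s\<close> contribute, which gives the volume factor,
  and there the norm of \<open>h\<close> is at most \<open>CARD('d) * s\<close>.\<close>

lemma box_cart_double_integral_bound: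
  fixes u :: "real^'d::finite \<Rightarrow> complex"
  assumes w: "weak_grad Q u g" and Q: "Q = box a b" and ab: "\<And>k. b $ k = a $ k + s" and s: "s > 0"
  shows "(\<integral>\<^sup>+x. indicator Q x * (\<integral>\<^sup>+y. indicator Q y * ennreal ((cmod (u x - u y))\<^sup>2) \<partial>lborel) \<partial>lborel)
    \<le> ennreal ((2 * s) ^ CARD('d) * (real CARD('d) * s)\<^sup>2) * grad_mass Q g"
proof -
  have [measurable]: "u \<in> borel_measurable borel" using w by (auto simp: weak_grad_def)
  have [measurable]: "Q \<in> sets borel" using Q by simp
  define B where "B = (cbox (\<chi> k. - s) (\<chi> k. s) :: (real^'d) set)"
  have [measurable]: "B \<in> sets borel" by (simp add: B_def)
  have Bm: "emeasure lborel B = ennreal ((2 * s) ^ CARD('d))"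
  proof -
    have "B \<noteq> {}" using s by (auto simp: B_def interval_ne_empty_cart)
    then have "measure lborel B = (2 * s) ^ CARD('d)" unfolding B_def by (subst content_cbox_cart) auto
    then show ?thesis
      using emeasure_eq_ennreal_measure[of lborel B] emeasure_lborel_cbox_finite[of "\<chi> k. - s" "\<chi> k. s"]
      by (simp add: B_def less_top)
  qed
  define S where "S h = Q \<inter> {x. x + h \<in> Q}" for h
  have "(\<integral>\<^sup>+x. indicator Q x * (\<integral>\<^sup>+y. indicator Q y * ennreal ((cmod (u x - u y))\<^sup>2) \<partial>lborel) \<partial>lborel)
    = (\<integral>\<^sup>+x. indicator Q x * (\<integral>\<^sup>+h. indicator Q (h + x) * ennreal ((cmod (u x - u (h + x)))\<^sup>2) \<partial>lborel) \<partial>lborel)"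
    using lborel_nn_integral_translate[of "\<lambda>y. indicator Q y * ennreal ((cmod (u x - u y))\<^sup>2)" x for x] by simp
  also have "\<dots> = (\<integral>\<^sup>+x. (\<integral>\<^sup>+h. indicator (S h) x * ennreal ((cmod (u (x + h) - u x))\<^sup>2) \<partial>lborel) \<partial>lborel)"
    by (subst nn_integral_cmult[symmetric]) (auto simp: S_def indicator_def add.commute norm_minus_commute intro!: nn_integral_cong)
  also have "\<dots> = (\<integral>\<^sup>+h. (\<integral>\<^sup>+x. indicator (S h) x * ennreal ((cmod (u (x + h) - u x))\<^sup>2) \<partial>lborel) \<partial>lborel)"
  proof (rule lborel_pair.Fubini')
    have e: "(\<lambda>(h, x). indicator (S h) x * ennreal ((cmod (u (x + h) - u x))\<^sup>2))
      = (\<lambda>(h, x). indicator Q x * indicator Q (x + h) * ennreal ((cmod (u (x + h) - u x))\<^sup>2))"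
      by (auto simp: S_def indicator_def fun_eq_iff)
    show "(\<lambda>(h, x). indicator (S h) x * ennreal ((cmod (u (x + h) - u x))\<^sup>2)) \<in> borel_measurable (lborel \<Otimes>\<^sub>M lborel)"
      unfolding e by measurable
  qed
  also have "\<dots> \<le> (\<integral>\<^sup>+h. indicator B h * (ennreal ((real CARD('d) * s)\<^sup>2) * grad_mass Q g) \<partial>lborel)"
  proof (rule nn_integral_mono)
    fix h
    show "(\<integral>\<^sup>+x. indicator (S h) x * ennreal ((cmod (u (x + h) - u x))\<^sup>2) \<partial>lborel)
      \<le> indicator B h * (ennreal ((real CARD('d) * s)\<^sup>2) * grad_mass Q g)"
    proof (cases "h \<in> B")
      case True
      have "(\<integral>\<^sup>+x. indicator (S h) x * ennreal ((cmod (u (x + h) - u x))\<^sup>2) \<partial>lborel) \<le> ennreal ((norm h)\<^sup>2) * grad_mass Q g"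
        unfolding grad_mass_def
      proof (rule translation_bound[OF w])
        have "open (Q \<inter> (\<lambda>x. x + h) -` Q)"
          unfolding Q by (intro open_Int open_box open_vimage continuous_intros)
        then show "open (S h)" by (simp add: S_def vimage_def)
        show "open Q" by (simp add: Q open_box)
        fix x t assume x: "x \<in> S h" and t: "0 \<le> t" "t \<le> (1::real)"
        have "(1 - t) *\<^sub>R x + t *\<^sub>R (x + h) \<in> Q"
          using x t convex_box(2)[of a b] unfolding S_def Q by (intro convexD) auto
        then show "x + t *\<^sub>R h \<in> Q" by (simp add: algebra_simps)
      qed
      also have "\<dots> \<le> ennreal ((real CARD('d) * s)\<^sup>2) * grad_mass Q g"
      proof (intro mult_right_mono ennreal_leI power_mono norm_le_card_cart)
        fix k show "\<bar>h $ k\<bar> \<le> s" using True by (auto simp: B_def mem_box_cart abs_le_iff minus_le_iff)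
      qed auto
      finally show ?thesis using True by simp
    next
      case False
      have "S h = {}"
      proof (rule ccontr)
        assume "S h \<noteq> {}"
        then obtain x where x: "x \<in> box a b" "x + h \<in> box a b" by (auto simp: S_def Q)
        have "- s \<le> h $ k \<and> h $ k \<le> s" for k
        proof -
          have "a $ k < x $ k" "x $ k < b $ k" "a $ k < x $ k + h $ k" "x $ k + h $ k < b $ k"
            using x by (auto simp: mem_box_cart)
          then show ?thesis using ab[of k] by linarith
        qed
        then show False using False by (simp add: B_def mem_box_cart)
      qed
      then show ?thesis by simp
    qed
  qed
  also have "\<dots> = ennreal ((2 * s) ^ CARD('d) * (real CARD('d) * s)\<^sup>2) * grad_mass Q g"
    using s by (subst nn_integral_multc) (auto simp: Bm ennreal_mult mult.assoc)
  finally show ?thesis .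
qed

lemma ennreal_distrib_aux:
  assumes "0 \<le> a" "0 \<le> b" "0 \<le> c" "0 \<le> d" "0 \<le> e"
  shows "ennreal a * (ennreal b * ennreal c + ennreal d * (ennreal e * N)) = ennreal (a * (b * c)) + ennreal (a * (d * e)) * N"
  using assms by (simp add: ennreal_mult distrib_left mult.assoc)

text \<open>With \<open>v\<close> the volume, \<open>v\<close> times \<open>u x\<close> is the
  integral \<open>m\<close> of \<open>u\<close> plus the integral of \<open>u x - u y\<close> over
  \<open>y\<close>. Squaring and integrating over \<open>x\<close> leaves the integral of
  \<open>u\<close> and the double integral of differences. Division by the square of
  \<open>v\<close> turns the first term into \<open>2 / v\<close> times \<open>mean_sq\<close>, and
  in the second the powers of \<open>s\<close> cancel against \<open>v\<close>, leaving
  \<open>2 ^ (CARD('d) + 1)\<close>.\<close>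

lemma poincare_cube:
  fixes u :: "real^'d::finite \<Rightarrow> complex"
  assumes w: "weak_grad Q u g" and Q: "Q = box a b" and ab: "\<And>k. b $ k = a $ k + s" and s: "s > 0"
  shows "sq_mass Q u \<le> ennreal (2 / s ^ CARD('d)) * mean_sq Q u
    + ennreal (2 ^ (CARD('d) + 1) * (real CARD('d) * s)\<^sup>2) * grad_mass Q g"
proof -
  have u: "integrable lborel u" using w by (auto simp: weak_grad_def)
  then have [measurable]: "u \<in> borel_measurable borel" by auto
  have [measurable]: "Q \<in> sets borel" using Q by simp
  define v where "v = s ^ CARD('d)"
  have v: "v > 0" using s by (simp add: v_def)
  have Qm: "emeasure lborel Q = ennreal v" "measure lborel Q = v"
  proof -
    have "a \<bullet> i \<le> b \<bullet> i" if "i \<in> Basis" for i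
      using that ab s by (auto simp: Basis_vec_def inner_axis)
    moreover have ne: "cbox a b \<noteq> {}" using ab s by (auto simp: interval_ne_empty_cart)
    have "measure lborel (cbox a b) = v" using ne ab by (subst content_cbox_cart) (auto simp: v_def)
    ultimately show "measure lborel Q = v" unfolding Q by (simp add: content_cbox)
    then show "emeasure lborel Q = ennreal v"
      using emeasure_eq_ennreal_measure[of lborel Q] emeasure_lborel_box_finite[of a b] by (simp add: Q)
  qed
  define m where "m = (\<integral>x. indicat_real Q x *\<^sub>R u x \<partial>lborel)"
  define d where "d x = (\<integral>\<^sup>+y. indicator Q y * ennreal ((cmod (u x - u y))\<^sup>2) \<partial>lborel)" for x
  have [measurable]: "d \<in> borel_measurable borel" unfolding d_def by measurable
  have pt: "ennreal (v\<^sup>2) * ennreal ((cmod (u x))\<^sup>2) \<le> ennreal (2 * (cmod m)\<^sup>2) + ennreal (2 * v) * d x" for x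
  proof -
    define r where "r = (\<integral>y. indicat_real Q y *\<^sub>R (u x - u y) \<partial>lborel)"
    have "integrable lborel (indicat_real Q)" using Qm by (simp add: integrable_indicator_iff)
    then have i: "integrable lborel (\<lambda>y. indicat_real Q y *\<^sub>R u x)" by simp
    have iu: "integrable lborel (\<lambda>y. indicat_real Q y *\<^sub>R u y)" using u by (intro integrable_mult_indicator) auto
    have "r = (\<integral>y. indicat_real Q y *\<^sub>R u x \<partial>lborel) - m"
      unfolding r_def m_def using i iu by (simp add: scaleR_diff_right)
    also have "(\<integral>y. indicat_real Q y *\<^sub>R u x \<partial>lborel) = of_real v * u x"
      using Qm by (simp add: scaleR_conv_of_real)
    finally have e: "of_real v * u x = m + r" by simp
    have "v\<^sup>2 * (cmod (u x))\<^sup>2 = (cmod (of_real v * u x))\<^sup>2" using v by (simp add: norm_mult power_mult_distrib)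
    also have "\<dots> \<le> 2 * (cmod m)\<^sup>2 + 2 * (cmod r)\<^sup>2" unfolding e by (rule norm_sq_add_le)
    finally have "ennreal (v\<^sup>2 * (cmod (u x))\<^sup>2) \<le> ennreal (2 * (cmod m)\<^sup>2 + 2 * (cmod r)\<^sup>2)" by (rule ennreal_leI)
    also have "\<dots> = ennreal (2 * (cmod m)\<^sup>2) + ennreal 2 * ennreal ((cmod r)\<^sup>2)"
      by (simp add: ennreal_plus ennreal_mult)
    also have "\<dots> \<le> ennreal (2 * (cmod m)\<^sup>2) + ennreal 2 * (ennreal v * d x)"
      using Cauchy_Schwarz_indicator[of Q "\<lambda>y. u x - u y"]
      by (intro add_left_mono mult_left_mono) (auto simp: r_def d_def Qm)
    also have "ennreal 2 * (ennreal v * d x) = ennreal (2 * v) * d x"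
      using v by (simp add: ennreal_mult mult.assoc)
    finally show ?thesis by (simp add: ennreal_mult)
  qed
  have "ennreal (v\<^sup>2) * sq_mass Q u = (\<integral>\<^sup>+x. ennreal (v\<^sup>2) * (indicator Q x * ennreal ((cmod (u x))\<^sup>2)) \<partial>lborel)"
    unfolding sq_mass_def by (subst nn_integral_cmult) auto
  also have "\<dots> \<le> (\<integral>\<^sup>+x. ennreal (2 * (cmod m)\<^sup>2) * indicator Q x + ennreal (2 * v) * (indicator Q x * d x) \<partial>lborel)"
    using pt by (intro nn_integral_mono) (auto simp: indicator_def)
  also have "\<dots> = ennreal (2 * (cmod m)\<^sup>2) * ennreal v + ennreal (2 * v) * (\<integral>\<^sup>+x. indicator Q x * d x \<partial>lborel)"
    by (subst nn_integral_add) (auto simp: nn_integral_cmult Qm)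
  also have "\<dots> \<le> ennreal (2 * (cmod m)\<^sup>2) * ennreal v
      + ennreal (2 * v) * (ennreal ((2 * s) ^ CARD('d) * (real CARD('d) * s)\<^sup>2) * grad_mass Q g)"
    using box_cart_double_integral_bound[OF w Q ab s] by (intro add_left_mono mult_left_mono) (auto simp: d_def)
  finally have 1: "ennreal (v\<^sup>2) * sq_mass Q u \<le> \<dots>" .
  have "sq_mass Q u = ennreal (1 / v\<^sup>2) * (ennreal (v\<^sup>2) * sq_mass Q u)"
    using v by (simp add: mult.assoc[symmetric] ennreal_mult[symmetric])
  also have "\<dots> \<le> ennreal (1 / v\<^sup>2) * (ennreal (2 * (cmod m)\<^sup>2) * ennreal v
      + ennreal (2 * v) * (ennreal ((2 * s) ^ CARD('d) * (real CARD('d) * s)\<^sup>2) * grad_mass Q g))"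
    using 1 by (intro mult_left_mono) auto
  also have "\<dots> = ennreal (1 / v\<^sup>2 * (2 * (cmod m)\<^sup>2 * v))
      + ennreal (1 / v\<^sup>2 * (2 * v * ((2 * s) ^ CARD('d) * (real CARD('d) * s)\<^sup>2))) * grad_mass Q g"
    using v s by (intro ennreal_distrib_aux) auto
  also have "1 / v\<^sup>2 * (2 * (cmod m)\<^sup>2 * v) = 2 / v * (cmod m)\<^sup>2"
    using v by (simp add: power2_eq_square)
  also have "1 / v\<^sup>2 * (2 * v * ((2 * s) ^ CARD('d) * (real CARD('d) * s)\<^sup>2)) = 2 ^ (CARD('d) + 1) * (real CARD('d) * s)\<^sup>2"
    using v s by (simp add: power2_eq_square v_def power_mult_distrib)
  also have "ennreal (2 / v * (cmod m)\<^sup>2) = ennreal (2 / v) * ennreal ((cmod m)\<^sup>2)"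
    using v by (subst ennreal_mult[symmetric]) auto
  finally show ?thesis by (simp add: m_def v_def)
qed

section \<open>Grid cells, transport from the boundary and the resulting compactness
  estimate\<close>

lemma AE_lborel_coordinate_neq: "AE x in lborel. (x::real^'d::finite) $ k \<noteq> c"
proof -
  have "negligible {x::real^'d. x \<bullet> axis k 1 = c}" by (rule negligible_standard_hyperplane) simp
  then have "AE x in lebesgue. x \<notin> {x::real^'d. x \<bullet> axis k 1 = c}"
    by (intro AE_not_in) (simp add: negligible_iff_null_sets)
  then show ?thesis by (simp add: AE_completion_iff inner_axis)
qed

text \<open>On a compact part of the domain the Poincare inequality on the cells of a fine grid controls the
  mass by finitely many averages.\<close>

lemma interior_mass_bound:
  fixes \<Omega> K :: "(real^'d::finite) set"
  assumes K: "compact K" "K \<subseteq> \<Omega>" and O: "open \<Omega>" and e: "e > 0"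
  obtains Qs C where "finite Qs" "\<And>Q. Q \<in> Qs \<Longrightarrow> open Q" "\<And>Q. Q \<in> Qs \<Longrightarrow> Q \<subseteq> \<Omega>" "C \<ge> 0"
    "\<And>u g. weak_grad \<Omega> u g \<Longrightarrow> sq_mass K u \<le> ennreal e * grad_mass \<Omega> g
       + ennreal C * (\<Sum>Q\<in>Qs. mean_sq Q u)"
proof -
  obtain \<delta> where \<delta>: "\<delta> > 0" "(\<Union>x\<in>K. cball x \<delta>) \<subseteq> \<Omega>"
    using compact_subset_open_imp_cball_epsilon_subset[OF K(1) O K(2)] by blast
  define n where "n = real CARD('d)"
  have n: "n > 0" by (simp add: n_def)
  \<comment> \<open>The first entry bounds the diameter of a cell by \<open>\<delta>\<close>, so
    that cells meeting \<open>K\<close> stay in the domain; the second makes the gradient constant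
    in \<open>poincare_cube\<close> at most \<open>e\<close>.\<close>
  define s where "s = min (\<delta> / n) (sqrt (e / 2 ^ (CARD('d) + 1)) / n)"
  have s: "s > 0" using \<delta> e n by (simp add: s_def)
  have sd: "n * s \<le> \<delta>" using n by (simp add: s_def min_def field_simps)
  have se: "2 ^ (CARD('d) + 1) * (n * s)\<^sup>2 \<le> e"
  proof -
    have "n * s \<le> sqrt (e / 2 ^ (CARD('d) + 1))" using n by (simp add: s_def min_def field_simps)
    then have "(n * s)\<^sup>2 \<le> (sqrt (e / 2 ^ (CARD('d) + 1)))\<^sup>2" using n s by (intro power_mono) auto
    also have "\<dots> = e / 2 ^ (CARD('d) + 1)" using e by simp
    finally show ?thesis by (simp add: field_simps)
  qed
  \<comment> \<open>Open cells are pairwise disjoint and fit the cube inequality as it stands. They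
    miss the grid hyperplanes, a null set, hence the almost everywhere form of
    \<open>cover\<close>.\<close>
  define q where "q z = (box (\<chi> k. s * of_int (z k)) (\<chi> k. s * of_int (z k) + s) :: (real^'d) set)" for z :: "'d \<Rightarrow> int"
  define Z where "Z = {z. q z \<inter> K \<noteq> {}}"
  define Qs where "Qs = q ` Z"
  have mem_q: "x \<in> q z \<longleftrightarrow> (\<forall>k. s * of_int (z k) < x $ k \<and> x $ k < s * of_int (z k) + s)" for x z
    by (simp add: q_def mem_box_cart)
  have mem_q': "z k = \<lfloor>x $ k / s\<rfloor>" if "x \<in> q z" for x z k
  proof -
    have "of_int (z k) < x $ k / s" "x $ k / s < of_int (z k) + 1"
      using that s by (auto simp: mem_q field_simps)
    then show ?thesis by linarith
  qed
  have disj: "q z = q z'" if "x \<in> q z" "x \<in> q z'" for x z z'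
  proof -
    have "z = z'" using mem_q'[OF that(1)] mem_q'[OF that(2)] by (simp add: fun_eq_iff)
    then show ?thesis by simp
  qed
  have "finite Z"
  proof -
    obtain R where R: "\<And>x. x \<in> K \<Longrightarrow> norm x \<le> R" using compact_imp_bounded[OF K(1)] by (auto simp: bounded_iff)
    define m where "m = \<lceil>R / s\<rceil> + 1"
    have "Z \<subseteq> PiE UNIV (\<lambda>_. {-m..m})"
    proof
      fix z assume "z \<in> Z"
      then obtain y where y: "y \<in> q z" "y \<in> K" by (auto simp: Z_def)
      have "z k \<in> {-m..m}" for k
      proof -
        have "\<bar>y $ k\<bar> \<le> R" using R[OF y(2)] component_le_norm_cart[of y k] by linarith
        then have "y $ k / s \<le> R / s" "- (R / s) \<le> y $ k / s" using s by (auto simp: abs_le_iff field_simps)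
        then have "\<lfloor>y $ k / s\<rfloor> \<le> \<lceil>R / s\<rceil> + 1" "- (\<lceil>R / s\<rceil> + 1) \<le> \<lfloor>y $ k / s\<rfloor>" by linarith+
        then show ?thesis unfolding mem_q'[OF y(1)] m_def by simp
      qed
      then show "z \<in> PiE UNIV (\<lambda>_. {-m..m})" by (simp add: PiE_def extensional_def Pi_def)
    qed
    moreover have "finite (PiE (UNIV::'d set) (\<lambda>_. {-m..m}))" by (intro finite_PiE) auto
    ultimately show ?thesis by (rule finite_subset)
  qed
  then have fin: "finite Qs" by (simp add: Qs_def)
  have op: "open Q" if "Q \<in> Qs" for Q using that by (auto simp: Qs_def q_def)
  have sub: "Q \<subseteq> \<Omega>" if "Q \<in> Qs" for Q
  proof
    fix x assume x: "x \<in> Q"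
    from that obtain z y where Q: "Q = q z" and y: "y \<in> q z" "y \<in> K" by (auto simp: Qs_def Z_def)
    have "norm (y - x) \<le> n * s" unfolding n_def
    proof (rule norm_le_card_cart)
      fix k
      have "s * of_int (z k) < x $ k \<and> x $ k < s * of_int (z k) + s" "s * of_int (z k) < y $ k \<and> y $ k < s * of_int (z k) + s"
        using x y by (auto simp: Q mem_q)
      then show "\<bar>(y - x) $ k\<bar> \<le> s" by (simp add: abs_le_iff)
    qed
    then have "x \<in> cball y \<delta>" using sd by (simp add: dist_norm)
    then show "x \<in> \<Omega>" using \<delta>(2) y(2) by blast
  qed
  \<comment> \<open>Disjointness of the cells keeps the sum of their gradient masses below that of
    the domain, so \<open>e\<close> is not multiplied by the number of cells.\<close>
  have ind1: "(\<Sum>Q\<in>Qs. indicator Q x) \<le> (indicator \<Omega> x :: ennreal)" for x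
  proof (cases "\<exists>Q\<in>Qs. x \<in> Q")
    case True
    then obtain Q where Q: "Q \<in> Qs" "x \<in> Q" by blast
    have "(\<Sum>Q\<in>Qs. indicator Q x :: ennreal) = (\<Sum>Q\<in>{Q}. indicator Q x)"
    proof (rule sum.mono_neutral_right[OF fin])
      show "\<forall>Q'\<in>Qs - {Q}. indicator Q' x = (0::ennreal)"
        using disj Q by (auto simp: Qs_def indicator_def)
    qed (use Q in auto)
    also have "\<dots> = 1" using Q by simp
    finally show ?thesis using sub[OF Q(1)] Q(2) by auto
  next
    case False
    then have "(\<Sum>Q\<in>Qs. indicator Q x :: ennreal) = 0" by (intro sum.neutral) auto
    then show ?thesis by simp
  qed
  have cover: "AE x in lborel. indicator K x \<le> (\<Sum>Q\<in>Qs. indicator Q x :: ennreal)"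
  proof -
    have "AE x in lborel. \<forall>k::'d. \<forall>m::int. (x::real^'d) $ k \<noteq> s * of_int m"
      by (simp add: AE_all_countable AE_lborel_coordinate_neq)
    then show ?thesis
    proof (rule eventually_mono)
      fix x :: "real^'d" assume x: "\<forall>k. \<forall>m::int. x $ k \<noteq> s * of_int m"
      show "indicator K x \<le> (\<Sum>Q\<in>Qs. indicator Q x :: ennreal)"
      proof (cases "x \<in> K")
        case True
        define z where "z k = \<lfloor>x $ k / s\<rfloor>" for k
        have "x \<in> q z"
        proof -
          have "s * of_int (z k) < x $ k \<and> x $ k < s * of_int (z k) + s" for k
          proof -
            have "of_int (z k) \<le> x $ k / s" "x $ k / s < of_int (z k) + 1" by (auto simp: z_def)
            then have "s * of_int (z k) \<le> x $ k" "x $ k < s * of_int (z k) + s" using s by (auto simp: field_simps)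
            moreover have "x $ k \<noteq> s * of_int (z k)" using x by simp
            ultimately show ?thesis by linarith
          qed
          then show ?thesis by (simp add: mem_q)
        qed
        then have "q z \<in> Qs" using True by (auto simp: Qs_def Z_def)
        then have "(indicator (q z) x :: ennreal) \<le> (\<Sum>Q\<in>Qs. indicator Q x)"
          using fin by (intro member_le_sum) auto
        then show ?thesis using True \<open>x \<in> q z\<close> by simp
      qed simp
    qed
  qed
  show thesis
  proof (rule that[of Qs "2 / s ^ CARD('d)"])
    fix u :: "real^'d \<Rightarrow> complex" and g assume w: "weak_grad \<Omega> u g"
    have [measurable]: "u \<in> borel_measurable borel" "\<And>k. g k \<in> borel_measurable borel" using weak_grad_measurable[OF w] by auto
    have [measurable]: "grad_sq g \<in> borel_measurable borel" unfolding grad_sq_def by measurable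
    have [measurable]: "\<And>Q. Q \<in> Qs \<Longrightarrow> Q \<in> sets borel" using op by auto
    define m where "m Q = mean_sq Q u" for Q
    have "sq_mass K u \<le> (\<integral>\<^sup>+x. (\<Sum>Q\<in>Qs. indicator Q x * ennreal ((cmod (u x))\<^sup>2)) \<partial>lborel)"
      unfolding sq_mass_def
    proof (rule nn_integral_mono_AE)
      show "AE x in lborel. indicator K x * ennreal ((cmod (u x))\<^sup>2) \<le> (\<Sum>Q\<in>Qs. indicator Q x * ennreal ((cmod (u x))\<^sup>2))"
        using cover by eventually_elim (auto simp: sum_distrib_right[symmetric] intro!: mult_right_mono)
    qed
    also have "\<dots> = (\<Sum>Q\<in>Qs. sq_mass Q u)"
      unfolding sq_mass_def by (subst nn_integral_sum) auto
    also have "\<dots> \<le> (\<Sum>Q\<in>Qs. ennreal (2 / s ^ CARD('d)) * m Q + ennreal e * grad_mass Q g)"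
    proof (rule sum_mono)
      fix Q assume Q: "Q \<in> Qs"
      then obtain z where z: "Q = q z" by (auto simp: Qs_def)
      have "sq_mass Q u \<le> ennreal (2 / s ^ CARD('d)) * m Q + ennreal (2 ^ (CARD('d) + 1) * (n * s)\<^sup>2) * grad_mass Q g"
        unfolding m_def n_def
        by (rule poincare_cube[OF weak_grad_subset[OF w sub[OF Q]] z[unfolded q_def] _ s]) simp
      also have "\<dots> \<le> ennreal (2 / s ^ CARD('d)) * m Q + ennreal e * grad_mass Q g"
        using se by (intro add_left_mono mult_right_mono ennreal_leI) auto
      finally show "sq_mass Q u \<le> ennreal (2 / s ^ CARD('d)) * m Q + ennreal e * grad_mass Q g" .
    qed
    also have "\<dots> = ennreal (2 / s ^ CARD('d)) * (\<Sum>Q\<in>Qs. m Q) + ennreal e * (\<Sum>Q\<in>Qs. grad_mass Q g)"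
      by (simp add: sum.distrib sum_distrib_left)
    also have "(\<Sum>Q\<in>Qs. grad_mass Q g) \<le> grad_mass \<Omega> g"
    proof -
      have "(\<Sum>Q\<in>Qs. grad_mass Q g) = (\<integral>\<^sup>+x. (\<Sum>Q\<in>Qs. indicator Q x * ennreal (grad_sq g x)) \<partial>lborel)"
        unfolding grad_mass_def by (subst nn_integral_sum) auto
      also have "\<dots> \<le> grad_mass \<Omega> g"
        unfolding grad_mass_def using ind1
        by (intro nn_integral_mono) (auto simp: sum_distrib_right[symmetric] intro!: mult_right_mono)
      finally show ?thesis .
    qed
    finally show "sq_mass K u \<le> ennreal e * grad_mass \<Omega> g + ennreal (2 / s ^ CARD('d)) *
        (\<Sum>Q\<in>Qs. mean_sq Q u)"
      by (simp add: m_def add.commute mult_left_mono add_mono)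
  qed (use fin op sub s in auto)
qed

text \<open>Near the boundary the mass is moved into the interior along the direction of the graph.\<close>

lemma boundary_mass_bound:
  fixes \<Omega> :: "(real^'d::finite) set"
  assumes O: "open \<Omega>" and r: "r > 0" and nu: "norm \<nu> = 1" and lip: "lipschitz_on C {z. z \<bullet> \<nu> = 0} \<gamma>"
    and gr: "\<forall>y\<in>ball x0 r. y \<in> \<Omega> \<longleftrightarrow> y \<bullet> \<nu> < \<gamma> (y - (y \<bullet> \<nu>) *\<^sub>R \<nu>)"
    and s: "0 < s" "s < r / 2"
  obtains K where "compact K" "K \<subseteq> \<Omega>"
    "\<And>u g. weak_grad \<Omega> u g \<Longrightarrow> sq_mass (\<Omega> \<inter> ball x0 (r / 2)) u \<le> 2 * sq_mass K u + ennreal (2 * s\<^sup>2) * grad_mass \<Omega> g"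
proof -
  define S where "S = \<Omega> \<inter> ball x0 (r / 2)"
  have S: "open S" unfolding S_def by (intro open_Int O open_ball)
  have nn: "\<nu> \<bullet> \<nu> = 1" using nu by (simp add: norm_eq_1)
  define p where "p y = y - (y \<bullet> \<nu>) *\<^sub>R \<nu>" for y :: "real^'d"
  have p0: "p y \<in> {z. z \<bullet> \<nu> = 0}" for y by (simp add: p_def inner_diff_left nn)
  have pshift: "p (y - t *\<^sub>R \<nu>) = p y" for y t by (simp add: p_def inner_diff_left nn algebra_simps)
  have contp: "continuous_on UNIV p" unfolding p_def by (intro continuous_intros)
  have cont: "continuous_on UNIV (\<lambda>y. \<gamma> (p y))"
    by (rule continuous_on_compose2[OF lipschitz_on_continuous_on[OF lip] contp]) (use p0 in auto)
  \<comment> \<open>By continuity of \<open>\<gamma>\<close> along the projection, points of the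
    closure of \<open>S\<close> lie on or below the graph. A positive shift against
    \<open>\<nu>\<close> puts them strictly below it, and the half radius together with
    \<open>s < r / 2\<close> keeps them in the ball where the graph describes the domain.\<close>
  have shift: "y - t *\<^sub>R \<nu> \<in> \<Omega>" if y: "y \<in> closure S" and t: "0 < t" "t \<le> s" for y t
  proof -
    have yb: "dist x0 y \<le> r / 2"
    proof -
      have "closure S \<subseteq> cball x0 (r / 2)" by (rule closure_minimal) (auto simp: S_def)
      then show ?thesis using y by auto
    qed
    have "y \<bullet> \<nu> \<le> \<gamma> (p y)"
    proof -
      have "closed {y. y \<bullet> \<nu> \<le> \<gamma> (p y)}" by (intro closed_Collect_le continuous_intros cont)
      moreover have "S \<subseteq> {y. y \<bullet> \<nu> \<le> \<gamma> (p y)}"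
      proof
        fix z assume z: "z \<in> S"
        then have "z \<in> ball x0 r" "z \<in> \<Omega>" using r by (auto simp: S_def)
        then show "z \<in> {y. y \<bullet> \<nu> \<le> \<gamma> (p y)}" using gr by (force simp: p_def)
      qed
      ultimately have "closure S \<subseteq> {y. y \<bullet> \<nu> \<le> \<gamma> (p y)}" by (metis closure_minimal)
      then show ?thesis using y by blast
    qed
    then have 1: "(y - t *\<^sub>R \<nu>) \<bullet> \<nu> < \<gamma> (p (y - t *\<^sub>R \<nu>))"
      using t by (simp add: pshift inner_diff_left nn)
    have "dist x0 (y - t *\<^sub>R \<nu>) \<le> dist x0 y + dist y (y - t *\<^sub>R \<nu>)" by (rule dist_triangle)
    also have "\<dots> \<le> r / 2 + t" using yb t nu by (simp add: dist_norm)
    also have "\<dots> < r" using t s by simp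
    finally have "y - t *\<^sub>R \<nu> \<in> ball x0 r" by simp
    then show ?thesis using gr 1 by (simp add: p_def)
  qed
  define h where "h = - s *\<^sub>R \<nu>"
  have hn: "norm h = s" using nu s by (simp add: h_def)
  \<comment> \<open>The set \<open>S\<close> may touch the boundary, but its whole closure shifted
    by \<open>h\<close> is a compact subset of the domain.\<close>
  define K where "K = (\<lambda>y. y + h) ` closure S"
  have "bounded S" by (rule bounded_subset[OF bounded_ball]) (auto simp: S_def)
  then have Kc: "compact K" unfolding K_def
    by (intro compact_continuous_image continuous_intros) (simp add: compact_closure)
  have KO: "K \<subseteq> \<Omega>" using shift[of _ s] s by (auto simp: K_def h_def)
  have seg: "x + t *\<^sub>R h \<in> \<Omega>" if "x \<in> S" "0 \<le> t" "t \<le> 1" for x t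
  proof (cases "t = 0")
    case True then show ?thesis using that by (simp add: S_def)
  next
    case False
    then have "x - (t * s) *\<^sub>R \<nu> \<in> \<Omega>"
      using that s closure_subset[of S] by (intro shift) (auto simp: mult_le_one mult_left_le_one_le)
    then show ?thesis by (simp add: h_def)
  qed
  have bound: "sq_mass S u \<le> 2 * sq_mass K u + ennreal (2 * s\<^sup>2) * grad_mass \<Omega> g" if w: "weak_grad \<Omega> u g" for u g
  proof -
    have [measurable]: "u \<in> borel_measurable borel" "\<And>k. g k \<in> borel_measurable borel" using weak_grad_measurable[OF w] by auto
    have [measurable]: "S \<in> sets borel" "K \<in> sets borel" using S Kc by (auto simp: borel_compact)
    have pt: "indicator S x * ennreal ((cmod (u x))\<^sup>2) \<le>
        2 * (indicator K (x + h) * ennreal ((cmod (u (x + h)))\<^sup>2)) + 2 * (indicator S x * ennreal ((cmod (u (x + h) - u x))\<^sup>2))" for x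
    proof (cases "x \<in> S")
      case True
      then have "x + h \<in> K" using closure_subset[of S] by (auto simp: K_def)
      moreover have "(cmod (u x))\<^sup>2 \<le> 2 * (cmod (u (x + h)))\<^sup>2 + 2 * (cmod (u (x + h) - u x))\<^sup>2"
        using norm_sq_add_le[of "u (x + h)" "u x - u (x + h)"] by (simp add: norm_minus_commute)
      then have "ennreal ((cmod (u x))\<^sup>2) \<le> 2 * ennreal ((cmod (u (x + h)))\<^sup>2) + 2 * ennreal ((cmod (u (x + h) - u x))\<^sup>2)"
        by (drule_tac ennreal_leI) (simp add: ennreal_plus ennreal_mult)
      ultimately show ?thesis using True by simp
    qed simp
    have "sq_mass S u \<le> (\<integral>\<^sup>+x. 2 * (indicator K (x + h) * ennreal ((cmod (u (x + h)))\<^sup>2)) + 2 * (indicator S x * ennreal ((cmod (u (x + h) - u x))\<^sup>2)) \<partial>lborel)"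
      unfolding sq_mass_def by (intro nn_integral_mono pt)
    also have "\<dots> = 2 * (\<integral>\<^sup>+x. indicator K (x + h) * ennreal ((cmod (u (x + h)))\<^sup>2) \<partial>lborel)
        + 2 * (\<integral>\<^sup>+x. indicator S x * ennreal ((cmod (u (x + h) - u x))\<^sup>2) \<partial>lborel)"
      by (subst nn_integral_add) (auto simp: nn_integral_cmult)
    also have "(\<integral>\<^sup>+x. indicator K (x + h) * ennreal ((cmod (u (x + h)))\<^sup>2) \<partial>lborel) = sq_mass K u"
      unfolding sq_mass_def by (rule lborel_nn_integral_translate[of "\<lambda>x. indicator K x * ennreal ((cmod (u x))\<^sup>2)"]) measurable
    also have "2 * sq_mass K u + 2 * (\<integral>\<^sup>+x. indicator S x * ennreal ((cmod (u (x + h) - u x))\<^sup>2) \<partial>lborel)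
       \<le> 2 * sq_mass K u + 2 * (ennreal (s\<^sup>2) * grad_mass \<Omega> g)"
      using translation_bound[OF w S O seg] unfolding hn grad_mass_def by (intro add_left_mono mult_left_mono) auto
    also have "2 * (ennreal (s\<^sup>2) * grad_mass \<Omega> g) = ennreal (2 * s\<^sup>2) * grad_mass \<Omega> g"
      by (simp add: ennreal_mult mult.assoc)
    finally show ?thesis .
  qed
  show thesis using that[OF Kc KO] bound by (simp add: S_def)
qed

text \<open>The frontier is compact, so finitely many half balls from the Lipschitz charts cover it.
  Each moves its mass into a compact set at the cost of a small gradient term; the rest of the
  domain lies in a compact set as well, and \<open>interior_mass_bound\<close> is applied once to
  the union \<open>L\<close> of these sets.\<close>

lemma rellich_inequality:
  fixes \<Omega> :: "(real^'d::finite) set"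
  assumes O: "bounded \<Omega>" "open \<Omega>" "lipschitz_boundary \<Omega>" and e: "e > 0"
  obtains Qs C where "finite Qs" "\<And>Q. Q \<in> Qs \<Longrightarrow> open Q" "\<And>Q. Q \<in> Qs \<Longrightarrow> Q \<subseteq> \<Omega>" "C \<ge> 0"
    "\<And>u g. weak_grad \<Omega> u g \<Longrightarrow> sq_mass \<Omega> u \<le> ennreal e * grad_mass \<Omega> g
       + ennreal C * (\<Sum>Q\<in>Qs. mean_sq Q u)"
proof -
  have "\<forall>x\<in>frontier \<Omega>. \<exists>r>0. \<forall>s. 0 < s \<and> s < r / 2 \<longrightarrow> (\<exists>K. compact K \<and> K \<subseteq> \<Omega> \<and>
    (\<forall>u g. weak_grad \<Omega> u g \<longrightarrow> sq_mass (\<Omega> \<inter> ball x (r / 2)) u \<le> 2 * sq_mass K u + ennreal (2 * s\<^sup>2) * grad_mass \<Omega> g))"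
  proof
    fix x assume "x \<in> frontier \<Omega>"
    then obtain r \<nu> C \<gamma> where *: "r > 0" "norm \<nu> = 1" "lipschitz_on C {z. z \<bullet> \<nu> = 0} \<gamma>"
      "\<forall>y\<in>ball x r. y \<in> \<Omega> \<longleftrightarrow> y \<bullet> \<nu> < \<gamma> (y - (y \<bullet> \<nu>) *\<^sub>R \<nu>)"
      using O(3) unfolding lipschitz_boundary_def by meson
    show "\<exists>r>0. \<forall>s. 0 < s \<and> s < r / 2 \<longrightarrow> (\<exists>K. compact K \<and> K \<subseteq> \<Omega> \<and>
      (\<forall>u g. weak_grad \<Omega> u g \<longrightarrow> sq_mass (\<Omega> \<inter> ball x (r / 2)) u \<le> 2 * sq_mass K u + ennreal (2 * s\<^sup>2) * grad_mass \<Omega> g))"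
      using boundary_mass_bound[OF O(2) *] *(1) by (metis (no_types, lifting))
  qed
  then obtain r where r: "\<And>x. x \<in> frontier \<Omega> \<Longrightarrow> r x > 0"
    and rK: "\<And>x s. x \<in> frontier \<Omega> \<Longrightarrow> 0 < s \<Longrightarrow> s < r x / 2 \<Longrightarrow> \<exists>K. compact K \<and> K \<subseteq> \<Omega> \<and>
    (\<forall>u g. weak_grad \<Omega> u g \<longrightarrow> sq_mass (\<Omega> \<inter> ball x (r x / 2)) u \<le> 2 * sq_mass K u + ennreal (2 * s\<^sup>2) * grad_mass \<Omega> g)"
    by metis
  have "compact (frontier \<Omega>)" using O(1) by (rule compact_frontier_bounded)
  then obtain X where X: "X \<subseteq> frontier \<Omega>" "finite X" "frontier \<Omega> \<subseteq> (\<Union>x\<in>X. ball x (r x / 2))"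
  proof (rule compactE_image)
    show "frontier \<Omega> \<subseteq> (\<Union>x\<in>frontier \<Omega>. ball x (r x / 2))"
    proof
      fix x assume "x \<in> frontier \<Omega>"
      with r[OF this] show "x \<in> (\<Union>x\<in>frontier \<Omega>. ball x (r x / 2))" by (intro UN_I[of x]) auto
    qed
  qed auto
  define m where "m = real (card X)"
  have m: "m \<ge> 0" by (simp add: m_def)
  \<comment> \<open>The first entry gives \<open>s x < r x / 2\<close>. The second bounds the cost
    per ball by \<open>e / (2 * (m + 1))\<close>, so the \<open>m\<close> balls together use at most
    half of \<open>e\<close>.\<close>
  define s where "s x = min (r x / 4) (sqrt (e / (4 * (m + 1))))" for x
  have s: "0 < s x" "s x < r x / 2" if "x \<in> X" for x using r[of x] X(1) that e m by (auto simp: s_def)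
  have s2: "2 * (s x)\<^sup>2 \<le> e / (2 * (m + 1))" if "x \<in> X" for x
  proof -
    have "(s x)\<^sup>2 \<le> (sqrt (e / (4 * (m + 1))))\<^sup>2" using s[OF that] by (intro power_mono) (auto simp: s_def)
    also have "\<dots> = e / (4 * (m + 1))" using e m by simp
    finally show ?thesis using m by (simp add: field_simps)
  qed
  have "\<forall>x\<in>X. \<exists>K. compact K \<and> K \<subseteq> \<Omega> \<and> (\<forall>u g. weak_grad \<Omega> u g \<longrightarrow>
    sq_mass (\<Omega> \<inter> ball x (r x / 2)) u \<le> 2 * sq_mass K u + ennreal (2 * (s x)\<^sup>2) * grad_mass \<Omega> g)"
    using rK s X(1) by blast
  from bchoice[OF this] obtain K where K: "\<And>x. x \<in> X \<Longrightarrow> compact (K x)" "\<And>x. x \<in> X \<Longrightarrow> K x \<subseteq> \<Omega>"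
    "\<And>x u g. x \<in> X \<Longrightarrow> weak_grad \<Omega> u g \<Longrightarrow> sq_mass (\<Omega> \<inter> ball x (r x / 2)) u \<le> 2 * sq_mass (K x) u + ennreal (2 * (s x)\<^sup>2) * grad_mass \<Omega> g"
    by blast
  \<comment> \<open>The balls cover the frontier, so what they leave of the closure is compact and
    lies in the open domain.\<close>
  define K0 where "K0 = closure \<Omega> - (\<Union>x\<in>X. ball x (r x / 2))"
  have K0: "compact K0" "K0 \<subseteq> \<Omega>"
  proof -
    show "compact K0" unfolding K0_def using O(1) by (intro compact_diff) (auto simp: compact_closure)
    show "K0 \<subseteq> \<Omega>" using X(3) O(2) by (auto simp: K0_def frontier_def interior_open)
  qed
  define L where "L = K0 \<union> (\<Union>x\<in>X. K x)"
  have L: "compact L" "L \<subseteq> \<Omega>" using K0 K X(2) by (auto simp: L_def intro!: compact_Un compact_UN)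
  \<comment> \<open>The mass of \<open>L\<close> enters \<open>2 * m + 1\<close> times: once for
    \<open>K0\<close> and twice for each ball. This value spends the other half of \<open>e\<close>
    on it.\<close>
  define e' where "e' = e / (2 * (2 * m + 1))"
  have e': "e' > 0" using e m by (simp add: e'_def)
  obtain Qs C where Q: "finite Qs" "\<And>Q. Q \<in> Qs \<Longrightarrow> open Q" "\<And>Q. Q \<in> Qs \<Longrightarrow> Q \<subseteq> \<Omega>" "C \<ge> 0"
    "\<And>u g. weak_grad \<Omega> u g \<Longrightarrow> sq_mass L u \<le> ennreal e' * grad_mass \<Omega> g
       + ennreal C * (\<Sum>Q\<in>Qs. mean_sq Q u)"
  proof (rule interior_mass_bound[OF L O(2) e'])
    fix Qs C
    assume a: "finite Qs" "\<And>Q. Q \<in> Qs \<Longrightarrow> open Q" "\<And>Q. Q \<in> Qs \<Longrightarrow> Q \<subseteq> \<Omega>" "C \<ge> 0"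
      "\<And>u g. weak_grad \<Omega> u g \<Longrightarrow> sq_mass L u \<le> ennreal e' * grad_mass \<Omega> g
        + ennreal C * (\<Sum>Q\<in>Qs. mean_sq Q u)"
    show thesis by (rule that[of Qs C]) (fact a)+
  qed
  show thesis
  proof (rule that[OF Q(1,2,3), of "(2 * m + 1) * C"])
    fix u :: "real^'d \<Rightarrow> complex" and g assume w: "weak_grad \<Omega> u g"
    have [measurable]: "u \<in> borel_measurable borel" using w by (auto simp: weak_grad_def)
    have [measurable]: "\<Omega> \<in> sets borel" "K0 \<in> sets borel" using O K0 by (auto simp: borel_compact)
    have [measurable]: "\<Omega> \<inter> ball y (r y / 2) \<in> sets borel" for y by (intro sets.Int) auto
    define N where "N = grad_mass \<Omega> g"
    define A where "A = (\<Sum>Q\<in>Qs. mean_sq Q u)"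
    have mono: "sq_mass S u \<le> sq_mass T u" if "S \<subseteq> T" for S T :: "(real^'d) set"
      unfolding sq_mass_def using that by (intro nn_integral_mono mult_right_mono) (auto simp: indicator_def)
    have "sq_mass \<Omega> u \<le> (\<integral>\<^sup>+x. indicator K0 x * ennreal ((cmod (u x))\<^sup>2) + (\<Sum>y\<in>X. indicator (\<Omega> \<inter> ball y (r y / 2)) x * ennreal ((cmod (u x))\<^sup>2)) \<partial>lborel)"
      unfolding sq_mass_def
    proof (rule nn_integral_mono)
      fix x
      show "indicator \<Omega> x * ennreal ((cmod (u x))\<^sup>2) \<le> indicator K0 x * ennreal ((cmod (u x))\<^sup>2)
        + (\<Sum>y\<in>X. indicator (\<Omega> \<inter> ball y (r y / 2)) x * ennreal ((cmod (u x))\<^sup>2))"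
      proof (cases "x \<in> \<Omega> \<and> x \<notin> K0")
        case True
        then obtain y where y: "y \<in> X" "x \<in> \<Omega> \<inter> ball y (r y / 2)"
          using closure_subset[of \<Omega>] by (auto simp: K0_def)
        then have "indicator (\<Omega> \<inter> ball y (r y / 2)) x * ennreal ((cmod (u x))\<^sup>2)
          \<le> (\<Sum>y\<in>X. indicator (\<Omega> \<inter> ball y (r y / 2)) x * ennreal ((cmod (u x))\<^sup>2))"
          using X(2) by (intro member_le_sum) auto
        then show ?thesis using y True by simp
      qed (auto simp: indicator_def)
    qed
    also have "\<dots> = sq_mass K0 u + (\<Sum>y\<in>X. sq_mass (\<Omega> \<inter> ball y (r y / 2)) u)"
      unfolding sq_mass_def
      by (subst nn_integral_add, measurable, subst nn_integral_sum, measurable)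
    also have "\<dots> \<le> sq_mass L u + (\<Sum>y\<in>X. 2 * sq_mass L u + ennreal (e / (2 * (m + 1))) * N)"
    proof (intro add_mono sum_mono)
      show "sq_mass K0 u \<le> sq_mass L u" by (rule mono) (simp add: L_def)
      fix y assume y: "y \<in> X"
      have "sq_mass (\<Omega> \<inter> ball y (r y / 2)) u \<le> 2 * sq_mass (K y) u + ennreal (2 * (s y)\<^sup>2) * N"
        unfolding N_def by (rule K(3)[OF y w])
      also have "\<dots> \<le> 2 * sq_mass L u + ennreal (e / (2 * (m + 1))) * N"
        using s2[OF y] y by (intro add_mono mult_left_mono mult_right_mono ennreal_leI mono) (auto simp: L_def)
      finally show "sq_mass (\<Omega> \<inter> ball y (r y / 2)) u \<le> 2 * sq_mass L u + ennreal (e / (2 * (m + 1))) * N" .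
    qed
    also have "\<dots> = ennreal (2 * m + 1) * sq_mass L u + ennreal (m * (e / (2 * (m + 1)))) * N"
    proof -
      have "sq_mass L u + (\<Sum>y\<in>X. 2 * sq_mass L u + ennreal (e / (2 * (m + 1))) * N)
        = sq_mass L u + ennreal m * (2 * sq_mass L u + ennreal (e / (2 * (m + 1))) * N)"
        by (simp add: m_def ennreal_of_nat_eq_real_of_nat)
      also have "\<dots> = (2 * ennreal m + 1) * sq_mass L u + (ennreal m * ennreal (e / (2 * (m + 1)))) * N"
        by (simp only: distrib_left distrib_right mult_1 mult_ac add_ac)
      also have "2 * ennreal m + 1 = ennreal (2 * m + 1)"
        using m by (simp add: ennreal_plus ennreal_mult)
      also have "ennreal m * ennreal (e / (2 * (m + 1))) = ennreal (m * (e / (2 * (m + 1))))"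
        using m e by (intro ennreal_mult[symmetric]) auto
      finally show ?thesis .
    qed
    also have "\<dots> \<le> ennreal (2 * m + 1) * (ennreal e' * N + ennreal C * A) + ennreal (e / 2) * N"
    proof (intro add_mono mult_left_mono mult_right_mono ennreal_leI)
      show "sq_mass L u \<le> ennreal e' * N + ennreal C * A" unfolding N_def A_def by (rule Q(5)[OF w])
      show "m * (e / (2 * (m + 1))) \<le> e / 2" using e m by (simp add: field_simps)
    qed auto
    also have "\<dots> = (ennreal ((2 * m + 1) * e') + ennreal (e / 2)) * N + ennreal ((2 * m + 1) * C) * A"
      using m e' Q(4) by (simp add: ennreal_mult distrib_left distrib_right mult.assoc add.assoc add.commute add.left_commute)
    also have "ennreal ((2 * m + 1) * e') + ennreal (e / 2) = ennreal e"
      using m e by (subst ennreal_plus[symmetric]) (auto simp: e'_def field_simps)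
    finally show "sq_mass \<Omega> u \<le> ennreal e * grad_mass \<Omega> g + ennreal ((2 * m + 1) * C) *
      (\<Sum>Q\<in>Qs. mean_sq Q u)"
      by (simp add: N_def A_def)
  qed (use m Q(4) in auto)
qed

section \<open>The form domain\<close>

text \<open>Functions themselves are the vectors, with pointwise addition from the function algebra,
  and no quotient is formed. Equality almost everywhere reappears as nullity for
  \<open>L2_inner\<close>.\<close>

definition vscale :: "complex \<Rightarrow> ('a \<Rightarrow> complex^'n) \<Rightarrow> 'a \<Rightarrow> complex^'n::finite" where
  "vscale c u = (\<lambda>x. c *s u x)"

lemma vscale_apply [simp]: "vscale c u x = c *s u x"
  by (simp add: vscale_def)

lemma vector_space_vscale: "vector_space (vscale :: complex \<Rightarrow> ('a \<Rightarrow> complex^'n::finite) \<Rightarrow> _)"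
  by unfold_locales (auto simp: fun_eq_iff vec_eq_iff algebra_simps)

section \<open>L2 pairings and completeness\<close>

definition L2_pair :: "(real^'d::finite) set \<Rightarrow> (real^'d \<Rightarrow> complex) \<Rightarrow> (real^'d \<Rightarrow> complex) \<Rightarrow> complex" where
  "L2_pair \<Omega> f g = integral\<^sup>L (lebesgue_on \<Omega>) (\<lambda>x. f x * cnj (g x))"

lemma L2_pair_cong_AE:
  assumes "L2 \<Omega> f" "L2 \<Omega> f'" "L2 \<Omega> g" "L2 \<Omega> g'"
    and "AE x in lebesgue_on \<Omega>. f x = f' x" "AE x in lebesgue_on \<Omega>. g x = g' x"
  shows "L2_pair \<Omega> f g = L2_pair \<Omega> f' g'"
  unfolding L2_pair_def
proof (rule integral_cong_AE)
  show "AE x in lebesgue_on \<Omega>. f x * cnj (g x) = f' x * cnj (g' x)"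
    using assms(5,6) by eventually_elim simp
qed (use assms in \<open>auto intro!: borel_measurable_integrable L2_integrable_mult L2_cnj\<close>)

lemma L2_pair_self: "Re (L2_pair \<Omega> f f) = L2_sq \<Omega> f"
proof -
  have "L2_pair \<Omega> f f = integral\<^sup>L (lebesgue_on \<Omega>) (\<lambda>x. complex_of_real ((cmod (f x))\<^sup>2))"
    unfolding L2_pair_def by (intro Bochner_Integration.integral_cong) (auto simp: complex_norm_square simp del: of_real_power)
  then show ?thesis by (simp add: integral_complex_of_real del: of_real_power)
qed

lemma L2_pair_add: "L2 \<Omega> f \<Longrightarrow> L2 \<Omega> g \<Longrightarrow> L2 \<Omega> h \<Longrightarrow> L2_pair \<Omega> (\<lambda>x. f x + g x) h = L2_pair \<Omega> f h + L2_pair \<Omega> g h"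
  unfolding L2_pair_def by (simp add: distrib_right L2_integrable_mult L2_cnj)

lemma L2_pair_scale: "L2_pair \<Omega> (\<lambda>x. c * f x) h = c * L2_pair \<Omega> f h"
  unfolding L2_pair_def by (simp add: mult.assoc)

lemma L2_pair_cnj: "L2_pair \<Omega> g f = cnj (L2_pair \<Omega> f g)"
  using Bochner_Integration.integral_cnj[of "lebesgue_on \<Omega>" "\<lambda>x. f x * cnj (g x)"] by (simp add: L2_pair_def mult.commute)

text \<open>Common source of three semi-inner products: the scalar pairing, the inner product of
  vector fields and the Stokes form. Linearity of the \<open>T i\<close> is asked almost everywhere
  only, because \<open>wd\<close> is determined no better than that.\<close>

lemma semi_inner_product_sum_L2_pair:
  fixes sc :: "complex \<Rightarrow> 'v::ab_group_add \<Rightarrow> 'v" and T :: "'i \<Rightarrow> 'v \<Rightarrow> real^'d::finite \<Rightarrow> complex"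
  assumes vs: "vector_space sc" and S: "module.subspace sc S" and I: "finite I"
    and L: "\<And>i u. i \<in> I \<Longrightarrow> u \<in> S \<Longrightarrow> L2 \<Omega> (T i u)"
    and add: "\<And>i u v. i \<in> I \<Longrightarrow> u \<in> S \<Longrightarrow> v \<in> S \<Longrightarrow> AE x in lebesgue_on \<Omega>. T i (u + v) x = T i u x + T i v x"
    and scl: "\<And>i c u. i \<in> I \<Longrightarrow> u \<in> S \<Longrightarrow> AE x in lebesgue_on \<Omega>. T i (sc c u) x = c * T i u x"
    and b: "\<And>u v. u \<in> S \<Longrightarrow> v \<in> S \<Longrightarrow> b u v = (\<Sum>i\<in>I. L2_pair \<Omega> (T i u) (T i v))"
  shows "semi_inner_product sc S b"
proof -
  interpret vector_space sc by (rule vs)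
  show ?thesis
  proof (intro semi_inner_product.intro hermitian_form.intro hermitian_form_axioms.intro semi_inner_product_axioms.intro)
    show "vector_space sc" by (rule vs)
    show "subspace S" by (rule S)
    fix u v w c assume u: "u \<in> S" and v: "v \<in> S"
    { assume w: "w \<in> S"
      have "L2_pair \<Omega> (T i (u + v)) (T i w) = L2_pair \<Omega> (T i u) (T i w) + L2_pair \<Omega> (T i v) (T i w)" if i: "i \<in> I" for i
        using L2_pair_cong_AE[OF L[OF i subspace_add[OF S u v]] L2_add[OF L[OF i u] L[OF i v]] L[OF i w] L[OF i w] add[OF i u v]]
        by (simp add: L2_pair_add L i u v w)
      then show "b (u + v) w = b u w + b v w"
        using u v w subspace_add[OF S u v] by (simp add: b sum.distrib) }
    have "L2_pair \<Omega> (T i (sc c u)) (T i v) = c * L2_pair \<Omega> (T i u) (T i v)" if i: "i \<in> I" for i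
      using L2_pair_cong_AE[OF L[OF i subspace_scale[OF S u]] L2_scale[OF L[OF i u]] L[OF i v] L[OF i v] scl[OF i u]]
      by (simp add: L2_pair_scale)
    then show "b (sc c u) v = c * b u v"
      using u v subspace_scale[OF S u] by (simp add: b sum_distrib_left)
    have "L2_pair \<Omega> (T i v) (T i u) = cnj (L2_pair \<Omega> (T i u) (T i v))" for i by (rule L2_pair_cnj)
    then show "b v u = cnj (b u v)" using u v by (simp add: b)
  next
    fix u assume u: "u \<in> S"
    then have "Re (b u u) = (\<Sum>i\<in>I. L2_sq \<Omega> (T i u))"
      by (simp add: b L2_pair_self)
    then show "0 \<le> Re (b u u)" by (simp add: sum_nonneg)
  qed
qed

lemma L2_zero: "L2 \<Omega> (\<lambda>x. 0)" by (simp add: L2_def)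

lemma L2_pair_Cauchy_Schwarz:
  assumes "L2 \<Omega> f" "L2 \<Omega> g"
  shows "(cmod (L2_pair \<Omega> f g))\<^sup>2 \<le> Re (L2_pair \<Omega> f f) * Re (L2_pair \<Omega> g g)"
proof -
  define sc where "sc c f = (\<lambda>x. c * f x)" for c :: complex and f :: "real^'a \<Rightarrow> complex"
  have vs: "vector_space sc" unfolding sc_def by unfold_locales (auto simp: fun_eq_iff algebra_simps)
  then interpret vector_space sc .
  have "subspace {f. L2 \<Omega> f}"
    by (auto simp: subspace_def sc_def L2_zero zero_fun_def plus_fun_def intro: L2_add L2_scale)
  then have "semi_inner_product sc {f. L2 \<Omega> f} (L2_pair \<Omega>)"
    by (intro semi_inner_product_sum_L2_pair[OF vs, where I = "{()}" and T = "\<lambda>_ f. f"]) (auto simp: sc_def)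
  then show ?thesis using semi_inner_product.form_Cauchy_Schwarz[of sc "{f. L2 \<Omega> f}" "L2_pair \<Omega>" f g] assms by simp
qed

lemma integral_norm_sq_eq_0_AE:
  fixes f :: "real^'d::finite \<Rightarrow> complex"
  assumes "L2 \<Omega> f" "L2_sq \<Omega> f = 0"
  shows "AE x in lebesgue_on \<Omega>. f x = 0"
  using integral_nonneg_eq_0_iff_AE[of "lebesgue_on \<Omega>" "\<lambda>x. (cmod (f x))\<^sup>2"] assms by (simp add: L2_def)

text \<open>Riesz-Fischer argument: a fast subsequence has increments that are absolutely summable
  almost everywhere, which defines the limit pointwise, and Fatou turns the Cauchy property of the
  whole sequence into convergence.\<close>

lemma L2_complete:
  fixes f :: "nat \<Rightarrow> real^'d::finite \<Rightarrow> complex"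
  assumes O: "bounded \<Omega>" "open \<Omega>" and L: "\<And>n. L2 \<Omega> (f n)"
    and C: "\<And>e. e > 0 \<Longrightarrow> \<exists>N. \<forall>m\<ge>N. \<forall>n\<ge>N. L2_sq \<Omega> (\<lambda>x. f m x - f n x) < e"
  shows "\<exists>g. L2 \<Omega> g \<and> (\<lambda>n. L2_sq \<Omega> (\<lambda>x. f n x - g x)) \<longlonglongrightarrow> 0"
proof -
  define M where "M = lebesgue_on \<Omega>"
  have [measurable]: "f n \<in> borel_measurable M" for n using L2_measurable[OF L] by (simp add: M_def)
  interpret M: finite_measure M
    unfolding M_def using O by (intro finite_measure_lebesgue_on) (simp add: lmeasurable_open)
  define d where "d m n = integral\<^sup>L M (\<lambda>x. (cmod (f m x - f n x))\<^sup>2)" for m n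
  have iD: "integrable M (\<lambda>x. (cmod (f m x - f n x))\<^sup>2)" for m n
    using L2_diff[OF L[of m] L[of n]] by (simp add: L2_def M_def)
  have "\<exists>N. \<forall>m\<ge>N. \<forall>n\<ge>N. d m n < (1 / 4) ^ k" for k using C[of "(1/4)^k"] by (simp add: d_def M_def)
  then obtain Nf where Nf: "\<And>k m n. m \<ge> Nf k \<Longrightarrow> n \<ge> Nf k \<Longrightarrow> d m n < (1 / 4) ^ k" by metis
  \<comment> \<open>Summing all earlier thresholds puts both \<open>r k\<close> and
    \<open>r (Suc k)\<close> beyond \<open>Nf k\<close>; the summand \<open>k\<close> makes
    \<open>r\<close> tend to infinity.\<close>
  define r where "r k = k + (\<Sum>j\<le>k. Nf j)" for k
  have rk: "r k \<ge> k" for k by (simp add: r_def)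
  have rN: "r k \<ge> Nf k" "r (Suc k) \<ge> Nf k" for k
    using member_le_sum[of k "{..k}" Nf] by (auto simp: r_def)
  define h where "h k x = f (r (Suc k)) x - f (r k) x" for k x
  have [measurable]: "h k \<in> borel_measurable M" for k unfolding h_def by measurable
  have ih: "integrable M (\<lambda>x. (cmod (h k x))\<^sup>2)" for k unfolding h_def by (rule iD)
  \<comment> \<open>A weighted inequality between \<open>2 * x\<close> and
    \<open>x\<^sup>2 + 1\<close> trades the first power of the increment for its square. The cost
    \<open>(1/2) ^ k\<close> is integrable on the bounded domain and summable in
    \<open>k\<close>.\<close>
  have h1: "cmod (h k x) \<le> 2 ^ k * (cmod (h k x))\<^sup>2 + (1/2) ^ k" for k x
  proof -
    have "2 * (2 ^ k * cmod (h k x)) * 1 \<le> (2 ^ k * cmod (h k x))\<^sup>2 + 1\<^sup>2" by (rule sum_squares_bound)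
    then have "2 ^ k * cmod (h k x) \<le> (2 ^ k * cmod (h k x))\<^sup>2 + 1"
      by (smt (verit) mult_nonneg_nonneg norm_ge_zero one_power2 zero_le_power)
    then have "(1/2) ^ k * (2 ^ k * cmod (h k x)) \<le> (1/2) ^ k * ((2 ^ k * cmod (h k x))\<^sup>2 + 1)"
      by (rule mult_left_mono) simp
    then show ?thesis by (simp add: power2_eq_square power_divide field_simps)
  qed
  have "(\<integral>\<^sup>+x. ennreal (cmod (h k x)) \<partial>M) \<le> ennreal ((1/2) ^ k * (1 + measure M (space M)))" for k
  proof -
    have "(\<integral>\<^sup>+x. ennreal (cmod (h k x)) \<partial>M) \<le> (\<integral>\<^sup>+x. ennreal (2 ^ k * (cmod (h k x))\<^sup>2 + (1/2) ^ k) \<partial>M)"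
      using h1 by (intro nn_integral_mono ennreal_leI)
    also have "\<dots> = ennreal (integral\<^sup>L M (\<lambda>x. 2 ^ k * (cmod (h k x))\<^sup>2 + (1/2) ^ k))"
      using ih[of k] by (intro nn_integral_eq_integral) auto
    also have "\<dots> \<le> ennreal ((1/2) ^ k * (1 + measure M (space M)))"
    proof (rule ennreal_leI)
      have "integral\<^sup>L M (\<lambda>x. (cmod (h k x))\<^sup>2) \<le> (1/4) ^ k"
        using Nf[OF rN(2) rN(1), of k] by (simp add: h_def d_def)
      then have "2 ^ k * integral\<^sup>L M (\<lambda>x. (cmod (h k x))\<^sup>2) \<le> 2 ^ k * (1/4) ^ k" by (rule mult_left_mono) simp
      also have "\<dots> = (1/2) ^ k" by (simp add: power_mult_distrib[symmetric])
      finally show "integral\<^sup>L M (\<lambda>x. 2 ^ k * (cmod (h k x))\<^sup>2 + (1/2) ^ k) \<le> (1/2) ^ k * (1 + measure M (space M))"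
        using ih[of k] by (simp add: algebra_simps)
    qed
    finally show ?thesis .
  qed
  then have "(\<Sum>k. \<integral>\<^sup>+x. ennreal (cmod (h k x)) \<partial>M) \<le> (\<Sum>k. ennreal ((1/2) ^ k * (1 + measure M (space M))))"
    by (intro suminf_le) auto
  also have "\<dots> = ennreal (\<Sum>k. (1/2) ^ k * (1 + measure M (space M)))"
    by (intro suminf_ennreal2 summable_mult2 summable_geometric) auto
  also have "\<dots> < top" by simp
  finally have "(\<integral>\<^sup>+x. (\<Sum>k. ennreal (cmod (h k x))) \<partial>M) < top"
    by (subst nn_integral_suminf) auto
  then have "AE x in M. (\<Sum>k. ennreal (cmod (h k x))) \<noteq> \<infinity>"
    by (intro nn_integral_PInf_AE) auto
  then have conv: "AE x in M. convergent (\<lambda>k. f (r k) x)"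
  proof (rule eventually_mono)
    fix x assume "(\<Sum>k. ennreal (cmod (h k x))) \<noteq> \<infinity>"
    then have "summable (\<lambda>k. cmod (h k x))" by (intro summable_suminf_not_top) (simp_all add: infinity_ennreal_def)
    then have "summable (\<lambda>k. h k x)" by (rule summable_norm_cancel)
    then have "convergent (\<lambda>n. \<Sum>k<n. h k x)" by (simp add: summable_iff_convergent)
    moreover have "(\<Sum>k<n. h k x) = f (r n) x - f (r 0) x" for n
      by (simp add: h_def sum_lessThan_telescope[of "\<lambda>k. f (r k) x"])
    ultimately have "convergent (\<lambda>n. (f (r n) x - f (r 0) x) + f (r 0) x)" by (simp only: convergent_add_const_right_iff)
    then show "convergent (\<lambda>k. f (r k) x)" by simp
  qed
  define g where "g x = lim (\<lambda>k. f (r k) x)" for x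
  have [measurable]: "g \<in> borel_measurable M" unfolding g_def by measurable
  have lim: "AE x in M. (\<lambda>k. f (r k) x) \<longlonglongrightarrow> g x"
    using conv by eventually_elim (simp add: g_def convergent_LIMSEQ_iff)
  have fatou: "(\<integral>\<^sup>+x. ennreal ((cmod (f n x - g x))\<^sup>2) \<partial>M) \<le> ennreal e"
    if e: "e > 0" and N: "\<And>m. m \<ge> N \<Longrightarrow> d n m \<le> e" for n N e
  proof -
    have "(\<integral>\<^sup>+x. ennreal ((cmod (f n x - g x))\<^sup>2) \<partial>M) = (\<integral>\<^sup>+x. liminf (\<lambda>k. ennreal ((cmod (f n x - f (r k) x))\<^sup>2)) \<partial>M)"
    proof (rule nn_integral_cong_AE)
      show "AE x in M. ennreal ((cmod (f n x - g x))\<^sup>2) = liminf (\<lambda>k. ennreal ((cmod (f n x - f (r k) x))\<^sup>2))"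
        using lim
      proof eventually_elim
        case (elim x)
        have "(\<lambda>k. ennreal ((cmod (f n x - f (r k) x))\<^sup>2)) \<longlonglongrightarrow> ennreal ((cmod (f n x - g x))\<^sup>2)"
          by (intro tendsto_intros elim)
        then show ?case using lim_imp_Liminf[OF sequentially_bot] by metis
      qed
    qed
    also have "\<dots> \<le> liminf (\<lambda>k. \<integral>\<^sup>+x. ennreal ((cmod (f n x - f (r k) x))\<^sup>2) \<partial>M)"
      by (rule nn_integral_liminf) measurable
    also have "\<dots> \<le> limsup (\<lambda>k. \<integral>\<^sup>+x. ennreal ((cmod (f n x - f (r k) x))\<^sup>2) \<partial>M)"
      by (rule Liminf_le_Limsup) simp
    also have "\<dots> \<le> ennreal e"
    proof (rule Limsup_bounded)
      have "(\<integral>\<^sup>+x. ennreal ((cmod (f n x - f (r k) x))\<^sup>2) \<partial>M) \<le> ennreal e" if "k \<ge> N" for k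
      proof -
        have "(\<integral>\<^sup>+x. ennreal ((cmod (f n x - f (r k) x))\<^sup>2) \<partial>M) = ennreal (d n (r k))"
          unfolding d_def by (intro nn_integral_eq_integral iD) auto
        also have "\<dots> \<le> ennreal e" using N[of "r k"] rk[of k] that by (intro ennreal_leI) linarith
        finally show ?thesis .
      qed
      then show "eventually (\<lambda>k. (\<integral>\<^sup>+x. ennreal ((cmod (f n x - f (r k) x))\<^sup>2) \<partial>M) \<le> ennreal e) sequentially"
        by (auto simp: eventually_sequentially)
    qed
    finally show ?thesis .
  qed
  have iG: "integrable M (\<lambda>x. (cmod (f n x - g x))\<^sup>2)"
    if "(\<integral>\<^sup>+x. ennreal ((cmod (f n x - g x))\<^sup>2) \<partial>M) \<le> ennreal e" for n e
    using that by (intro integrableI_bounded) (auto simp: le_less_trans[OF _ ennreal_less_top])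
  have Lg: "L2 \<Omega> g"
  proof -
    have "d (Nf 0) m \<le> 1" if "m \<ge> Nf 0" for m using Nf[of 0 "Nf 0" m] that by simp
    then have "integrable M (\<lambda>x. (cmod (f (Nf 0) x - g x))\<^sup>2)"
      by (intro iG[of _ 1] fatou[of 1 "Nf 0" "Nf 0"]) auto
    then have "L2 \<Omega> (\<lambda>x. f (Nf 0) x - g x)" by (simp add: L2_def M_def[symmetric])
    then show ?thesis using L2_diff[OF L[of "Nf 0"], of "\<lambda>x. f (Nf 0) x - g x"] by simp
  qed
  have "(\<lambda>n. integral\<^sup>L M (\<lambda>x. (cmod (f n x - g x))\<^sup>2)) \<longlonglongrightarrow> 0"
  proof (rule LIMSEQ_I)
    fix e :: real assume e: "e > 0"
    obtain N where N: "\<And>m n. m \<ge> N \<Longrightarrow> n \<ge> N \<Longrightarrow> d m n < e / 2" using C[of "e/2"] e by (auto simp: d_def M_def)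
    have "norm (integral\<^sup>L M (\<lambda>x. (cmod (f n x - g x))\<^sup>2) - 0) < e" if "n \<ge> N" for n
    proof -
      have *: "(\<integral>\<^sup>+x. ennreal ((cmod (f n x - g x))\<^sup>2) \<partial>M) \<le> ennreal (e/2)"
        using e N that by (intro fatou[of _ N]) (auto intro: less_imp_le)
      then have "ennreal (integral\<^sup>L M (\<lambda>x. (cmod (f n x - g x))\<^sup>2)) \<le> ennreal (e/2)"
        by (subst nn_integral_eq_integral[symmetric]) (auto intro: iG)
      then have "integral\<^sup>L M (\<lambda>x. (cmod (f n x - g x))\<^sup>2) \<le> e / 2" using e by (simp add: ennreal_le_iff)
      moreover have "0 \<le> integral\<^sup>L M (\<lambda>x. (cmod (f n x - g x))\<^sup>2)" by simp
      ultimately show ?thesis using e by simp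
    qed
    then show "\<exists>N. \<forall>n\<ge>N. norm (integral\<^sup>L M (\<lambda>x. (cmod (f n x - g x))\<^sup>2) - 0) < e" by blast
  qed
  with Lg show ?thesis by (auto simp: M_def)
qed

section \<open>Linear structure of \<open>H1\<close> and the two forms on \<open>V_N\<close>\<close>

lemma H1_component: "H1 \<Omega> u \<Longrightarrow> L2 \<Omega> (\<lambda>x. u x $ l)"
  by (simp add: H1_def L2_vec_iff)

lemma H1_I:
  assumes O: "bounded \<Omega>" "open \<Omega>" and "\<And>l. L2 \<Omega> (\<lambda>x. u x $ l)" "\<And>k l. L2 \<Omega> (g k l)"
    "\<And>k l. is_weak_deriv \<Omega> k (\<lambda>x. u x $ l) (g k l)"
  shows "H1 \<Omega> u" "AE x in lebesgue_on \<Omega>. wd \<Omega> k l u x = g k l x"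
proof -
  show "H1 \<Omega> u" unfolding H1_def using assms(3) assms(4,5) by (auto simp: L2_vec_iff intro!: exI[of _ "g _ _"])
  show "AE x in lebesgue_on \<Omega>. wd \<Omega> k l u x = g k l x"
    using assms by (intro wd_eqI) auto
qed

lemma H1_lincomb:
  assumes O: "bounded \<Omega>" "open \<Omega>" and u: "H1 \<Omega> u" and v: "H1 \<Omega> v"
  shows "H1 \<Omega> (vscale c u + v)"
    "AE x in lebesgue_on \<Omega>. wd \<Omega> k l (vscale c u + v) x = c * wd \<Omega> k l u x + wd \<Omega> k l v x"
proof -
  have 1: "L2 \<Omega> (\<lambda>x. (vscale c u + v) x $ l)" for l
    using L2_add[OF L2_scale[OF H1_component[OF u]] H1_component[OF v]] by simp
  have 2: "L2 \<Omega> (\<lambda>x. c * wd \<Omega> k l u x + wd \<Omega> k l v x)" for k l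
    by (intro L2_add L2_scale H1_wd u v)
  have 3: "is_weak_deriv \<Omega> k (\<lambda>x. (vscale c u + v) x $ l) (\<lambda>x. c * wd \<Omega> k l u x + wd \<Omega> k l v x)" for k l
    using is_weak_deriv_lincomb[OF O H1_component[OF u] H1_wd(1)[OF u] H1_component[OF v] H1_wd(1)[OF v] H1_wd(2)[OF u] H1_wd(2)[OF v]]
    by simp
  show "H1 \<Omega> (vscale c u + v)"
    "AE x in lebesgue_on \<Omega>. wd \<Omega> k l (vscale c u + v) x = c * wd \<Omega> k l u x + wd \<Omega> k l v x"
    by (rule H1_I(1)[OF O 1 2 3], rule H1_I(2)[OF O 1 2 3])
qed

text \<open>Stated for functions that vanish almost everywhere, and not just for the zero function,
  because this is what makes the Stokes form blind to the null vectors of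
  \<open>L2_inner\<close>.\<close>

lemma H1_zero:
  assumes O: "bounded \<Omega>" "open \<Omega>" and z: "\<And>l. AE x in lebesgue_on \<Omega>. u x $ l = 0" "\<And>l. L2 \<Omega> (\<lambda>x. u x $ l)"
  shows "H1 \<Omega> u" "AE x in lebesgue_on \<Omega>. wd \<Omega> k l u x = 0"
proof -
  have "is_weak_deriv \<Omega> k (\<lambda>x. u x $ l) (\<lambda>x. 0)" for k l
    unfolding is_weak_deriv_def
  proof (intro allI impI)
    fix \<phi>
    have "integral\<^sup>L (lebesgue_on \<Omega>) (\<lambda>x. u x $ l * complex_of_real (pderiv_cl k \<phi> x)) = 0"
      by (rule integral_eq_zero_AE) (use z(1)[of l] in \<open>eventually_elim, simp\<close>)
    then show "integral\<^sup>L (lebesgue_on \<Omega>) (\<lambda>x. u x $ l * complex_of_real (pderiv_cl k \<phi> x)) =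
      - integral\<^sup>L (lebesgue_on \<Omega>) (\<lambda>x. 0 * complex_of_real (\<phi> x))" by simp
  qed
  then show "H1 \<Omega> u" "AE x in lebesgue_on \<Omega>. wd \<Omega> k l u x = 0"
    using H1_I[OF O z(2) L2_zero] by auto
qed

lemma subspace_V_N:
  assumes O: "bounded \<Omega>" "open \<Omega>"
  shows "module.subspace vscale (V_N \<Omega>)"
proof -
  interpret vector_space "vscale :: complex \<Rightarrow> (real^'a \<Rightarrow> complex^'a) \<Rightarrow> _" by (rule vector_space_vscale)
  have 0: "0 \<in> V_N \<Omega>"
  proof -
    have "AE x in lebesgue_on \<Omega>. (\<Sum>k\<in>UNIV. wd \<Omega> k k 0 x) = 0"
    proof -
      have "AE x in lebesgue_on \<Omega>. \<forall>k. wd \<Omega> k k 0 x = 0"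
        using H1_zero(2)[OF O, of 0] by (simp add: AE_all_countable L2_zero)
      then show ?thesis by eventually_elim simp
    qed
    then show ?thesis using H1_zero(1)[OF O, of 0] by (simp add: V_N_def div_free_def L2_zero)
  qed
  have lin: "vscale c u + v \<in> V_N \<Omega>" if u: "u \<in> V_N \<Omega>" and v: "v \<in> V_N \<Omega>" for c u v
  proof -
    have H: "H1 \<Omega> u" "H1 \<Omega> v" and d: "AE x in lebesgue_on \<Omega>. (\<Sum>k\<in>UNIV. wd \<Omega> k k u x) = 0"
      "AE x in lebesgue_on \<Omega>. (\<Sum>k\<in>UNIV. wd \<Omega> k k v x) = 0"
      using u v by (auto simp: V_N_def div_free_def)
    have "AE x in lebesgue_on \<Omega>. \<forall>k. wd \<Omega> k k (vscale c u + v) x = c * wd \<Omega> k k u x + wd \<Omega> k k v x"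
      using H1_lincomb(2)[OF O H] by (simp add: AE_all_countable)
    with d have "AE x in lebesgue_on \<Omega>. (\<Sum>k\<in>UNIV. wd \<Omega> k k (vscale c u + v) x) = 0"
      by eventually_elim (simp add: sum.distrib sum_distrib_left[symmetric])
    then show ?thesis using H1_lincomb(1)[OF O H] by (simp add: V_N_def div_free_def)
  qed
  show ?thesis unfolding subspace_def
  proof (intro conjI ballI allI)
    show "0 \<in> V_N \<Omega>" by (rule 0)
    fix u v assume "u \<in> V_N \<Omega>" "v \<in> V_N \<Omega>"
    then show "u + v \<in> V_N \<Omega>" using lin[of u v 1] by simp
  next
    fix c u assume "u \<in> V_N \<Omega>"
    then show "vscale c u \<in> V_N \<Omega>" using lin[of u 0 c] 0 by simp
  qed
qed

lemma L2_inner_eq_sum: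
  assumes "\<And>l. L2 \<Omega> (\<lambda>x. u x $ l)" "\<And>l. L2 \<Omega> (\<lambda>x. v x $ l)"
  shows "L2_inner \<Omega> u v = (\<Sum>l\<in>UNIV. L2_pair \<Omega> (\<lambda>x. u x $ l) (\<lambda>x. v x $ l))"
  unfolding L2_inner_def L2_pair_def using assms
  by (intro Bochner_Integration.integral_sum L2_integrable_mult L2_cnj)

lemma semi_inner_product_L2_inner:
  assumes O: "bounded \<Omega>" "open \<Omega>"
  shows "semi_inner_product vscale (V_N \<Omega>) (L2_inner \<Omega>)"
proof (rule semi_inner_product_sum_L2_pair[OF vector_space_vscale subspace_V_N[OF O], where I = UNIV and T = "\<lambda>l u x. u x $ l"])
  fix l u assume "u \<in> V_N \<Omega>"
  then show "L2 \<Omega> (\<lambda>x. u x $ l)" by (simp add: V_N_def H1_component)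
next
  fix u v assume "u \<in> V_N \<Omega>" "v \<in> V_N \<Omega>"
  then show "L2_inner \<Omega> u v = (\<Sum>l\<in>UNIV. L2_pair \<Omega> (\<lambda>x. u x $ l) (\<lambda>x. v x $ l))"
    by (intro L2_inner_eq_sum) (auto simp: V_N_def H1_component)
qed auto

lemma stokes_form_eq_sum:
  "stokes_form \<Omega> u v = (\<Sum>i\<in>UNIV \<times> UNIV. L2_pair \<Omega> (wd \<Omega> (fst i) (snd i) u) (wd \<Omega> (fst i) (snd i) v))"
  unfolding stokes_form_def L2_pair_def by (simp add: sum.cartesian_product case_prod_beta)

lemma semi_inner_product_stokes_form:
  assumes O: "bounded \<Omega>" "open \<Omega>"
  shows "semi_inner_product vscale (V_N \<Omega>) (stokes_form \<Omega>)"
proof (rule semi_inner_product_sum_L2_pair[OF vector_space_vscale subspace_V_N[OF O], where I = "UNIV \<times> UNIV" and T = "\<lambda>i. wd \<Omega> (fst i) (snd i)"])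
  interpret vector_space "vscale :: complex \<Rightarrow> (real^'a \<Rightarrow> complex^'a) \<Rightarrow> _" by (rule vector_space_vscale)
  note S0 = subspace_0[OF subspace_V_N[OF O]]
  fix i :: "'a \<times> 'a" and u assume u: "u \<in> V_N \<Omega>"
  then have Hu: "H1 \<Omega> u" by (simp add: V_N_def)
  show "L2 \<Omega> (wd \<Omega> (fst i) (snd i) u)" by (rule H1_wd(1)[OF Hu])
  { fix v assume v: "v \<in> V_N \<Omega>"
    then show "AE x in lebesgue_on \<Omega>. wd \<Omega> (fst i) (snd i) (u + v) x = wd \<Omega> (fst i) (snd i) u x + wd \<Omega> (fst i) (snd i) v x"
      using H1_lincomb(2)[OF O Hu, of v _ _ 1] by (simp add: V_N_def) }
  fix c
  have H0: "H1 \<Omega> 0" using S0 by (simp add: V_N_def)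
  have z: "AE x in lebesgue_on \<Omega>. wd \<Omega> (fst i) (snd i) 0 x = 0"
    using H1_zero(2)[OF O, of 0] by (simp add: L2_zero)
  have "AE x in lebesgue_on \<Omega>. wd \<Omega> (fst i) (snd i) (vscale c u + 0) x = c * wd \<Omega> (fst i) (snd i) u x + wd \<Omega> (fst i) (snd i) 0 x"
    by (rule H1_lincomb(2)[OF O Hu H0])
  with z show "AE x in lebesgue_on \<Omega>. wd \<Omega> (fst i) (snd i) (vscale c u) x = c * wd \<Omega> (fst i) (snd i) u x"
    by eventually_elim simp
qed (auto simp: stokes_form_eq_sum)

lemma Re_L2_inner_self:
  assumes "H1 \<Omega> u"
  shows "Re (L2_inner \<Omega> u u) = (\<Sum>l\<in>UNIV. L2_sq \<Omega> (\<lambda>x. u x $ l))"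
  using L2_inner_eq_sum[OF H1_component[OF assms] H1_component[OF assms]] by (simp add: L2_pair_self)

lemma Re_stokes_form_self:
  "Re (stokes_form \<Omega> u u) = (\<Sum>k\<in>UNIV. \<Sum>l\<in>UNIV. L2_sq \<Omega> (wd \<Omega> k l u))"
  unfolding stokes_form_def by (simp add: L2_pair_self[unfolded L2_pair_def])

lemma Re_L2_inner_eq_0_iff:
  assumes "H1 \<Omega> u"
  shows "Re (L2_inner \<Omega> u u) = 0 \<longleftrightarrow> (AE x in lebesgue_on \<Omega>. u x = 0)"
proof -
  have "Re (L2_inner \<Omega> u u) = 0 \<longleftrightarrow> (\<forall>l. L2_sq \<Omega> (\<lambda>x. u x $ l) = 0)"
    unfolding Re_L2_inner_self[OF assms] by (subst sum_nonneg_eq_0_iff) auto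
  also have "\<dots> \<longleftrightarrow> (\<forall>l. AE x in lebesgue_on \<Omega>. u x $ l = 0)"
  proof (intro iff_allI iffI)
    fix l assume "AE x in lebesgue_on \<Omega>. u x $ l = 0"
    then have "AE x in lebesgue_on \<Omega>. (cmod (u x $ l))\<^sup>2 = 0" by eventually_elim simp
    then show "L2_sq \<Omega> (\<lambda>x. u x $ l) = 0" by (rule integral_eq_zero_AE)
  qed (use integral_norm_sq_eq_0_AE H1_component[OF assms] in blast)
  also have "\<dots> \<longleftrightarrow> (AE x in lebesgue_on \<Omega>. u x = 0)"
    by (simp add: AE_all_countable[symmetric] vec_eq_iff)
  finally show ?thesis .
qed

section \<open>Completeness of the form domain\<close>

lemma L2_pair_tendsto:
  assumes L: "\<And>n. L2 \<Omega> (f n)" "L2 \<Omega> g" "L2 \<Omega> h"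
    and lim: "(\<lambda>n. L2_sq \<Omega> (\<lambda>x. f n x - g x)) \<longlonglongrightarrow> 0"
  shows "(\<lambda>n. L2_pair \<Omega> (f n) h) \<longlonglongrightarrow> L2_pair \<Omega> g h"
proof -
  have "(\<lambda>n. (cmod (L2_pair \<Omega> (f n) h - L2_pair \<Omega> g h))\<^sup>2) \<longlonglongrightarrow> 0"
  proof (rule tendsto_sandwich[OF _ _ tendsto_const])
    show "eventually (\<lambda>n. (cmod (L2_pair \<Omega> (f n) h - L2_pair \<Omega> g h))\<^sup>2
      \<le> L2_sq \<Omega> (\<lambda>x. f n x - g x) * Re (L2_pair \<Omega> h h)) sequentially"
    proof (intro always_eventually allI)
      fix n
      have "L2_pair \<Omega> (f n) h = L2_pair \<Omega> (\<lambda>x. f n x - g x) h + L2_pair \<Omega> g h"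
        using L2_pair_add[OF L2_diff[OF L(1)[of n] L(2)] L(2,3)] by simp
      then have "L2_pair \<Omega> (f n) h - L2_pair \<Omega> g h = L2_pair \<Omega> (\<lambda>x. f n x - g x) h" by simp
      then show "(cmod (L2_pair \<Omega> (f n) h - L2_pair \<Omega> g h))\<^sup>2
        \<le> L2_sq \<Omega> (\<lambda>x. f n x - g x) * Re (L2_pair \<Omega> h h)"
        using L2_pair_Cauchy_Schwarz[OF L2_diff[OF L(1)[of n] L(2)] L(3)] by (simp add: L2_pair_self)
    qed
    show "(\<lambda>n. L2_sq \<Omega> (\<lambda>x. f n x - g x) * Re (L2_pair \<Omega> h h)) \<longlonglongrightarrow> 0"
      using tendsto_mult[OF lim tendsto_const] by simp
  qed auto
  then have "(\<lambda>n. sqrt ((cmod (L2_pair \<Omega> (f n) h - L2_pair \<Omega> g h))\<^sup>2)) \<longlonglongrightarrow> sqrt 0" by (rule tendsto_real_sqrt)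
  then have "(\<lambda>n. L2_pair \<Omega> (f n) h - L2_pair \<Omega> g h) \<longlonglongrightarrow> 0"
    by (simp add: tendsto_norm_zero_iff)
  then show ?thesis by (simp add: LIM_zero_iff)
qed

text \<open>For a fixed test function both sides of the defining identity are continuous in
  L2.\<close>

lemma is_weak_deriv_limit:
  assumes O: "bounded \<Omega>" "open \<Omega>"
    and L: "\<And>n. L2 \<Omega> (f n)" "\<And>n. L2 \<Omega> (f' n)" "L2 \<Omega> g" "L2 \<Omega> g'"
    and w: "\<And>n. is_weak_deriv \<Omega> k (f n) (f' n)"
    and lim: "(\<lambda>n. L2_sq \<Omega> (\<lambda>x. f n x - g x)) \<longlonglongrightarrow> 0"
      "(\<lambda>n. L2_sq \<Omega> (\<lambda>x. f' n x - g' x)) \<longlonglongrightarrow> 0"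
  shows "is_weak_deriv \<Omega> k g g'"
  unfolding is_weak_deriv_def
proof (intro allI impI)
  fix \<phi> assume \<phi>: "test_fun \<Omega> \<phi>"
  have "(\<lambda>n. L2_pair \<Omega> (f n) (\<lambda>x. complex_of_real (pderiv_cl k \<phi> x))) \<longlonglongrightarrow> L2_pair \<Omega> g (\<lambda>x. complex_of_real (pderiv_cl k \<phi> x))"
    by (rule L2_pair_tendsto[OF L(1,3) L2_test_fun(2)[OF O \<phi>] lim(1)])
  moreover have "(\<lambda>n. - L2_pair \<Omega> (f' n) (\<lambda>x. complex_of_real (\<phi> x))) \<longlonglongrightarrow> - L2_pair \<Omega> g' (\<lambda>x. complex_of_real (\<phi> x))"
    by (intro tendsto_minus L2_pair_tendsto[OF L(2,4) L2_test_fun(1)[OF O \<phi>] lim(2)])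
  moreover have "L2_pair \<Omega> (f n) (\<lambda>x. complex_of_real (pderiv_cl k \<phi> x)) = - L2_pair \<Omega> (f' n) (\<lambda>x. complex_of_real (\<phi> x))" for n
    using w[of n] \<phi> by (simp add: is_weak_deriv_def L2_pair_def)
  ultimately have "L2_pair \<Omega> g (\<lambda>x. complex_of_real (pderiv_cl k \<phi> x)) = - L2_pair \<Omega> g' (\<lambda>x. complex_of_real (\<phi> x))"
    using LIMSEQ_unique by simp
  then show "integral\<^sup>L (lebesgue_on \<Omega>) (\<lambda>x. g x * complex_of_real (pderiv_cl k \<phi> x))
      = - integral\<^sup>L (lebesgue_on \<Omega>) (\<lambda>x. g' x * complex_of_real (\<phi> x))" by (simp add: L2_pair_def)
qed

lemma H1_diff:
  assumes O: "bounded \<Omega>" "open \<Omega>" and u: "H1 \<Omega> u" and v: "H1 \<Omega> v"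
  shows "H1 \<Omega> (u - v)" "AE x in lebesgue_on \<Omega>. wd \<Omega> k l (u - v) x = wd \<Omega> k l u x - wd \<Omega> k l v x"
proof -
  have e: "vscale (-1) v + u = u - v" by (auto simp: fun_eq_iff vec_eq_iff)
  show "H1 \<Omega> (u - v)" using H1_lincomb(1)[OF O v u, of "-1"] unfolding e .
  have "AE x in lebesgue_on \<Omega>. wd \<Omega> k l (u - v) x = (-1) * wd \<Omega> k l v x + wd \<Omega> k l u x"
    using H1_lincomb(2)[OF O v u, of k l "-1"] unfolding e .
  then show "AE x in lebesgue_on \<Omega>. wd \<Omega> k l (u - v) x = wd \<Omega> k l u x - wd \<Omega> k l v x" by eventually_elim simp
qed

lemma integral_norm_sq_cong_AE:
  assumes "L2 \<Omega> f" "L2 \<Omega> g" "AE x in lebesgue_on \<Omega>. f x = g x"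
  shows "L2_sq \<Omega> f = L2_sq \<Omega> g"
  using L2_pair_cong_AE[OF assms(1,2,1,2,3,3)] by (simp flip: L2_pair_self)

lemma Re_L2_inner_diff:
  assumes O: "bounded \<Omega>" "open \<Omega>" and "H1 \<Omega> u" "H1 \<Omega> v"
  shows "Re (L2_inner \<Omega> (u - v) (u - v)) = (\<Sum>l\<in>UNIV. L2_sq \<Omega> (\<lambda>x. u x $ l - v x $ l))"
  using Re_L2_inner_self[OF H1_diff(1)[OF assms]] by simp

lemma Re_stokes_form_diff:
  assumes O: "bounded \<Omega>" "open \<Omega>" and u: "H1 \<Omega> u" and v: "H1 \<Omega> v"
  shows "Re (stokes_form \<Omega> (u - v) (u - v))
    = (\<Sum>k\<in>UNIV. \<Sum>l\<in>UNIV. L2_sq \<Omega> (\<lambda>x. wd \<Omega> k l u x - wd \<Omega> k l v x))"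
  unfolding Re_stokes_form_self
  by (intro sum.cong refl integral_norm_sq_cong_AE H1_wd(1) H1_diff O u v L2_diff)

text \<open>Components and weak derivatives are Cauchy in L2 one by one, and the limits fit together
  because weak derivatives are closed under such limits. Vanishing divergence survives since it can
  be tested against test functions, for which convergence of the pairings suffices.\<close>

lemma V_N_complete:
  assumes O: "bounded \<Omega>" "open \<Omega>" and u: "\<And>n. u n \<in> V_N \<Omega>"
    and C: "\<And>e. e > 0 \<Longrightarrow> \<exists>N. \<forall>m\<ge>N. \<forall>n\<ge>N. Re (L2_inner \<Omega> (u m - u n) (u m - u n)) + Re (stokes_form \<Omega> (u m - u n) (u m - u n)) < e"
  shows "\<exists>v\<in>V_N \<Omega>. (\<lambda>n. Re (L2_inner \<Omega> (u n - v) (u n - v))) \<longlonglongrightarrow> 0 \<and> (\<lambda>n. Re (stokes_form \<Omega> (u n - v) (u n - v))) \<longlonglongrightarrow> 0"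
proof -
  have H: "H1 \<Omega> (u n)" for n using u by (simp add: V_N_def)
  have le1: "L2_sq \<Omega> (\<lambda>x. u m x $ l - u n x $ l) \<le> Re (L2_inner \<Omega> (u m - u n) (u m - u n)) + Re (stokes_form \<Omega> (u m - u n) (u m - u n))" for m n l
  proof -
    have "L2_sq \<Omega> (\<lambda>x. u m x $ l - u n x $ l) \<le> Re (L2_inner \<Omega> (u m - u n) (u m - u n))"
      unfolding Re_L2_inner_diff[OF O H H]
      by (rule member_le_sum[of l UNIV "\<lambda>l. L2_sq \<Omega> (\<lambda>x. u m x $ l - u n x $ l)"]) auto
    moreover have "0 \<le> Re (stokes_form \<Omega> (u m - u n) (u m - u n))" unfolding Re_stokes_form_self by (intro sum_nonneg) auto
    ultimately show ?thesis by simp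
  qed
  have le2: "L2_sq \<Omega> (\<lambda>x. wd \<Omega> k l (u m) x - wd \<Omega> k l (u n) x) \<le> Re (L2_inner \<Omega> (u m - u n) (u m - u n)) + Re (stokes_form \<Omega> (u m - u n) (u m - u n))" for m n k l
  proof -
    have "L2_sq \<Omega> (\<lambda>x. wd \<Omega> k l (u m) x - wd \<Omega> k l (u n) x) \<le> (\<Sum>l\<in>UNIV. L2_sq \<Omega> (\<lambda>x. wd \<Omega> k l (u m) x - wd \<Omega> k l (u n) x))"
      by (rule member_le_sum[of l UNIV "\<lambda>l. L2_sq \<Omega> (\<lambda>x. wd \<Omega> k l (u m) x - wd \<Omega> k l (u n) x)"]) auto
    also have "\<dots> \<le> Re (stokes_form \<Omega> (u m - u n) (u m - u n))"
      unfolding Re_stokes_form_diff[OF O H H]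
      by (rule member_le_sum[of k UNIV "\<lambda>k. (\<Sum>l\<in>UNIV. L2_sq \<Omega> (\<lambda>x. wd \<Omega> k l (u m) x - wd \<Omega> k l (u n) x))"]) (auto intro!: sum_nonneg)
    moreover have "0 \<le> Re (L2_inner \<Omega> (u m - u n) (u m - u n))"
      unfolding Re_L2_inner_diff[OF O H H] by (intro sum_nonneg) auto
    ultimately show ?thesis by simp
  qed
  have ex1: "\<exists>g. L2 \<Omega> g \<and> (\<lambda>n. L2_sq \<Omega> (\<lambda>x. u n x $ l - g x)) \<longlonglongrightarrow> 0" for l
  proof (rule L2_complete[OF O])
    fix e :: real assume "e > 0"
    from C[OF this] obtain N where N: "\<forall>m\<ge>N. \<forall>n\<ge>N. Re (L2_inner \<Omega> (u m - u n) (u m - u n)) + Re (stokes_form \<Omega> (u m - u n) (u m - u n)) < e" by blast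
    show "\<exists>N. \<forall>m\<ge>N. \<forall>n\<ge>N. L2_sq \<Omega> (\<lambda>x. u m x $ l - u n x $ l) < e"
      by (intro exI[of _ N] allI impI) (rule le_less_trans[OF le1], use N in blast)
  qed (rule H1_component[OF H])
  have "\<forall>l. \<exists>g. L2 \<Omega> g \<and> (\<lambda>n. L2_sq \<Omega> (\<lambda>x. u n x $ l - g x)) \<longlonglongrightarrow> 0" using ex1 by blast
  from choice[OF this] obtain f where f: "\<And>l. L2 \<Omega> (f l)" "\<And>l. (\<lambda>n. L2_sq \<Omega> (\<lambda>x. u n x $ l - f l x)) \<longlonglongrightarrow> 0" by blast
  have ex2: "\<exists>g. L2 \<Omega> g \<and> (\<lambda>n. L2_sq \<Omega> (\<lambda>x. wd \<Omega> k l (u n) x - g x)) \<longlonglongrightarrow> 0" for k l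
  proof (rule L2_complete[OF O])
    fix e :: real assume "e > 0"
    from C[OF this] obtain N where N: "\<forall>m\<ge>N. \<forall>n\<ge>N. Re (L2_inner \<Omega> (u m - u n) (u m - u n)) + Re (stokes_form \<Omega> (u m - u n) (u m - u n)) < e" by blast
    show "\<exists>N. \<forall>m\<ge>N. \<forall>n\<ge>N. L2_sq \<Omega> (\<lambda>x. wd \<Omega> k l (u m) x - wd \<Omega> k l (u n) x) < e"
      by (intro exI[of _ N] allI impI) (rule le_less_trans[OF le2], use N in blast)
  qed (rule H1_wd(1)[OF H])
  have "\<forall>k. \<exists>g. \<forall>l. L2 \<Omega> (g l) \<and> (\<lambda>n. L2_sq \<Omega> (\<lambda>x. wd \<Omega> k l (u n) x - g l x)) \<longlonglongrightarrow> 0"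
  proof
    fix k
    have "\<forall>l. \<exists>g. L2 \<Omega> g \<and> (\<lambda>n. L2_sq \<Omega> (\<lambda>x. wd \<Omega> k l (u n) x - g x)) \<longlonglongrightarrow> 0" using ex2 by blast
    from choice[OF this] show "\<exists>g. \<forall>l. L2 \<Omega> (g l) \<and> (\<lambda>n. L2_sq \<Omega> (\<lambda>x. wd \<Omega> k l (u n) x - g l x)) \<longlonglongrightarrow> 0" .
  qed
  from choice[OF this] obtain g where g: "\<And>k l. L2 \<Omega> (g k l)" "\<And>k l. (\<lambda>n. L2_sq \<Omega> (\<lambda>x. wd \<Omega> k l (u n) x - g k l x)) \<longlonglongrightarrow> 0" by blast
  define v where "v x = (\<chi> l. f l x)" for x
  have vl: "(\<lambda>x. v x $ l) = f l" for l by (simp add: v_def)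
  have wv: "is_weak_deriv \<Omega> k (\<lambda>x. v x $ l) (g k l)" for k l
    unfolding vl by (rule is_weak_deriv_limit[OF O H1_component[OF H] H1_wd(1)[OF H] f(1) g(1) H1_wd(2)[OF H] f(2) g(2)])
  have Hv: "H1 \<Omega> v" and wdv: "\<And>k l. AE x in lebesgue_on \<Omega>. wd \<Omega> k l v x = g k l x"
    using H1_I[OF O _ g(1) wv] f(1) vl by auto
  have "AE x in lebesgue_on \<Omega>. (\<Sum>k\<in>UNIV. g k k x) = 0"
  proof (rule AE_eq_0_if_orthogonal_test_funs[OF O])
    show "L2 \<Omega> (\<lambda>x. \<Sum>k\<in>UNIV. g k k x)" by (intro L2_sum g) auto
    fix \<phi> assume \<phi>: "test_fun \<Omega> \<phi>"
    let ?p = "\<lambda>x. complex_of_real (\<phi> x)"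
    have p: "L2 \<Omega> ?p" by (rule L2_test_fun(1)[OF O \<phi>])
    have s: "integral\<^sup>L (lebesgue_on \<Omega>) (\<lambda>x. (\<Sum>k\<in>UNIV. h k x) * ?p x) = (\<Sum>k\<in>UNIV. L2_pair \<Omega> (h k) ?p)"
      if "\<And>k. L2 \<Omega> (h k)" for h :: "'a \<Rightarrow> _"
      using that p by (simp add: sum_distrib_right L2_pair_def Bochner_Integration.integral_sum L2_integrable_mult)
    have "(\<lambda>n. \<Sum>k\<in>UNIV. L2_pair \<Omega> (wd \<Omega> k k (u n)) ?p) \<longlonglongrightarrow> (\<Sum>k\<in>UNIV. L2_pair \<Omega> (g k k) ?p)"
      by (intro tendsto_sum L2_pair_tendsto[OF H1_wd(1)[OF H] g(1) p g(2)])
    moreover have "(\<Sum>k\<in>UNIV. L2_pair \<Omega> (wd \<Omega> k k (u n)) ?p) = 0" for n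
    proof -
      have "AE x in lebesgue_on \<Omega>. (\<Sum>k\<in>UNIV. wd \<Omega> k k (u n) x) * ?p x = 0"
      proof -
        have "AE x in lebesgue_on \<Omega>. (\<Sum>k\<in>UNIV. wd \<Omega> k k (u n) x) = 0"
          using u[of n] by (simp add: V_N_def div_free_def)
        then show ?thesis by eventually_elim simp
      qed
      then show ?thesis unfolding s[OF H1_wd(1)[OF H], symmetric] by (rule integral_eq_zero_AE)
    qed
    ultimately show "integral\<^sup>L (lebesgue_on \<Omega>) (\<lambda>x. (\<Sum>k\<in>UNIV. g k k x) * ?p x) = 0"
      by (simp add: s[OF g(1)] LIMSEQ_const_iff)
  qed
  moreover have "AE x in lebesgue_on \<Omega>. \<forall>k. wd \<Omega> k k v x = g k k x" using wdv by (simp add: AE_all_countable)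
  ultimately have "AE x in lebesgue_on \<Omega>. (\<Sum>k\<in>UNIV. wd \<Omega> k k v x) = 0" by eventually_elim simp
  then have "v \<in> V_N \<Omega>" using Hv by (simp add: V_N_def div_free_def)
  moreover have "(\<lambda>n. Re (L2_inner \<Omega> (u n - v) (u n - v))) \<longlonglongrightarrow> 0"
  proof -
    have "(\<lambda>n. \<Sum>l\<in>UNIV. L2_sq \<Omega> (\<lambda>x. u n x $ l - v x $ l)) \<longlonglongrightarrow> (\<Sum>l\<in>(UNIV::'a set). 0)"
      by (intro tendsto_sum) (use f(2) in \<open>simp add: v_def\<close>)
    then show ?thesis by (simp add: Re_L2_inner_diff[OF O H Hv])
  qed
  moreover have "(\<lambda>n. Re (stokes_form \<Omega> (u n - v) (u n - v))) \<longlonglongrightarrow> 0"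
  proof -
    have e: "L2_sq \<Omega> (\<lambda>x. wd \<Omega> k l (u n) x - wd \<Omega> k l v x) = L2_sq \<Omega> (\<lambda>x. wd \<Omega> k l (u n) x - g k l x)" for k l n
    proof (rule integral_norm_sq_cong_AE)
      show "AE x in lebesgue_on \<Omega>. wd \<Omega> k l (u n) x - wd \<Omega> k l v x = wd \<Omega> k l (u n) x - g k l x"
        using wdv[of k l] by eventually_elim simp
    qed (intro L2_diff H1_wd(1) H Hv g)+
    have "(\<lambda>n. \<Sum>k\<in>UNIV. \<Sum>l\<in>UNIV. L2_sq \<Omega> (\<lambda>x. wd \<Omega> k l (u n) x - wd \<Omega> k l v x)) \<longlonglongrightarrow> (\<Sum>k\<in>(UNIV::'a set). \<Sum>l\<in>(UNIV::'a set). 0)"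
      unfolding e by (intro tendsto_sum g)
    then show ?thesis by (simp add: Re_stokes_form_diff[OF O H Hv])
  qed
  ultimately show ?thesis by blast
qed

text \<open>Leads from \<open>lebesgue_on\<close> to the compactness estimate, which is formulated
  for functions integrable over the whole space and for masses in \<open>ennreal\<close>. Applied to
  a function and to its weak derivatives it produces a \<open>weak_grad\<close> pair.\<close>

lemma L2_borel_representative:
  fixes f :: "real^'d::finite \<Rightarrow> complex"
  assumes O: "bounded \<Omega>" "open \<Omega>" and f: "L2 \<Omega> f"
  shows "\<exists>f'. integrable lborel f' \<and>
    (\<forall>\<psi>\<in>borel_measurable borel. (\<integral>x. f' x * \<psi> x \<partial>lborel) = integral\<^sup>L (lebesgue_on \<Omega>) (\<lambda>x. f x * \<psi> x)) \<and>
    (\<integral>\<^sup>+x. indicator \<Omega> x * ennreal ((cmod (f' x))\<^sup>2) \<partial>lborel) = ennreal (L2_sq \<Omega> f)"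
proof -
  have Ob: "\<Omega> \<in> sets borel" using O by simp
  obtain f' where f': "f' \<in> borel_measurable borel" "\<And>x. x \<notin> \<Omega> \<Longrightarrow> f' x = 0"
    "AE x in lebesgue_on \<Omega>. f x = f' x" using borel_representative[OF Ob L2_measurable[OF f]] by blast
  have bm: "h \<in> borel_measurable (lebesgue_on \<Omega>)" if "h \<in> borel_measurable borel" for h :: "real^'d \<Rightarrow> complex"
    using that by (intro measurable_restrict_space1 measurable_completion) simp
  note fm = L2_measurable[OF f]
  have 1: "integrable lborel f'"
  proof -
    have "integrable (lebesgue_on \<Omega>) f'"
      using L2_integrable[OF O f] f'(3) bm[OF f'(1)] fm by (subst integrable_cong_AE[of f' _ f]) auto
    then show ?thesis using integral_lebesgue_on_eq_lborel(1)[OF Ob f'(1,2)] by simp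
  qed
  have 2: "(\<integral>x. f' x * \<psi> x \<partial>lborel) = integral\<^sup>L (lebesgue_on \<Omega>) (\<lambda>x. f x * \<psi> x)" if p: "\<psi> \<in> borel_measurable borel" for \<psi>
  proof -
    have "(\<integral>x. f' x * \<psi> x \<partial>lborel) = integral\<^sup>L (lebesgue_on \<Omega>) (\<lambda>x. f' x * \<psi> x)"
      using f' Ob p by (subst integral_lebesgue_on_eq_lborel(2)) auto
    also have "\<dots> = integral\<^sup>L (lebesgue_on \<Omega>) (\<lambda>x. f x * \<psi> x)"
    proof (rule integral_cong_AE)
      show "(\<lambda>x. f' x * \<psi> x) \<in> borel_measurable (lebesgue_on \<Omega>)" "(\<lambda>x. f x * \<psi> x) \<in> borel_measurable (lebesgue_on \<Omega>)"
        by (intro borel_measurable_times bm f'(1) p fm)+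
    qed (use f'(3) in \<open>eventually_elim, simp\<close>)
    finally show ?thesis .
  qed
  have L': "L2 \<Omega> f'"
  proof -
    have "integrable (lebesgue_on \<Omega>) (\<lambda>x. (cmod (f' x))\<^sup>2)"
    proof (rule integrable_cong_AE_imp)
      show "integrable (lebesgue_on \<Omega>) (\<lambda>x. (cmod (f x))\<^sup>2)" using f by (simp add: L2_def)
      show "(\<lambda>x. (cmod (f' x))\<^sup>2) \<in> borel_measurable (lebesgue_on \<Omega>)" using bm[OF f'(1)] by measurable
      show "AE x in lebesgue_on \<Omega>. (cmod (f x))\<^sup>2 = (cmod (f' x))\<^sup>2" using f'(3) by eventually_elim simp
    qed
    then show ?thesis using bm[OF f'(1)] by (simp add: L2_def)
  qed
  have 3: "(\<integral>\<^sup>+x. indicator \<Omega> x * ennreal ((cmod (f' x))\<^sup>2) \<partial>lborel) = ennreal (L2_sq \<Omega> f)"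
  proof -
    have e: "(\<lambda>x. indicator \<Omega> x * ennreal ((cmod (f' x))\<^sup>2)) = (\<lambda>x. ennreal ((cmod (f' x))\<^sup>2))"
      using f'(2) by (auto simp: indicator_def)
    have m: "(\<lambda>x. (cmod (f' x))\<^sup>2) \<in> borel_measurable borel" using f'(1) by measurable
    have "integrable lborel (\<lambda>x. (cmod (f' x))\<^sup>2)"
      using L' integral_lebesgue_on_eq_lborel(1)[OF Ob m] f'(2) by (simp add: L2_def)
    then have "(\<integral>\<^sup>+x. ennreal ((cmod (f' x))\<^sup>2) \<partial>lborel) = ennreal (\<integral>x. (cmod (f' x))\<^sup>2 \<partial>lborel)"
      by (intro nn_integral_eq_integral) auto
    also have "(\<integral>x. (cmod (f' x))\<^sup>2 \<partial>lborel) = L2_sq \<Omega> f'"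
      using integral_lebesgue_on_eq_lborel(2)[OF Ob m] f'(2) by simp
    also have "\<dots> = L2_sq \<Omega> f"
      by (rule integral_norm_sq_cong_AE[OF L' f]) (use f'(3) in \<open>eventually_elim, simp\<close>)
    finally show ?thesis unfolding e .
  qed
  show ?thesis using 1 2 3 by blast
qed

text \<open>The integrals over the sets \<open>Q\<close> become pairings with indicators, that is,
  bounded linear functionals on L2. All terms are finite here, so the inequality returns from
  \<open>ennreal\<close> to the reals.\<close>

lemma rellich_scalar:
  fixes \<Omega> :: "(real^'d::finite) set"
  assumes O: "bounded \<Omega>" "open \<Omega>" "lipschitz_boundary \<Omega>" and e: "e > 0"
  shows "\<exists>Qs C. finite Qs \<and> (\<forall>Q\<in>Qs. open Q) \<and> C \<ge> 0 \<and>
    (\<forall>f g. L2 \<Omega> f \<longrightarrow> (\<forall>k. L2 \<Omega> (g k) \<and> is_weak_deriv \<Omega> k f (g k)) \<longrightarrow>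
      L2_sq \<Omega> f
       \<le> e * (\<Sum>k\<in>UNIV. L2_sq \<Omega> (g k))
         + C * (\<Sum>Q\<in>Qs. (cmod (L2_pair \<Omega> f (\<lambda>x. complex_of_real (indicat_real Q x))))\<^sup>2))"
proof (rule rellich_inequality[OF O e])
  fix Qs C
  assume Q: "finite Qs" "\<And>Q. Q \<in> Qs \<Longrightarrow> open Q" "C \<ge> 0"
    and R: "\<And>u g. weak_grad \<Omega> u g \<Longrightarrow> sq_mass \<Omega> u \<le> ennreal e * grad_mass \<Omega> g
       + ennreal C * (\<Sum>Q\<in>Qs. mean_sq Q u)"
  have "L2_sq \<Omega> f
       \<le> e * (\<Sum>k\<in>UNIV. L2_sq \<Omega> (g k))
         + C * (\<Sum>Q\<in>Qs. (cmod (L2_pair \<Omega> f (\<lambda>x. complex_of_real (indicat_real Q x))))\<^sup>2)"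
    if f: "L2 \<Omega> f" and g: "\<And>k. L2 \<Omega> (g k)" and w: "\<And>k. is_weak_deriv \<Omega> k f (g k)" for f g
  proof -
    obtain f' where f': "integrable lborel f'"
      "\<And>\<psi>. \<psi> \<in> borel_measurable borel \<Longrightarrow> (\<integral>x. f' x * \<psi> x \<partial>lborel) = integral\<^sup>L (lebesgue_on \<Omega>) (\<lambda>x. f x * \<psi> x)"
      "(\<integral>\<^sup>+x. indicator \<Omega> x * ennreal ((cmod (f' x))\<^sup>2) \<partial>lborel) = ennreal (L2_sq \<Omega> f)"
      using L2_borel_representative[OF O(1,2) f] by blast
    have "\<forall>k. \<exists>g'. integrable lborel g' \<and>
      (\<forall>\<psi>\<in>borel_measurable borel. (\<integral>x. g' x * \<psi> x \<partial>lborel) = integral\<^sup>L (lebesgue_on \<Omega>) (\<lambda>x. g k x * \<psi> x)) \<and>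
      (\<integral>\<^sup>+x. indicator \<Omega> x * ennreal ((cmod (g' x))\<^sup>2) \<partial>lborel) = ennreal (L2_sq \<Omega> (g k))"
      using L2_borel_representative[OF O(1,2) g] by blast
    from choice[OF this] obtain g' where g': "\<And>k. integrable lborel (g' k)"
      "\<And>k \<psi>. \<psi> \<in> borel_measurable borel \<Longrightarrow> (\<integral>x. g' k x * \<psi> x \<partial>lborel) = integral\<^sup>L (lebesgue_on \<Omega>) (\<lambda>x. g k x * \<psi> x)"
      "\<And>k. (\<integral>\<^sup>+x. indicator \<Omega> x * ennreal ((cmod (g' k x))\<^sup>2) \<partial>lborel) = ennreal (L2_sq \<Omega> (g k))"
      by blast
    have wg: "weak_grad \<Omega> f' g'"
      unfolding weak_grad_def
    proof (intro conjI allI impI f' g')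
      fix k \<phi> assume \<phi>: "test_fun \<Omega> \<phi>"
      have "(\<lambda>x. complex_of_real (\<phi> x)) \<in> borel_measurable borel" "(\<lambda>x. complex_of_real (pderiv_cl k \<phi> x)) \<in> borel_measurable borel"
        by (intro borel_measurable_continuous_onI continuous_intros test_fun_continuous_on[OF \<phi>] continuous_on_pderiv_cl test_fun_smooth[OF \<phi>])+
      then show "(\<integral>x. f' x * complex_of_real (pderiv_cl k \<phi> x) \<partial>lborel) = - (\<integral>x. g' k x * complex_of_real (\<phi> x) \<partial>lborel)"
        using w[of k] \<phi> by (simp add: f'(2) g'(2) is_weak_deriv_def)
    qed
    have [measurable]: "g' k \<in> borel_measurable borel" for k by (rule weak_grad_measurable(2)[OF wg])
    have [measurable]: "\<Omega> \<in> sets borel" using O by simp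
    have G: "grad_mass \<Omega> g' = ennreal (\<Sum>k\<in>UNIV. L2_sq \<Omega> (g k))"
    proof -
      have "grad_mass \<Omega> g' = (\<integral>\<^sup>+x. (\<Sum>k\<in>UNIV. indicator \<Omega> x * ennreal ((cmod (g' k x))\<^sup>2)) \<partial>lborel)"
        unfolding grad_mass_def grad_sq_def
        by (intro nn_integral_cong) (simp add: sum_distrib_left[symmetric] sum_ennreal)
      also have "\<dots> = (\<Sum>k\<in>UNIV. \<integral>\<^sup>+x. indicator \<Omega> x * ennreal ((cmod (g' k x))\<^sup>2) \<partial>lborel)"
        by (rule nn_integral_sum) measurable
      finally show ?thesis by (simp add: g'(3) sum_ennreal)
    qed
    have QI: "(\<integral>x. indicat_real Q x *\<^sub>R f' x \<partial>lborel) = L2_pair \<Omega> f (\<lambda>x. complex_of_real (indicat_real Q x))" if "Q \<in> Qs" for Q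
    proof -
      have [measurable]: "Q \<in> sets borel" using Q(2)[OF that] by simp
      have "(\<lambda>x. complex_of_real (indicat_real Q x)) \<in> borel_measurable borel" by measurable
      from f'(2)[OF this] show ?thesis by (simp add: L2_pair_def scaleR_conv_of_real mult.commute)
    qed
    define I where "I h = L2_sq \<Omega> h" for h :: "real^'d \<Rightarrow> complex"
    have I0: "I h \<ge> 0" for h by (simp add: I_def)
    have "ennreal (I f) \<le> ennreal e * ennreal (\<Sum>k\<in>UNIV. I (g k))
       + ennreal C * (\<Sum>Q\<in>Qs. ennreal ((cmod (L2_pair \<Omega> f (\<lambda>x. complex_of_real (indicat_real Q x))))\<^sup>2))"
      using R[OF wg] QI unfolding G sq_mass_def f'(3) I_def by simp
    also have "\<dots> = ennreal (e * (\<Sum>k\<in>UNIV. I (g k)) + C * (\<Sum>Q\<in>Qs. (cmod (L2_pair \<Omega> f (\<lambda>x. complex_of_real (indicat_real Q x))))\<^sup>2))"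
      using e Q(3) I0 by (simp add: ennreal_mult ennreal_plus sum_nonneg sum_ennreal)
    finally show ?thesis using e Q(3) I0 by (subst (asm) ennreal_le_iff) (auto simp: I_def intro!: add_nonneg_nonneg mult_nonneg_nonneg sum_nonneg)
  qed
  then show ?thesis using Q by (intro exI[of _ Qs] exI[of _ C]) auto
qed

text \<open>The functionals for \<open>form_compact\<close> are the pairings of each component with
  the indicator of each of the finitely many sets \<open>Q\<close>; summing the scalar estimate over
  the components gives the one for vector fields.\<close>

lemma compact_form_V_N:
  fixes \<Omega> :: "(real^'d::finite) set"
  assumes O: "bounded \<Omega>" "open \<Omega>" "lipschitz_boundary \<Omega>"
  shows "compact_form vscale (V_N \<Omega>) (L2_inner \<Omega>) (stokes_form \<Omega>)"
proof (intro compact_form.intro compact_form_axioms.intro semi_inner_product_L2_inner semi_inner_product_stokes_form O(1,2))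
  fix u assume u: "u \<in> V_N \<Omega>" "Re (L2_inner \<Omega> u u) = 0"
  then have H: "H1 \<Omega> u" by (simp add: V_N_def)
  have "AE x in lebesgue_on \<Omega>. u x = 0" using u Re_L2_inner_eq_0_iff[OF H] by simp
  then have "AE x in lebesgue_on \<Omega>. u x $ l = 0" for l by eventually_elim simp
  then have "AE x in lebesgue_on \<Omega>. (cmod (wd \<Omega> k l u x))\<^sup>2 = 0" for k l
    using H1_zero(2)[OF O(1,2) _ H1_component[OF H], of k l] by auto
  then have "L2_sq \<Omega> (wd \<Omega> k l u) = 0" for k l by (rule integral_eq_zero_AE)
  then show "Re (stokes_form \<Omega> u u) = 0" by (simp add: Re_stokes_form_self)
next
  fix u :: "nat \<Rightarrow> real^'d \<Rightarrow> complex^'d"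
  assume "\<And>n. u n \<in> V_N \<Omega>" "\<And>e. 0 < e \<Longrightarrow> \<exists>N. \<forall>m\<ge>N. \<forall>n\<ge>N. Re (L2_inner \<Omega> (u m - u n) (u m - u n)) + Re (stokes_form \<Omega> (u m - u n) (u m - u n)) < e"
  then show "\<exists>l\<in>V_N \<Omega>. (\<lambda>n. Re (L2_inner \<Omega> (u n - l) (u n - l))) \<longlonglongrightarrow> 0 \<and> (\<lambda>n. Re (stokes_form \<Omega> (u n - l) (u n - l))) \<longlonglongrightarrow> 0"
    by (rule V_N_complete[OF O(1,2)])
next
  fix e :: real assume e: "0 < e"
  obtain Qs C where Q: "finite Qs" "\<forall>Q\<in>Qs. open Q" "C \<ge> 0"
    and R: "\<And>f g. L2 \<Omega> f \<Longrightarrow> (\<forall>k. L2 \<Omega> (g k) \<and> is_weak_deriv \<Omega> k f (g k)) \<Longrightarrow>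
      L2_sq \<Omega> f
       \<le> e * (\<Sum>k\<in>UNIV. L2_sq \<Omega> (g k))
         + C * (\<Sum>Q\<in>Qs. (cmod (L2_pair \<Omega> f (\<lambda>x. complex_of_real (indicat_real Q x))))\<^sup>2)"
    using rellich_scalar[OF O e] by auto
  define J where "J = (UNIV :: 'd set) \<times> Qs"
  have J: "finite J" using Q(1) by (simp add: J_def)
  obtain h where h: "bij_betw h {..<card J} J"
    using ex_bij_betw_nat_finite[OF J] by (auto simp: atLeast0LessThan)
  define p where "p i u = L2_pair \<Omega> (\<lambda>x. u x $ fst i) (\<lambda>x. complex_of_real (indicat_real (snd i) x))" for i and u :: "real^'d \<Rightarrow> complex^'d"
  have L: "L2 \<Omega> (\<lambda>x. complex_of_real (indicat_real Q x))" if "Q \<in> Qs" for Q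
  proof (rule L2_bounded[OF O(1,2), of _ 1])
    have [measurable]: "Q \<in> sets borel" using Q(2) that by simp
    show "(\<lambda>x. complex_of_real (indicat_real Q x)) \<in> borel_measurable (lebesgue_on \<Omega>)"
      by (intro measurable_restrict_space1 measurable_completion) simp
  qed (auto simp: indicator_def)
  \<comment> \<open>Bound for the squared norms of the indicators, hence by Cauchy-Schwarz for the
    functionals; inserting 0 covers an empty \<open>Qs\<close>. The locale wants a single constant,
    so \<open>C + D\<close> is used for this bound and for the estimate.\<close>
  define D where "D = Max (insert 0 ((\<lambda>Q. Re (L2_pair \<Omega> (\<lambda>x. complex_of_real (indicat_real Q x)) (\<lambda>x. complex_of_real (indicat_real Q x)))) ` Qs))"
  have D0: "D \<ge> 0" unfolding D_def using Q(1) by (intro Max_ge) auto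
  have D: "Re (L2_pair \<Omega> (\<lambda>x. complex_of_real (indicat_real Q x)) (\<lambda>x. complex_of_real (indicat_real Q x))) \<le> D" if "Q \<in> Qs" for Q
    unfolding D_def using Q(1) that by (intro Max_ge) auto
  show "\<exists>(m::nat) \<phi> C. C \<ge> 0 \<and>
      (\<forall>j<m. \<forall>u\<in>V_N \<Omega>. \<forall>v\<in>V_N \<Omega>. \<phi> j (u - v) = (\<phi> j u - \<phi> j v :: complex)) \<and>
      (\<forall>j<m. \<forall>u\<in>V_N \<Omega>. (cmod (\<phi> j u))\<^sup>2 \<le> C * Re (L2_inner \<Omega> u u)) \<and>
      (\<forall>u\<in>V_N \<Omega>. Re (L2_inner \<Omega> u u) \<le> e * Re (stokes_form \<Omega> u u) + C * (\<Sum>j<m. (cmod (\<phi> j u))\<^sup>2))"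
  proof (intro exI[of _ "card J"] exI[of _ "\<lambda>j. p (h j)"] exI[of _ "C + D"] conjI allI impI ballI)
    show "0 \<le> C + D" using Q D0 by simp
    fix j assume "j < card J"
    then have hj: "snd (h j) \<in> Qs" using bij_betwE[OF h] by (auto simp: J_def mem_Times_iff)
    { fix u v assume uv: "u \<in> V_N \<Omega>" "v \<in> V_N \<Omega>"
      then have H: "H1 \<Omega> u" "H1 \<Omega> v" by (auto simp: V_N_def)
      have "p (h j) u = p (h j) (u - v) + p (h j) v"
        unfolding p_def using L2_pair_add[OF L2_diff[OF H1_component[OF H(1)] H1_component[OF H(2)]] H1_component[OF H(2)] L[OF hj], of "fst (h j)" "fst (h j)" "fst (h j)"] by simp
      then show "p (h j) (u - v) = p (h j) u - p (h j) v" by simp }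
    fix u assume u: "u \<in> V_N \<Omega>"
    then have H: "H1 \<Omega> u" by (simp add: V_N_def)
    have "Re (L2_pair \<Omega> (\<lambda>x. u x $ fst (h j)) (\<lambda>x. u x $ fst (h j))) \<le> Re (L2_inner \<Omega> u u)"
      unfolding Re_L2_inner_self[OF H] L2_pair_self
      by (rule member_le_sum[of _ UNIV "\<lambda>l. L2_sq \<Omega> (\<lambda>x. u x $ l)"]) auto
    moreover have "0 \<le> Re (L2_pair \<Omega> (\<lambda>x. u x $ fst (h j)) (\<lambda>x. u x $ fst (h j)))" by (simp add: L2_pair_self)
    ultimately have "Re (L2_pair \<Omega> (\<lambda>x. u x $ fst (h j)) (\<lambda>x. u x $ fst (h j))) *
      Re (L2_pair \<Omega> (\<lambda>x. complex_of_real (indicat_real (snd (h j)) x)) (\<lambda>x. complex_of_real (indicat_real (snd (h j)) x)))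
      \<le> Re (L2_inner \<Omega> u u) * (C + D)"
      using D[OF hj] Q(3) by (intro mult_mono) (auto simp: L2_pair_self Re_L2_inner_self[OF H] intro!: sum_nonneg)
    then show "(cmod (p (h j) u))\<^sup>2 \<le> (C + D) * Re (L2_inner \<Omega> u u)"
      using L2_pair_Cauchy_Schwarz[OF H1_component[OF H, of "fst (h j)"] L[OF hj]] unfolding p_def by (simp add: mult.commute)
  next
    fix u assume u: "u \<in> V_N \<Omega>"
    then have H: "H1 \<Omega> u" by (simp add: V_N_def)
    have "Re (L2_inner \<Omega> u u) \<le> (\<Sum>l\<in>UNIV. e * (\<Sum>k\<in>UNIV. L2_sq \<Omega> (wd \<Omega> k l u))
         + C * (\<Sum>Q\<in>Qs. (cmod (p (l, Q) u))\<^sup>2))"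
      unfolding Re_L2_inner_self[OF H] p_def fst_conv snd_conv
      by (intro sum_mono R H1_component[OF H]) (simp add: H1_wd[OF H])
    also have "\<dots> = e * (\<Sum>l\<in>UNIV. \<Sum>k\<in>UNIV. L2_sq \<Omega> (wd \<Omega> k l u))
         + C * (\<Sum>l\<in>UNIV. \<Sum>Q\<in>Qs. (cmod (p (l, Q) u))\<^sup>2)"
      by (simp add: sum.distrib sum_distrib_left)
    also have "(\<Sum>l\<in>UNIV. \<Sum>k\<in>UNIV. L2_sq \<Omega> (wd \<Omega> k l u)) = Re (stokes_form \<Omega> u u)"
      unfolding Re_stokes_form_self by (rule sum.swap)
    also have "(\<Sum>l\<in>UNIV. \<Sum>Q\<in>Qs. (cmod (p (l, Q) u))\<^sup>2) = (\<Sum>i\<in>J. (cmod (p i u))\<^sup>2)"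
      by (simp add: J_def sum.cartesian_product case_prod_beta)
    also have "\<dots> = (\<Sum>j<card J. (cmod (p (h j) u))\<^sup>2)"
      by (rule sum.reindex_bij_betw[OF h, symmetric])
    also have "C * \<dots> \<le> (C + D) * \<dots>" using D0 by (intro mult_right_mono) (auto intro: sum_nonneg)
    finally show "Re (L2_inner \<Omega> u u) \<le> e * Re (stokes_form \<Omega> u u) + (C + D) * (\<Sum>j<card J. (cmod (p (h j) u))\<^sup>2)" by simp
  qed
qed

section \<open>Plane waves\<close>

definition wave :: "real^'d::finite \<Rightarrow> real^'d \<Rightarrow> complex" where
  "wave w x = cis (w \<bullet> x)"

lemma norm_wave [simp]: "cmod (wave w x) = 1" by (simp add: wave_def)

lemma continuous_on_wave: "continuous_on S (wave w)"
  unfolding wave_def cis_conv_exp by (intro continuous_intros)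

lemma wave_has_vector_derivative:
  "((\<lambda>t. wave w (x + t *\<^sub>R axis k 1)) has_vector_derivative (\<i> * of_real (w $ k) * wave w x)) (at 0)"
proof -
  have e: "wave w (x + t *\<^sub>R axis k 1) = exp (\<i> * of_real (w \<bullet> x) + \<i> * of_real (w $ k) * of_real t)" for t
    by (simp add: wave_def cis_conv_exp inner_add_right inner_axis algebra_simps)
  have "((\<lambda>z. exp (\<i> * of_real (w \<bullet> x) + \<i> * of_real (w $ k) * z)) has_field_derivative
     \<i> * of_real (w $ k) * exp (\<i> * of_real (w \<bullet> x) + \<i> * of_real (w $ k) * of_real 0)) (at (of_real 0))"
    by (auto intro!: derivative_eq_intros)
  from has_vector_derivative_real_field[OF this]
  show ?thesis unfolding e by (simp add: wave_def cis_conv_exp o_def)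
qed

lemma cnj_wave: "cnj (wave w x) = wave (- w) x"
  by (simp add: wave_def cis_cnj)

lemma L2_wave:
  assumes "bounded \<Omega>" "open \<Omega>"
  shows "L2 \<Omega> (wave w)"
  using assms by (intro L2_bounded[of _ _ 1] continuous_imp_measurable_on_sets_lebesgue continuous_on_wave) auto

lemma is_weak_deriv_wave:
  assumes "open \<Omega>"
  shows "is_weak_deriv \<Omega> k (\<lambda>x. c * wave w x) (\<lambda>x. c * (\<i> * of_real (w $ k) * wave w x))"
  using assms
  by (intro is_weak_deriv_classical has_vector_derivative_mult_right[OF wave_has_vector_derivative] continuous_intros continuous_on_wave)

definition plane_wave :: "real^'d::finite \<Rightarrow> real^'d \<Rightarrow> real^'d \<Rightarrow> complex^'d" where
  "plane_wave w h x = (\<chi> l. of_real (h $ l) * wave w x)"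

lemma plane_wave_nth [simp]: "plane_wave w h x $ l = of_real (h $ l) * wave w x"
  by (simp add: plane_wave_def)

lemma plane_wave_H1:
  assumes O: "bounded \<Omega>" "open \<Omega>"
  shows "H1 \<Omega> (plane_wave w h)"
    "AE x in lebesgue_on \<Omega>. wd \<Omega> k l (plane_wave w h) x = of_real (h $ l) * (\<i> * of_real (w $ k) * wave w x)"
proof -
  have 1: "L2 \<Omega> (\<lambda>x. plane_wave w h x $ l)" for l by (simp add: L2_scale L2_wave[OF O])
  have 2: "L2 \<Omega> (\<lambda>x. of_real (h $ l) * (\<i> * of_real (w $ k) * wave w x))" for k l
    by (intro L2_scale L2_wave O)
  have 3: "is_weak_deriv \<Omega> k (\<lambda>x. plane_wave w h x $ l) (\<lambda>x. of_real (h $ l) * (\<i> * of_real (w $ k) * wave w x))" for k l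
    using is_weak_deriv_wave[OF O(2)] by simp
  show "H1 \<Omega> (plane_wave w h)"
    "AE x in lebesgue_on \<Omega>. wd \<Omega> k l (plane_wave w h) x = of_real (h $ l) * (\<i> * of_real (w $ k) * wave w x)"
    by (rule H1_I(1)[OF O 1 2 3], rule H1_I(2)[OF O 1 2 3])
qed

lemma plane_wave_V_N:
  assumes O: "bounded \<Omega>" "open \<Omega>" and "w \<bullet> h = 0"
  shows "plane_wave w h \<in> V_N \<Omega>"
proof -
  have "AE x in lebesgue_on \<Omega>. \<forall>k. wd \<Omega> k k (plane_wave w h) x = of_real (h $ k) * (\<i> * of_real (w $ k) * wave w x)"
    using plane_wave_H1(2)[OF O] by (simp add: AE_all_countable)
  then have "AE x in lebesgue_on \<Omega>. (\<Sum>k\<in>UNIV. wd \<Omega> k k (plane_wave w h) x) = 0"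
  proof eventually_elim
    case (elim x)
    have "(\<Sum>k\<in>UNIV. wd \<Omega> k k (plane_wave w h) x) = \<i> * of_real (w \<bullet> h) * wave w x"
      using elim by (simp add: inner_vec_def sum_distrib_left sum_distrib_right mult_ac)
    then show ?case using assms by simp
  qed
  then show ?thesis using plane_wave_H1(1)[OF O] by (simp add: V_N_def div_free_def)
qed

lemma L2_pair_scale_right: "L2_pair \<Omega> f (\<lambda>x. c * g x) = cnj c * L2_pair \<Omega> f g"
  using L2_pair_cnj[of \<Omega> f "\<lambda>x. c * g x"] L2_pair_cnj[of \<Omega> f g] by (simp add: L2_pair_scale)

lemma stokes_form_plane_wave:
  assumes O: "bounded \<Omega>" "open \<Omega>" and u: "H1 \<Omega> u"
  shows "stokes_form \<Omega> u (plane_wave w h)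
    = (\<Sum>k\<in>UNIV. \<Sum>l\<in>UNIV. - \<i> * of_real (w $ k) * of_real (h $ l) * L2_pair \<Omega> (wd \<Omega> k l u) (wave w))"
  unfolding stokes_form_def
proof (intro sum.cong refl)
  fix k l
  have e: "(\<lambda>x. of_real (h $ l) * (\<i> * of_real (w $ k) * wave w x)) = (\<lambda>x. of_real (h $ l) * (\<i> * of_real (w $ k)) * wave w x)"
    by (simp add: mult.assoc)
  have "L2_pair \<Omega> (wd \<Omega> k l u) (wd \<Omega> k l (plane_wave w h))
     = L2_pair \<Omega> (wd \<Omega> k l u) (\<lambda>x. of_real (h $ l) * (\<i> * of_real (w $ k) * wave w x))"
    by (rule L2_pair_cong_AE) (auto intro!: H1_wd u plane_wave_H1 O L2_scale L2_wave)
  also have "\<dots> = - \<i> * of_real (w $ k) * of_real (h $ l) * L2_pair \<Omega> (wd \<Omega> k l u) (wave w)"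
    unfolding e L2_pair_scale_right by simp
  finally show "integral\<^sup>L (lebesgue_on \<Omega>) (\<lambda>x. wd \<Omega> k l u x * cnj (wd \<Omega> k l (plane_wave w h) x))
    = - \<i> * of_real (w $ k) * of_real (h $ l) * L2_pair \<Omega> (wd \<Omega> k l u) (wave w)"
    by (simp add: L2_pair_def)
qed

lemma L2_inner_plane_wave:
  assumes O: "bounded \<Omega>" "open \<Omega>" and u: "H1 \<Omega> u"
  shows "L2_inner \<Omega> u (plane_wave w h) = (\<Sum>l\<in>UNIV. of_real (h $ l) * L2_pair \<Omega> (\<lambda>x. u x $ l) (wave w))"
  using L2_inner_eq_sum[OF H1_component[OF u] H1_component[OF plane_wave_H1(1)[OF O]]]
  by (simp add: L2_pair_scale_right)

text \<open>A substitute for membership in \<open>H10\<close> that is visibly stable under linear combinations.\<close>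

definition trace_free :: "(real^'d::finite) set \<Rightarrow> (real^'d \<Rightarrow> complex^'d) \<Rightarrow> bool" where
  "trace_free \<Omega> u \<longleftrightarrow> H1 \<Omega> u \<and>
    (\<forall>k l w. L2_pair \<Omega> (wd \<Omega> k l u) (wave w) = \<i> * of_real (w $ k) * L2_pair \<Omega> (\<lambda>x. u x $ l) (wave w))"

text \<open>Differentiating the wave yields, after conjugation, the factor
  \<open>- \<i> * w $ k\<close>. Moving the derivative off \<open>u\<close>, which is what
  \<open>trace_free\<close> permits, yields \<open>\<i> * w $ k\<close>; the product summed over
  \<open>k\<close> is \<open>w \<bullet> w\<close>.\<close>

lemma stokes_form_trace_free_plane_wave:
  assumes O: "bounded \<Omega>" "open \<Omega>" and u: "trace_free \<Omega> u"
  shows "stokes_form \<Omega> u (plane_wave w h) = of_real (w \<bullet> w) * L2_inner \<Omega> u (plane_wave w h)"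
proof -
  have H: "H1 \<Omega> u" using u by (simp add: trace_free_def)
  have "stokes_form \<Omega> u (plane_wave w h) = (\<Sum>k\<in>UNIV. \<Sum>l\<in>UNIV. of_real (w $ k * w $ k) * (of_real (h $ l) * L2_pair \<Omega> (\<lambda>x. u x $ l) (wave w)))"
    unfolding stokes_form_plane_wave[OF O H]
  proof (intro sum.cong refl)
    fix k l
    show "- \<i> * of_real (w $ k) * of_real (h $ l) * L2_pair \<Omega> (wd \<Omega> k l u) (wave w) =
       of_real (w $ k * w $ k) * (of_real (h $ l) * L2_pair \<Omega> (\<lambda>x. u x $ l) (wave w))"
      using u by (simp add: trace_free_def mult_ac)
  qed
  also have "\<dots> = of_real (w \<bullet> w) * L2_inner \<Omega> u (plane_wave w h)"
    unfolding L2_inner_plane_wave[OF O H] by (simp add: inner_vec_def sum_product)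
  finally show ?thesis .
qed

lemma trace_free_lincomb:
  assumes O: "bounded \<Omega>" "open \<Omega>" and u: "trace_free \<Omega> u" and v: "trace_free \<Omega> v"
  shows "trace_free \<Omega> (vscale c u + v)"
proof -
  have H: "H1 \<Omega> u" "H1 \<Omega> v" using u v by (auto simp: trace_free_def)
  have "L2_pair \<Omega> (wd \<Omega> k l (vscale c u + v)) (wave w) = \<i> * of_real (w $ k) * L2_pair \<Omega> (\<lambda>x. (vscale c u + v) x $ l) (wave w)" for k l w
  proof -
    have "L2_pair \<Omega> (wd \<Omega> k l (vscale c u + v)) (wave w) = L2_pair \<Omega> (\<lambda>x. c * wd \<Omega> k l u x + wd \<Omega> k l v x) (wave w)"
      by (rule L2_pair_cong_AE) (auto intro!: H1_wd(1) H1_lincomb O H L2_add L2_scale L2_wave)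
    also have "\<dots> = c * L2_pair \<Omega> (wd \<Omega> k l u) (wave w) + L2_pair \<Omega> (wd \<Omega> k l v) (wave w)"
      by (simp add: L2_pair_add L2_pair_scale L2_scale H1_wd(1) H L2_wave[OF O])
    also have "\<dots> = \<i> * of_real (w $ k) * (c * L2_pair \<Omega> (\<lambda>x. u x $ l) (wave w) + L2_pair \<Omega> (\<lambda>x. v x $ l) (wave w))"
      using u v by (simp add: trace_free_def algebra_simps)
    also have "c * L2_pair \<Omega> (\<lambda>x. u x $ l) (wave w) + L2_pair \<Omega> (\<lambda>x. v x $ l) (wave w) = L2_pair \<Omega> (\<lambda>x. (vscale c u + v) x $ l) (wave w)"
      by (simp add: L2_pair_add L2_pair_scale L2_scale H1_component H L2_wave[OF O])
    finally show ?thesis .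
  qed
  then show ?thesis using H1_lincomb(1)[OF O H] by (simp add: trace_free_def)
qed

lemma trace_free_sum:
  assumes O: "bounded \<Omega>" "open \<Omega>" and "finite J" "\<And>j. j \<in> J \<Longrightarrow> trace_free \<Omega> (e j)"
  shows "trace_free \<Omega> (\<Sum>j\<in>J. vscale (c j) (e j))"
  using assms(3,4)
proof (induction J rule: finite_induct)
  case empty
  have z: "AE x in lebesgue_on \<Omega>. wd \<Omega> k l 0 x = 0" for k l using H1_zero(2)[OF O, of 0] by (simp add: L2_zero)
  have H: "H1 \<Omega> 0" using H1_zero(1)[OF O, of 0] by (simp add: L2_zero)
  have "L2_pair \<Omega> (wd \<Omega> k l 0) (wave w) = L2_pair \<Omega> (\<lambda>x. 0) (wave w)" for k l w
    by (rule L2_pair_cong_AE) (auto intro!: z H1_wd(1) H L2_wave O L2_zero)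
  then have "L2_pair \<Omega> (wd \<Omega> k l 0) (wave w) = \<i> * of_real (w $ k) * L2_pair \<Omega> (\<lambda>x. (0::real^'a \<Rightarrow> complex^'a) x $ l) (wave w)" for k l w
    by (simp add: L2_pair_def)
  with H show ?case unfolding sum.empty trace_free_def by blast
next
  case (insert j J)
  show ?case unfolding sum.insert[OF insert.hyps]
    by (rule trace_free_lincomb[OF O]) (use insert in blast)+
qed

text \<open>The roles in the definition of a weak derivative are exchanged: the conjugate wave is
  the differentiated function, while the real and imaginary parts of the components of
  \<open>p\<close> act as test functions.\<close>

lemma vec_test_fun_trace_free:
  assumes O: "bounded \<Omega>" "open \<Omega>" and p: "vec_test_fun \<Omega> p"
  shows "trace_free \<Omega> p"
proof -
  have R: "test_fun \<Omega> (\<lambda>x. Re (p x $ l))" and I: "test_fun \<Omega> (\<lambda>x. Im (p x $ l))" for l using p by (auto simp: vec_test_fun_def)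
  define g where "g k l x = of_real (pderiv_cl k (\<lambda>x. Re (p x $ l)) x) + \<i> * of_real (pderiv_cl k (\<lambda>x. Im (p x $ l)) x)" for k l x
  have pe: "(\<lambda>x. p x $ l) = (\<lambda>x. of_real (Re (p x $ l)) + \<i> * of_real (Im (p x $ l)))" for l by (simp add: fun_eq_iff complex_eq_iff)
  have 1: "L2 \<Omega> (\<lambda>x. p x $ l)" for l
    unfolding pe by (intro L2_add L2_scale L2_test_fun O R I)
  have 2: "L2 \<Omega> (g k l)" for k l unfolding g_def by (intro L2_add L2_scale L2_test_fun O R I)
  have 3: "is_weak_deriv \<Omega> k (\<lambda>x. p x $ l) (g k l)" for k l
  proof (rule is_weak_deriv_classical[OF O(2)])
    fix x
    have "((\<lambda>t. of_real (f (x + t *\<^sub>R axis k 1))) has_vector_derivative (of_real (pderiv_cl k f x) :: complex)) (at 0)"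
      if "test_fun \<Omega> f" for f
      using pderiv_cl_has_vector_derivative[OF test_fun_smooth[OF that]]
      by (rule bounded_linear.has_vector_derivative[OF bounded_linear_of_real])
    from has_vector_derivative_add[OF this[OF R[of l]] has_vector_derivative_mult_right[OF this[OF I[of l]], of "\<i>"]]
    show "((\<lambda>t. p (x + t *\<^sub>R axis k 1) $ l) has_vector_derivative g k l x) (at 0)"
      by (simp add: g_def complex_eq[symmetric])
    show "continuous_on UNIV (\<lambda>x. p x $ l)"
      unfolding pe by (intro continuous_intros test_fun_continuous_on[OF R] test_fun_continuous_on[OF I])
    show "continuous_on UNIV (g k l)"
      unfolding g_def by (intro continuous_intros continuous_on_pderiv_cl test_fun_smooth[OF R] test_fun_smooth[OF I])
  qed
  have H: "H1 \<Omega> p" and wdp: "\<And>k l. AE x in lebesgue_on \<Omega>. wd \<Omega> k l p x = g k l x"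
    by (rule H1_I(1)[OF O 1 2 3], rule H1_I(2)[OF O 1 2 3])
  have ibp: "L2_pair \<Omega> (\<lambda>x. of_real (pderiv_cl k f x)) (wave w) = \<i> * of_real (w $ k) * L2_pair \<Omega> (\<lambda>x. of_real (f x)) (wave w)"
    if f: "test_fun \<Omega> f" for f k w
  proof -
    have "integral\<^sup>L (lebesgue_on \<Omega>) (\<lambda>x. 1 * wave (- w) x * complex_of_real (pderiv_cl k f x)) =
      - integral\<^sup>L (lebesgue_on \<Omega>) (\<lambda>x. 1 * (\<i> * of_real ((- w) $ k) * wave (- w) x) * complex_of_real (f x))"
      using is_weak_deriv_wave[OF O(2), of k 1 "- w"] f unfolding is_weak_deriv_def by blast
    also have "\<dots> = \<i> * of_real (w $ k) * integral\<^sup>L (lebesgue_on \<Omega>) (\<lambda>x. wave (- w) x * complex_of_real (f x))"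
      by (simp add: mult.assoc)
    finally show ?thesis by (simp add: L2_pair_def cnj_wave mult.commute)
  qed
  have "L2_pair \<Omega> (wd \<Omega> k l p) (wave w) = \<i> * of_real (w $ k) * L2_pair \<Omega> (\<lambda>x. p x $ l) (wave w)" for k l w
  proof -
    have "L2_pair \<Omega> (wd \<Omega> k l p) (wave w) = L2_pair \<Omega> (g k l) (wave w)"
      by (rule L2_pair_cong_AE) (auto intro!: wdp H1_wd(1) H L2_wave O 2)
    also have "\<dots> = \<i> * of_real (w $ k) * L2_pair \<Omega> (\<lambda>x. p x $ l) (wave w)"
      unfolding pe g_def
      by (simp add: L2_pair_add L2_pair_scale L2_scale L2_test_fun[OF O R] L2_test_fun[OF O I] L2_wave[OF O]
          ibp[OF R] ibp[OF I] algebra_simps)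
    finally show ?thesis .
  qed
  then show ?thesis using H by (simp add: trace_free_def)
qed

text \<open>The identity in \<open>trace_free\<close> holds for the approximating test functions,
  and both of its sides are continuous in the \<open>H1\<close> norm.\<close>

lemma H10_trace_free:
  assumes O: "bounded \<Omega>" "open \<Omega>" and u: "H10 \<Omega> u"
  shows "trace_free \<Omega> u"
proof -
  obtain p where p: "\<And>n. vec_test_fun \<Omega> (p n)" and lim: "(\<lambda>n. h1_norm_sq \<Omega> (\<lambda>x. p n x - u x)) \<longlonglongrightarrow> 0"
    and H: "H1 \<Omega> u" using u by (auto simp: H10_def)
  have tp: "trace_free \<Omega> (p n)" for n by (rule vec_test_fun_trace_free[OF O p])
  then have Hp: "H1 \<Omega> (p n)" for n by (simp add: trace_free_def)
  have e: "(\<lambda>x. p n x - u x) = p n - u" for n by (simp add: fun_eq_iff)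
  have nn: "(norm v)\<^sup>2 = (\<Sum>l\<in>UNIV. (cmod (v $ l))\<^sup>2)" for v :: "complex^'a"
    by (simp add: norm_vec_def L2_set_def sum_nonneg)
  have h1: "h1_norm_sq \<Omega> (\<lambda>x. p n x - u x)
     = (\<Sum>l\<in>UNIV. L2_sq \<Omega> (\<lambda>x. p n x $ l - u x $ l)) + (\<Sum>k\<in>UNIV. \<Sum>l\<in>UNIV. L2_sq \<Omega> (\<lambda>x. wd \<Omega> k l (p n) x - wd \<Omega> k l u x))" for n
  proof -
    have "integral\<^sup>L (lebesgue_on \<Omega>) (\<lambda>x. (norm (p n x - u x))\<^sup>2) = (\<Sum>l\<in>UNIV. L2_sq \<Omega> (\<lambda>x. p n x $ l - u x $ l))"
      unfolding nn vector_minus_component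
      using L2_diff[OF H1_component[OF Hp] H1_component[OF H]]
      by (intro Bochner_Integration.integral_sum) (simp add: L2_def)
    then show ?thesis
      using Re_stokes_form_diff[OF O Hp[of n] H] unfolding h1_norm_sq_def Re_stokes_form_self[symmetric] e by simp
  qed
  have l1: "(\<lambda>n. L2_sq \<Omega> (\<lambda>x. p n x $ l - u x $ l)) \<longlonglongrightarrow> 0" for l
  proof (rule tendsto_sandwich[OF _ _ tendsto_const lim])
    show "\<forall>\<^sub>F n in sequentially. L2_sq \<Omega> (\<lambda>x. p n x $ l - u x $ l) \<le> h1_norm_sq \<Omega> (\<lambda>x. p n x - u x)"
    proof (intro always_eventually allI)
      fix n
      have "L2_sq \<Omega> (\<lambda>x. p n x $ l - u x $ l) \<le> (\<Sum>l\<in>UNIV. L2_sq \<Omega> (\<lambda>x. p n x $ l - u x $ l))"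
        by (rule member_le_sum[of l UNIV "\<lambda>l. L2_sq \<Omega> (\<lambda>x. p n x $ l - u x $ l)"]) auto
      then show "L2_sq \<Omega> (\<lambda>x. p n x $ l - u x $ l) \<le> h1_norm_sq \<Omega> (\<lambda>x. p n x - u x)"
        unfolding h1 by (simp add: add_increasing2 sum_nonneg)
    qed
  qed simp
  have l2: "(\<lambda>n. L2_sq \<Omega> (\<lambda>x. wd \<Omega> k l (p n) x - wd \<Omega> k l u x)) \<longlonglongrightarrow> 0" for k l
  proof (rule tendsto_sandwich[OF _ _ tendsto_const lim])
    show "\<forall>\<^sub>F n in sequentially. L2_sq \<Omega> (\<lambda>x. wd \<Omega> k l (p n) x - wd \<Omega> k l u x) \<le> h1_norm_sq \<Omega> (\<lambda>x. p n x - u x)"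
    proof (intro always_eventually allI)
      fix n
      have "L2_sq \<Omega> (\<lambda>x. wd \<Omega> k l (p n) x - wd \<Omega> k l u x) \<le> (\<Sum>l\<in>UNIV. L2_sq \<Omega> (\<lambda>x. wd \<Omega> k l (p n) x - wd \<Omega> k l u x))"
        by (rule member_le_sum[of l UNIV "\<lambda>l. L2_sq \<Omega> (\<lambda>x. wd \<Omega> k l (p n) x - wd \<Omega> k l u x)"]) auto
      also have "\<dots> \<le> (\<Sum>k\<in>UNIV. \<Sum>l\<in>UNIV. L2_sq \<Omega> (\<lambda>x. wd \<Omega> k l (p n) x - wd \<Omega> k l u x))"
        by (rule member_le_sum[of k UNIV "\<lambda>k. (\<Sum>l\<in>UNIV. L2_sq \<Omega> (\<lambda>x. wd \<Omega> k l (p n) x - wd \<Omega> k l u x))"]) (auto intro!: sum_nonneg)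
      finally show "L2_sq \<Omega> (\<lambda>x. wd \<Omega> k l (p n) x - wd \<Omega> k l u x) \<le> h1_norm_sq \<Omega> (\<lambda>x. p n x - u x)"
        unfolding h1 by (simp add: add_increasing sum_nonneg)
    qed
  qed simp
  have "L2_pair \<Omega> (wd \<Omega> k l u) (wave w) = \<i> * of_real (w $ k) * L2_pair \<Omega> (\<lambda>x. u x $ l) (wave w)" for k l w
  proof -
    have "(\<lambda>n. L2_pair \<Omega> (wd \<Omega> k l (p n)) (wave w)) \<longlonglongrightarrow> L2_pair \<Omega> (wd \<Omega> k l u) (wave w)"
      by (rule L2_pair_tendsto[OF H1_wd(1)[OF Hp] H1_wd(1)[OF H] L2_wave[OF O] l2])
    moreover have "(\<lambda>n. \<i> * of_real (w $ k) * L2_pair \<Omega> (\<lambda>x. p n x $ l) (wave w)) \<longlonglongrightarrow> \<i> * of_real (w $ k) * L2_pair \<Omega> (\<lambda>x. u x $ l) (wave w)"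
      by (intro tendsto_intros L2_pair_tendsto[OF H1_component[OF Hp] H1_component[OF H] L2_wave[OF O] l1])
    moreover have "L2_pair \<Omega> (wd \<Omega> k l (p n)) (wave w) = \<i> * of_real (w $ k) * L2_pair \<Omega> (\<lambda>x. p n x $ l) (wave w)" for n
      using tp by (simp add: trace_free_def)
    ultimately show ?thesis using LIMSEQ_unique by simp
  qed
  then show ?thesis using H by (simp add: trace_free_def)
qed

section \<open>Injectivity of the Fourier transform\<close>

inductive trig_poly :: "(real^'d::finite \<Rightarrow> complex) \<Rightarrow> bool" where
  trig_poly_wave: "trig_poly (\<lambda>x. c * wave w x)"
| trig_poly_add: "trig_poly f \<Longrightarrow> trig_poly g \<Longrightarrow> trig_poly (\<lambda>x. f x + g x)"

lemma trig_poly_wave_mult: "trig_poly g \<Longrightarrow> trig_poly (\<lambda>x. c * wave w x * g x)"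
proof (induction rule: trig_poly.induct)
  case (trig_poly_wave c' w')
  have "(\<lambda>x. c * wave w x * (c' * wave w' x)) = (\<lambda>x. (c * c') * wave (w + w') x)"
    by (simp add: fun_eq_iff wave_def cis_mult[symmetric] inner_add_left mult_ac)
  then show ?case using trig_poly.trig_poly_wave[of "c * c'" "w + w'"] by simp
next
  case (trig_poly_add f g)
  then show ?case using trig_poly.trig_poly_add by (simp add: distrib_left)
qed

lemma trig_poly_mult: "trig_poly f \<Longrightarrow> trig_poly g \<Longrightarrow> trig_poly (\<lambda>x. f x * g x)"
proof (induction rule: trig_poly.induct)
  case (trig_poly_wave c w)
  then show ?case by (rule trig_poly_wave_mult)
next
  case (trig_poly_add f1 f2)
  then show ?case using trig_poly.trig_poly_add[of "\<lambda>x. f1 x * g x" "\<lambda>x. f2 x * g x"] by (simp add: distrib_right)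
qed

lemma trig_poly_continuous_on: "trig_poly f \<Longrightarrow> continuous_on S f"
  by (induction rule: trig_poly.induct) (auto intro!: continuous_intros continuous_on_wave)

lemma trig_poly_separates:
  fixes x y :: "real^'d::finite"
  assumes "x \<noteq> y"
  shows "\<exists>f. trig_poly (\<lambda>z. complex_of_real (f z)) \<and> f x \<noteq> f y"
proof -
  \<comment> \<open>This scaling makes the phase difference \<open>w \<bullet> (x - y)\<close> equal
    to 1, so the shifted sine takes the values \<open>sin 1\<close> and 0 at the two points.\<close>
  define w where "w = (1 / ((x - y) \<bullet> (x - y))) *\<^sub>R (x - y)"
  define f where "f z = sin (w \<bullet> z - w \<bullet> y)" for z
  have "(\<lambda>z. complex_of_real (f z)) = (\<lambda>z. (cis (- (w \<bullet> y)) / (2 * \<i>)) * wave w z + (- cis (w \<bullet> y) / (2 * \<i>)) * wave (- w) z)"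
  proof
    fix z
    have "cis (- (w \<bullet> y)) * wave w z - cis (w \<bullet> y) * wave (- w) z = cis (w \<bullet> z - w \<bullet> y) - cis (- (w \<bullet> z - w \<bullet> y))"
      by (simp add: wave_def cis_mult)
    also have "\<dots> = 2 * \<i> * complex_of_real (f z)"
    proof -
      have "cis t - cis (- t) = 2 * \<i> * complex_of_real (sin t)" for t by (simp add: complex_eq_iff)
      then show ?thesis unfolding f_def .
    qed
    finally show "complex_of_real (f z) = (cis (- (w \<bullet> y)) / (2 * \<i>)) * wave w z + (- cis (w \<bullet> y) / (2 * \<i>)) * wave (- w) z"
      by (simp add: field_simps)
  qed
  then have "trig_poly (\<lambda>z. complex_of_real (f z))" by (simp only:) (intro trig_poly.intros)
  moreover have "w \<bullet> x - w \<bullet> y = 1"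
  proof -
    have "w \<bullet> x - w \<bullet> y = w \<bullet> (x - y)" by (simp only: inner_diff_right)
    also have "\<dots> = 1" using assms by (simp add: w_def)
    finally show ?thesis .
  qed
  then have "f x = sin 1" "f y = 0" by (simp_all add: f_def)
  moreover have "sin (1::real) > 0" by (rule sin_gt_zero_02) auto
  ultimately show ?thesis by (intro exI[of _ f]) auto
qed

lemma L2_pair_trig_poly:
  assumes O: "bounded \<Omega>" "open \<Omega>" and h: "L2 \<Omega> h" and z: "\<And>w. L2_pair \<Omega> h (wave w) = 0"
    and f: "trig_poly f"
  shows "integral\<^sup>L (lebesgue_on \<Omega>) (\<lambda>x. h x * f x) = 0 \<and> L2 \<Omega> f"
  using f
proof (induction rule: trig_poly.induct)
  case (trig_poly_wave c w)
  have "integral\<^sup>L (lebesgue_on \<Omega>) (\<lambda>x. h x * wave w x) = 0"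
    using z[of "- w"] by (simp add: L2_pair_def cnj_wave)
  then have "c * integral\<^sup>L (lebesgue_on \<Omega>) (\<lambda>x. h x * wave w x) = 0" by simp
  then have "integral\<^sup>L (lebesgue_on \<Omega>) (\<lambda>x. c * (h x * wave w x)) = 0" by simp
  moreover have "(\<lambda>x. h x * (c * wave w x)) = (\<lambda>x. c * (h x * wave w x))" by (simp add: fun_eq_iff mult_ac)
  ultimately show ?case using L2_scale[OF L2_wave[OF O]] by (simp only:)
next
  case (trig_poly_add f g)
  then show ?case using L2_integrable_mult[OF h] by (simp add: distrib_left L2_add)
qed

text \<open>The Fourier transform is injective: by Stone-Weierstrass trigonometric polynomials approximate test
  functions uniformly on the closure of the domain.\<close>

lemma AE_eq_0_if_orthogonal_waves:
  fixes h :: "real^'d::finite \<Rightarrow> complex"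
  assumes O: "bounded \<Omega>" "open \<Omega>" and h: "L2 \<Omega> h" and z: "\<And>w. L2_pair \<Omega> h (wave w) = 0"
  shows "AE x in lebesgue_on \<Omega>. h x = 0"
proof (rule AE_eq_0_if_orthogonal_test_funs[OF O h])
  fix \<phi> assume \<phi>: "test_fun \<Omega> \<phi>"
  define N where "N = integral\<^sup>L (lebesgue_on \<Omega>) (\<lambda>x. cmod (h x))"
  have N0: "N \<ge> 0" by (simp add: N_def)
  have ih: "integrable (lebesgue_on \<Omega>) (\<lambda>x. cmod (h x))" using L2_integrable[OF O h] by simp
  have small: "cmod (integral\<^sup>L (lebesgue_on \<Omega>) (\<lambda>x. h x * complex_of_real (\<phi> x))) \<le> e" if e: "e > 0" for e
  proof -
    \<comment> \<open>A uniform error \<open>d\<close> costs \<open>d * N\<close> in the integral;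
      the summand 1 allows \<open>N = 0\<close>.\<close>
    define d where "d = e / (N + 1)"
    have d: "d > 0" using e N0 by (simp add: d_def)
    have "\<exists>g. trig_poly (\<lambda>x. complex_of_real (g x)) \<and> (\<forall>x\<in>closure \<Omega>. \<bar>\<phi> x - g x\<bar> < d)"
    proof (rule Stone_Weierstrass_HOL[of "closure \<Omega>" "\<lambda>g. trig_poly (\<lambda>x. complex_of_real (g x))"])
      show "compact (closure \<Omega>)" using O by (simp add: compact_closure)
      show "trig_poly (\<lambda>x. complex_of_real c)" for c
        using trig_poly_wave[of "complex_of_real c" 0] by (simp add: wave_def)
      show "continuous_on (closure \<Omega>) g" if "trig_poly (\<lambda>x. complex_of_real (g x))" for g
        using continuous_on_Re[OF trig_poly_continuous_on[OF that]] by simp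
      show "trig_poly (\<lambda>x. complex_of_real (f x + g x))"
        if "trig_poly (\<lambda>x. complex_of_real (f x)) \<and> trig_poly (\<lambda>x. complex_of_real (g x))" for f g
        using that trig_poly_add[of "\<lambda>x. complex_of_real (f x)" "\<lambda>x. complex_of_real (g x)"] by simp
      show "trig_poly (\<lambda>x. complex_of_real (f x * g x))"
        if "trig_poly (\<lambda>x. complex_of_real (f x)) \<and> trig_poly (\<lambda>x. complex_of_real (g x))" for f g
        using that trig_poly_mult[of "\<lambda>x. complex_of_real (f x)" "\<lambda>x. complex_of_real (g x)"] by simp
      show "\<exists>f. trig_poly (\<lambda>x. complex_of_real (f x)) \<and> f x \<noteq> f y" if "x \<in> closure \<Omega> \<and> y \<in> closure \<Omega> \<and> x \<noteq> y" for x y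
        using trig_poly_separates that by blast
      show "continuous_on (closure \<Omega>) \<phi>" by (rule test_fun_continuous_on[OF \<phi>])
    qed (rule d)
    then obtain g where g: "trig_poly (\<lambda>x. complex_of_real (g x))" "\<And>x. x \<in> closure \<Omega> \<Longrightarrow> \<bar>\<phi> x - g x\<bar> < d" by blast
    have G: "integral\<^sup>L (lebesgue_on \<Omega>) (\<lambda>x. h x * complex_of_real (g x)) = 0" "L2 \<Omega> (\<lambda>x. complex_of_real (g x))"
      using L2_pair_trig_poly[OF O h z g(1)] by auto
    note i = L2_integrable_mult[OF h L2_test_fun(1)[OF O \<phi>]] L2_integrable_mult[OF h G(2)]
    have "integral\<^sup>L (lebesgue_on \<Omega>) (\<lambda>x. h x * complex_of_real (\<phi> x)) = integral\<^sup>L (lebesgue_on \<Omega>) (\<lambda>x. h x * complex_of_real (\<phi> x) - h x * complex_of_real (g x))"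
      using i G(1) by simp
    also have "cmod \<dots> \<le> integral\<^sup>L (lebesgue_on \<Omega>) (\<lambda>x. d * cmod (h x))"
    proof (rule Bochner_Integration.integral_norm_bound_integral)
      show "integrable (lebesgue_on \<Omega>) (\<lambda>x. h x * complex_of_real (\<phi> x) - h x * complex_of_real (g x))" using i by simp
      show "integrable (lebesgue_on \<Omega>) (\<lambda>x. d * cmod (h x))" using ih by simp
      fix x assume "x \<in> space (lebesgue_on \<Omega>)"
      then have "x \<in> closure \<Omega>" using closure_subset by auto
      then have "\<bar>\<phi> x - g x\<bar> \<le> d" using g(2) by (simp add: less_imp_le)
      moreover have "cmod (h x * complex_of_real (\<phi> x) - h x * complex_of_real (g x)) = cmod (h x) * \<bar>\<phi> x - g x\<bar>"
        by (metis norm_mult norm_of_real of_real_diff right_diff_distrib)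
      ultimately show "cmod (h x * complex_of_real (\<phi> x) - h x * complex_of_real (g x)) \<le> d * cmod (h x)"
        by (simp add: mult.commute[of d] mult_left_mono)
    qed
    also have "\<dots> = d * N" by (simp add: N_def)
    also have "\<dots> \<le> e" using e N0 by (simp add: d_def field_simps)
    finally show ?thesis .
  qed
  have "cmod (integral\<^sup>L (lebesgue_on \<Omega>) (\<lambda>x. h x * complex_of_real (\<phi> x))) \<le> 0"
  proof (rule field_le_epsilon)
    fix e :: real assume "0 < e"
    from small[OF this] show "cmod (integral\<^sup>L (lebesgue_on \<Omega>) (\<lambda>x. h x * complex_of_real (\<phi> x))) \<le> 0 + e" by simp
  qed
  then show "integral\<^sup>L (lebesgue_on \<Omega>) (\<lambda>x. h x * complex_of_real (\<phi> x)) = 0" by simp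
qed

text \<open>Continuity of the Fourier transform of a function on a bounded set. It fills in the
  exceptional sphere, and it keeps the pairing of two nearby waves away from 0.\<close>

lemma L2_pair_wave_tendsto:
  assumes O: "bounded \<Omega>" "open \<Omega>" and h: "L2 \<Omega> h" and w: "w \<longlonglongrightarrow> w0"
  shows "(\<lambda>n. L2_pair \<Omega> h (wave (w n))) \<longlonglongrightarrow> L2_pair \<Omega> h (wave w0)"
  unfolding L2_pair_def
proof (rule integral_dominated_convergence[where w = "\<lambda>x. cmod (h x)"])
  show "(\<lambda>x. h x * cnj (wave w0 x)) \<in> borel_measurable (lebesgue_on \<Omega>)"
    "\<And>n. (\<lambda>x. h x * cnj (wave (w n) x)) \<in> borel_measurable (lebesgue_on \<Omega>)"
    by (intro borel_measurable_integrable L2_integrable_mult h L2_cnj L2_wave O)+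
  show "integrable (lebesgue_on \<Omega>) (\<lambda>x. cmod (h x))" using L2_integrable[OF O h] by simp
  show "AE x in lebesgue_on \<Omega>. (\<lambda>n. h x * cnj (wave (w n) x)) \<longlonglongrightarrow> h x * cnj (wave w0 x)"
    unfolding wave_def cis_conv_exp by (intro AE_I2 tendsto_intros w)
  show "AE x in lebesgue_on \<Omega>. cmod (h x * cnj (wave (w n) x)) \<le> cmod (h x)" for n
    by (simp add: norm_mult)
qed

text \<open>For a divergence free plane wave the Stokes form has two values:
  \<open>w \<bullet> w\<close> times the inner product, as \<open>u\<close> is trace free, and
  \<open>lam\<close> times it, as \<open>u\<close> solves the Neumann equation. Off the sphere the
  vector of the \<open>F l w\<close> is therefore orthogonal to every amplitude orthogonal to
  \<open>w\<close>, and vanishing divergence makes it orthogonal to \<open>w\<close> too. No sign of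
  \<open>lam\<close> is assumed; the case 0 yields positivity of the Dirichlet eigenvalue
  later.\<close>

lemma trace_free_neumann_eigenfunction_eq_0:
  fixes \<Omega> :: "(real^'d::finite) set"
  assumes O: "bounded \<Omega>" "open \<Omega>" and t: "trace_free \<Omega> u" and u: "u \<in> V_N \<Omega>"
    and eig: "\<And>v. v \<in> V_N \<Omega> \<Longrightarrow> stokes_form \<Omega> u v = of_real lam * L2_inner \<Omega> u v"
  shows "AE x in lebesgue_on \<Omega>. u x = 0"
proof -
  have H: "H1 \<Omega> u" using u by (simp add: V_N_def)
  define F where "F l w = L2_pair \<Omega> (\<lambda>x. u x $ l) (wave w)" for l w
  have div: "(\<Sum>k\<in>UNIV. of_real (w $ k) * F k w) = 0" for w
  proof -
    have "(\<Sum>k\<in>UNIV. L2_pair \<Omega> (wd \<Omega> k k u) (wave w)) = integral\<^sup>L (lebesgue_on \<Omega>) (\<lambda>x. (\<Sum>k\<in>UNIV. wd \<Omega> k k u x) * cnj (wave w x))"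
      unfolding L2_pair_def sum_distrib_right
      by (rule Bochner_Integration.integral_sum[symmetric]) (intro L2_integrable_mult H1_wd(1) H L2_cnj L2_wave O)
    also have "\<dots> = 0"
    proof (rule integral_eq_zero_AE)
      have "AE x in lebesgue_on \<Omega>. (\<Sum>k\<in>UNIV. wd \<Omega> k k u x) = 0" using u by (simp add: V_N_def div_free_def)
      then show "AE x in lebesgue_on \<Omega>. (\<Sum>k\<in>UNIV. wd \<Omega> k k u x) * cnj (wave w x) = 0" by eventually_elim simp
    qed
    finally have "(\<Sum>k\<in>UNIV. \<i> * of_real (w $ k) * F k w) = 0" using t by (simp add: trace_free_def F_def)
    then have "\<i> * (\<Sum>k\<in>UNIV. of_real (w $ k) * F k w) = 0" by (simp add: sum_distrib_left mult.assoc)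
    then show ?thesis by simp
  qed
  have orth: "(\<Sum>l\<in>UNIV. of_real (h $ l) * F l w) = 0" if wl: "w \<bullet> w \<noteq> lam" and h: "w \<bullet> h = 0" for w h
  proof -
    have "of_real (w \<bullet> w) * L2_inner \<Omega> u (plane_wave w h) = of_real lam * L2_inner \<Omega> u (plane_wave w h)"
      by (rule trans[OF stokes_form_trace_free_plane_wave[OF O t, symmetric] eig[OF plane_wave_V_N[OF O h]]])
    then have "L2_inner \<Omega> u (plane_wave w h) = 0" using wl by simp
    then show ?thesis by (simp add: L2_inner_plane_wave[OF O H] F_def)
  qed
  have F1: "F l w = 0" if wl: "w \<bullet> w \<noteq> lam" for l w
  proof -
    \<comment> \<open>Amplitudes of plane waves are real, so the complex Fourier vector is split. By
      \<open>div\<close> both parts are orthogonal to \<open>w\<close> and thus admissible as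
      amplitudes; testing with each makes it orthogonal to itself.\<close>
    define r where "r = (\<chi> l. Re (F l w))"
    define s where "s = (\<chi> l. Im (F l w))"
    have dr: "w \<bullet> r = 0" using arg_cong[OF div[of w], of Re] by (simp add: r_def inner_vec_def)
    have ds: "w \<bullet> s = 0" using arg_cong[OF div[of w], of Im] by (simp add: s_def inner_vec_def)
    have "r \<bullet> r = 0" using arg_cong[OF orth[OF wl dr], of Re] by (simp add: r_def inner_vec_def)
    moreover have "s \<bullet> s = 0" using arg_cong[OF orth[OF wl ds], of Im] by (simp add: s_def inner_vec_def)
    ultimately have "r $ l = 0" "s $ l = 0" by simp_all
    then show ?thesis by (simp add: r_def s_def complex_eq_iff)
  qed
  have F0: "F l w = 0" for l w
  proof (cases "w \<bullet> w = lam")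
    case True
    \<comment> \<open>A direction that leads strictly out of the sphere: radial, or any axis if the
      sphere shrinks to the origin. Continuity then carries the zeros of the Fourier transform back
      to \<open>w\<close>.\<close>
    define e where "e = (if w = 0 then axis undefined 1 else w)"
    have e: "w \<bullet> e \<ge> 0" "e \<bullet> e > 0" by (auto simp: e_def)
    define v where "v n = w + (1 / real (Suc n)) *\<^sub>R e" for n
    have "v n \<bullet> v n \<noteq> lam" for n
    proof -
      define s where "s = 1 / real (Suc n)"
      have s: "s > 0" by (simp add: s_def)
      have v: "v n = w + s *\<^sub>R e" by (simp add: v_def s_def)
      have "v n \<bullet> v n = w \<bullet> w + 2 * s * (w \<bullet> e) + s\<^sup>2 * (e \<bullet> e)"
        unfolding v by (simp add: inner_add_left inner_add_right inner_commute[of e w] power2_eq_square algebra_simps)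
      moreover have "s\<^sup>2 * (e \<bullet> e) > 0" using s e by simp
      moreover have "2 * s * (w \<bullet> e) \<ge> 0" using s e by simp
      ultimately show ?thesis using True by linarith
    qed
    then have "F l (v n) = 0" for n by (rule F1)
    moreover have "v \<longlonglongrightarrow> w + 0 *\<^sub>R e" unfolding v_def
      by (intro tendsto_intros) (use LIMSEQ_inverse_real_of_nat in \<open>simp add: inverse_eq_divide\<close>)
    then have "(\<lambda>n. F l (v n)) \<longlonglongrightarrow> F l w"
      unfolding F_def by (intro L2_pair_wave_tendsto O H1_component H) simp
    ultimately show ?thesis by (simp add: LIMSEQ_const_iff)
  qed (rule F1)
  have "AE x in lebesgue_on \<Omega>. u x $ l = 0" for l
    using F0 by (intro AE_eq_0_if_orthogonal_waves O H1_component H) (simp add: F_def)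
  then have "AE x in lebesgue_on \<Omega>. \<forall>l. u x $ l = 0" by (simp add: AE_all_countable)
  then show ?thesis by eventually_elim (simp add: vec_eq_iff)
qed

section \<open>Two plane waves on the same sphere\<close>

lemma stokes_form_plane_waves:
  assumes O: "bounded \<Omega>" "open \<Omega>"
  shows "stokes_form \<Omega> (plane_wave w h) (plane_wave w' h') = of_real (w \<bullet> w') * L2_inner \<Omega> (plane_wave w h) (plane_wave w' h')"
    "L2_inner \<Omega> (plane_wave w h) (plane_wave w' h') = of_real (h \<bullet> h') * L2_pair \<Omega> (wave w) (wave w')"
proof -
  note H = plane_wave_H1(1)[OF O]
  have p: "L2_pair \<Omega> (wd \<Omega> k l (plane_wave w h)) (wave w') = of_real (h $ l) * (\<i> * of_real (w $ k)) * L2_pair \<Omega> (wave w) (wave w')" for k l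
  proof -
    have "L2_pair \<Omega> (wd \<Omega> k l (plane_wave w h)) (wave w') = L2_pair \<Omega> (\<lambda>x. of_real (h $ l) * (\<i> * of_real (w $ k) * wave w x)) (wave w')"
      by (rule L2_pair_cong_AE) (auto intro!: H1_wd H plane_wave_H1 O L2_scale L2_wave)
    also have "\<dots> = of_real (h $ l) * (\<i> * of_real (w $ k)) * L2_pair \<Omega> (wave w) (wave w')"
      by (simp add: L2_pair_scale mult.assoc)
    finally show ?thesis .
  qed
  show e: "L2_inner \<Omega> (plane_wave w h) (plane_wave w' h') = of_real (h \<bullet> h') * L2_pair \<Omega> (wave w) (wave w')"
    unfolding L2_inner_plane_wave[OF O H] plane_wave_nth L2_pair_scale
    by (simp add: inner_vec_def sum_distrib_left mult_ac)
  have "stokes_form \<Omega> (plane_wave w h) (plane_wave w' h')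
    = (\<Sum>k\<in>UNIV. \<Sum>l\<in>UNIV. of_real (w $ k * w' $ k) * (of_real (h $ l * h' $ l) * L2_pair \<Omega> (wave w) (wave w')))"
    unfolding stokes_form_plane_wave[OF O H] p by (intro sum.cong refl) (simp add: mult_ac)
  also have "\<dots> = (\<Sum>k\<in>UNIV. of_real (w $ k * w' $ k)) * ((\<Sum>l\<in>UNIV. of_real (h $ l * h' $ l)) * L2_pair \<Omega> (wave w) (wave w'))"
    by (simp only: sum_distrib_left[symmetric] sum_distrib_right[symmetric])
  also have "\<dots> = of_real (w \<bullet> w') * L2_inner \<Omega> (plane_wave w h) (plane_wave w' h')"
    unfolding e by (simp add: inner_vec_def)
  finally show "stokes_form \<Omega> (plane_wave w h) (plane_wave w' h') = of_real (w \<bullet> w') * L2_inner \<Omega> (plane_wave w h) (plane_wave w' h')" .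
qed

text \<open>Frequency and amplitude are rotated together by a small angle in the plane of two axes,
  available as \<open>CARD('d)\<close> is at least 2. The shifted form of the two waves is then
  \<open>lam * (cos (\<theta> n) - 1) * cos (\<theta> n)\<close> times the pairing of the scalar
  waves. The trigonometric factors are nonzero for every \<open>n\<close>, and the pairing tends to
  the measure of the nonempty open domain, hence is nonzero for some \<open>n\<close>.\<close>

lemma plane_wave_pair_exists:
  fixes \<Omega> :: "(real^'d::finite) set"
  assumes O: "bounded \<Omega>" "open \<Omega>" "\<Omega> \<noteq> {}" and d: "CARD('d) \<ge> 2" and lam: "lam > 0"
  shows "\<exists>f w h w' h'. f = plane_wave w h \<and> w \<bullet> h = 0 \<and> w' \<bullet> h' = 0 \<and> w \<bullet> w = lam \<and> w' \<bullet> w' = lam \<and>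
    stokes_form \<Omega> f (plane_wave w' h') \<noteq> of_real lam * L2_inner \<Omega> f (plane_wave w' h')"
proof -
  obtain i j :: 'd where ij: "i \<noteq> j"
    using d by (metis (full_types) card_le_Suc0_iff_eq finite numeral_2_eq_2 not_less_eq_eq)
  define q where "q = sqrt lam"
  have qq: "q * q = lam" using lam by (simp add: q_def)
  define w where "w = q *\<^sub>R (axis i 1 :: real^'d)"
  define h where "h = (axis j 1 :: real^'d)"
  define \<theta> where "\<theta> n = 1 / real (Suc n)" for n
  define w' where "w' n = q *\<^sub>R (cos (\<theta> n) *\<^sub>R axis i 1 + sin (\<theta> n) *\<^sub>R axis j 1 :: real^'d)" for n
  define h' where "h' n = (- sin (\<theta> n)) *\<^sub>R axis i 1 + cos (\<theta> n) *\<^sub>R (axis j 1 :: real^'d)" for n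
  have ax: "(axis i 1 :: real^'d) \<bullet> axis i 1 = 1" "(axis j 1 :: real^'d) \<bullet> axis j 1 = 1" "(axis i 1 :: real^'d) \<bullet> axis j 1 = 0" "(axis j 1 :: real^'d) \<bullet> axis i 1 = 0"
    using ij by (auto simp: inner_axis_axis)
  have 1: "w \<bullet> h = 0" "w \<bullet> w = lam" by (auto simp: w_def h_def ax qq)
  have 2: "w' n \<bullet> h' n = 0" "w' n \<bullet> w' n = lam" for n
  proof -
    show "w' n \<bullet> h' n = 0" by (simp add: w'_def h'_def inner_add_left inner_add_right inner_diff_right ax)
    have "(q *\<^sub>R (c *\<^sub>R axis i 1 + s *\<^sub>R axis j 1 :: real^'d)) \<bullet> (q *\<^sub>R (c *\<^sub>R axis i 1 + s *\<^sub>R axis j 1)) = (q * q) * (c * c + s * s)" for c s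
      by (simp add: inner_add_left inner_add_right ax algebra_simps)
    then have "w' n \<bullet> w' n = (q * q) * (cos (\<theta> n) * cos (\<theta> n) + sin (\<theta> n) * sin (\<theta> n))"
      unfolding w'_def .
    then show "w' n \<bullet> w' n = lam" by (simp only: qq sin_cos_squared_add3 mult_1_right)
  qed
  have t0: "\<theta> \<longlonglongrightarrow> 0" unfolding \<theta>_def using LIMSEQ_inverse_real_of_nat by (simp add: inverse_eq_divide)
  have "w' \<longlonglongrightarrow> q *\<^sub>R (cos 0 *\<^sub>R axis i 1 + sin 0 *\<^sub>R axis j 1)"
    unfolding w'_def by (intro tendsto_intros t0)
  then have "w' \<longlonglongrightarrow> w" by (simp add: w_def)
  from L2_pair_wave_tendsto[OF O(1,2) L2_wave[OF O(1,2), of w] this]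
  have lim: "(\<lambda>n. L2_pair \<Omega> (wave w) (wave (w' n))) \<longlonglongrightarrow> L2_pair \<Omega> (wave w) (wave w)" .
  have "L2_pair \<Omega> (wave w) (wave w) \<noteq> 0"
  proof
    assume "L2_pair \<Omega> (wave w) (wave w) = 0"
    then have "L2_sq \<Omega> (wave w) = 0" using L2_pair_self[of \<Omega> "wave w"] by simp
    then have "AE x in lebesgue_on \<Omega>. wave w x = 0" by (rule integral_norm_sq_eq_0_AE[OF L2_wave[OF O(1,2)]])
    then have "AE x in lebesgue_on \<Omega>. False"
    proof eventually_elim
      case (elim x)
      then show ?case using norm_wave[of w x] by simp
    qed
    then have "AE x in lborel. x \<notin> \<Omega>" using O by (simp add: AE_lebesgue_on_iff)
    then have "emeasure lborel \<Omega> = 0" using O by (subst (asm) AE_iff_measurable[of \<Omega>]) auto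
    then have "\<Omega> \<in> null_sets lborel" using O by (simp add: null_sets_def)
    then have "negligible \<Omega>" by (simp add: negligible_iff_null_sets null_sets_completionI)
    then show False using open_not_negligible[OF O(2,3)] by simp
  qed
  then have "\<forall>\<^sub>F n in sequentially. L2_pair \<Omega> (wave w) (wave (w' n)) \<noteq> 0" using lim tendsto_imp_eventually_ne by blast
  then obtain n where n: "L2_pair \<Omega> (wave w) (wave (w' n)) \<noteq> 0" by (auto simp: eventually_sequentially)
  have th: "0 < \<theta> n" "\<theta> n \<le> 1" by (auto simp: \<theta>_def)
  have c: "cos (\<theta> n) > 0" by (rule cos_gt_zero) (use th pi_gt3 in linarith)+
  have c1: "cos (\<theta> n) < 1" using cos_monotone_0_pi[of 0 "\<theta> n"] th pi_gt3 by simp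
  have ww: "w \<bullet> w' n = lam * cos (\<theta> n)" by (simp add: w_def w'_def inner_add_right ax qq[symmetric])
  have hh: "h \<bullet> h' n = cos (\<theta> n)" by (simp add: h_def h'_def inner_add_right inner_diff_right ax)
  have "stokes_form \<Omega> (plane_wave w h) (plane_wave (w' n) (h' n)) \<noteq> of_real lam * L2_inner \<Omega> (plane_wave w h) (plane_wave (w' n) (h' n))"
    using lam c c1 n by (simp add: stokes_form_plane_waves[OF O(1,2)] ww hh)
  then show ?thesis using 1 2 by blast
qed

section \<open>Comparison of eigenvalues\<close>

lemma vscale_sum_apply: "(\<Sum>i\<in>I. vscale (c i) (u i)) x = (\<Sum>i\<in>I. c i *s u i x)"
proof (cases "finite I")
  case True
  then show ?thesis by (induction I rule: finite_induct) auto
qed simp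

text \<open>Turns recorded multiplicities into one eigenvector per index: for each value
  \<open>t\<close> a bijection distributes a basis of the eigenspace over the indices carrying
  \<open>t\<close>. Independence is claimed for one value at a time, since different values are
  later separated by orthogonality.\<close>

lemma eigenvalue_seq_eigvecs:
  assumes "eigenvalue_seq \<Omega> V lam"
  obtains e where "\<And>j. 1 \<le> j \<Longrightarrow> is_eigvec \<Omega> V (lam j) (e j)"
    "\<forall>t c. (AE x in lebesgue_on \<Omega>. (\<Sum>j\<in>{j. 1 \<le> j \<and> lam j = t}. c j *s e j x) = 0) \<longrightarrow> (\<forall>j\<ge>1. lam j = t \<longrightarrow> c j = 0)"
proof -
  define S where "S t = {j. 1 \<le> j \<and> lam j = t}" for t
  have fin: "finite (S t)" and ind: "indep_eigvecs \<Omega> V t (card (S t))" for t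
    using assms by (auto simp: eigenvalue_seq_def S_def)
  have "\<forall>t. \<exists>U. (\<forall>i<card (S t). is_eigvec \<Omega> V t (U i)) \<and>
      (\<forall>c :: nat \<Rightarrow> complex. (AE x in lebesgue_on \<Omega>. (\<Sum>i<card (S t). c i *s U i x) = 0) \<longrightarrow> (\<forall>i<card (S t). c i = 0))"
    using ind unfolding indep_eigvecs_def by blast
  from choice[OF this] obtain U where U: "\<And>t i. i < card (S t) \<Longrightarrow> is_eigvec \<Omega> V t (U t i)"
    and Ui: "\<And>t c i. AE x in lebesgue_on \<Omega>. (\<Sum>i<card (S t). c i *s U t i x) = 0 \<Longrightarrow> i < card (S t) \<Longrightarrow> c i = (0::complex)"
    by blast
  have "\<forall>t. \<exists>h. bij_betw h (S t) {..<card (S t)}"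
    using ex_bij_betw_finite_nat[OF fin] by (simp add: atLeast0LessThan)
  from choice[OF this] obtain h where h: "\<And>t. bij_betw (h t) (S t) {..<card (S t)}" by blast
  define e where "e j = U (lam j) (h (lam j) j)" for j
  show thesis
  proof (rule that[of e])
    fix j :: nat assume j: "1 \<le> j"
    then have "j \<in> S (lam j)" by (simp add: S_def)
    then have "h (lam j) j < card (S (lam j))" using bij_betwE[OF h] by blast
    then show "is_eigvec \<Omega> V (lam j) (e j)" unfolding e_def by (rule U)
  next
    show "\<forall>t c. (AE x in lebesgue_on \<Omega>. (\<Sum>j\<in>{j. 1 \<le> j \<and> lam j = t}. c j *s e j x) = 0) \<longrightarrow> (\<forall>j\<ge>1. lam j = t \<longrightarrow> c j = 0)"
    proof (intro allI impI)
      fix t c j assume z: "AE x in lebesgue_on \<Omega>. (\<Sum>j\<in>{j. 1 \<le> j \<and> lam j = t}. c j *s e j x) = 0" and j: "1 \<le> j" "lam j = t"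
      define g where "g = the_inv_into (S t) (h t)"
      have g: "g (h t j) = j" if "j \<in> S t" for j
        unfolding g_def using h[of t] that by (intro the_inv_into_f_f) (auto simp: bij_betw_def)
      have "(\<Sum>j\<in>S t. c j *s e j x) = (\<Sum>i<card (S t). c (g i) *s U t i x)" for x
      proof -
        have "(\<Sum>i<card (S t). c (g i) *s U t i x) = (\<Sum>j\<in>S t. c (g (h t j)) *s U t (h t j) x)"
          using sum.reindex_bij_betw[OF h[of t], of "\<lambda>i. c (g i) *s U t i x"] by simp
        also have "\<dots> = (\<Sum>j\<in>S t. c j *s e j x)"
          by (intro sum.cong refl) (simp add: g, simp add: e_def S_def)
        finally show ?thesis by simp
      qed
      with z have "AE x in lebesgue_on \<Omega>. (\<Sum>i<card (S t). c (g i) *s U t i x) = 0" by (simp add: S_def)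
      moreover have jS: "j \<in> S t" using j by (simp add: S_def)
      then have "h t j < card (S t)" using bij_betwE[OF h] by blast
      ultimately have "c (g (h t j)) = 0" by (rule Ui[where t = t and c = "\<lambda>i. c (g i)"])
      then show "c j = 0" using g[OF jS] by simp
    qed
  qed
qed

lemma V_D_subset_V_N: "V_D \<Omega> \<subseteq> V_N \<Omega>"
  by (auto simp: V_D_def V_N_def H10_def)

text \<open>Treats Neumann and Dirichlet eigenvectors at once: \<open>V\<close> need only be
  contained in \<open>V_N\<close>, as \<open>eigen_family\<close> tests the equation within the
  family. For a single eigenvalue the coefficients are extended by 0 to all indices that carry it,
  where \<open>ind\<close> applies.\<close>

lemma is_eigvec_independent_family:
  assumes cf: "compact_form vscale (V_N \<Omega>) (L2_inner \<Omega>) (stokes_form \<Omega>)"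
    and V: "V \<subseteq> V_N \<Omega>" and J: "finite J" "J \<subseteq> {1..}" and S: "\<And>t. finite {j. 1 \<le> j \<and> lam j = t}"
    and e: "\<And>j. 1 \<le> j \<Longrightarrow> is_eigvec \<Omega> V (lam j) (e j)"
    and ind: "\<forall>t c. (AE x in lebesgue_on \<Omega>. (\<Sum>j\<in>{j. 1 \<le> j \<and> lam j = t}. c j *s e j x) = 0) \<longrightarrow> (\<forall>j\<ge>1. lam j = t \<longrightarrow> c j = 0)"
  shows "compact_form.eigen_family (V_N \<Omega>) (L2_inner \<Omega>) (stokes_form \<Omega>) J lam e"
    "compact_form.independent_family vscale (V_N \<Omega>) (L2_inner \<Omega>) J e"
proof -
  interpret cf: compact_form vscale "V_N \<Omega>" "L2_inner \<Omega>" "stokes_form \<Omega>" by (rule cf)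
  have eV: "e j \<in> V_N \<Omega>" if "1 \<le> j" for j using e[OF that] V by (auto simp: is_eigvec_def)
  show E: "cf.eigen_family J lam e"
    unfolding cf.eigen_family_def using e J(2) eV by (auto simp: is_eigvec_def subset_iff)
  show "cf.independent_family J e"
  proof (rule cf.eigen_family_independent[OF J(1) E])
    fix t
    define T where "T = {j \<in> J. lam j = t}"
    have T: "finite T" "T \<subseteq> {j. 1 \<le> j \<and> lam j = t}" using J by (auto simp: T_def)
    have "cf.independent_family T e"
      unfolding cf.independent_family_def
    proof (intro conjI ballI allI impI)
      show "e i \<in> V_N \<Omega>" if "i \<in> T" for i using that T eV by auto
      fix c i assume z: "Re (L2_inner \<Omega> (\<Sum>j\<in>T. vscale (c j) (e j)) (\<Sum>j\<in>T. vscale (c j) (e j))) = 0" and i: "i \<in> T"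
      have "(\<Sum>j\<in>T. vscale (c j) (e j)) \<in> V_N \<Omega>" by (intro cf.ip.lincomb_mem) (use T eV in auto)
      then have "AE x in lebesgue_on \<Omega>. (\<Sum>j\<in>T. vscale (c j) (e j)) x = 0"
        using z Re_L2_inner_eq_0_iff[of \<Omega> "\<Sum>j\<in>T. vscale (c j) (e j)"] unfolding V_N_def by blast
      moreover have "(\<Sum>j\<in>T. vscale (c j) (e j)) x = (\<Sum>j\<in>{j. 1 \<le> j \<and> lam j = t}. (if j \<in> T then c j else 0) *s e j x)" for x
      proof -
        have "(\<Sum>j\<in>{j. 1 \<le> j \<and> lam j = t}. (if j \<in> T then c j else 0) *s e j x) = (\<Sum>j\<in>T. (if j \<in> T then c j else 0) *s e j x)"
          by (rule sum.mono_neutral_right[OF S T(2)]) auto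
        then show ?thesis by (simp add: vscale_sum_apply)
      qed
      ultimately have "AE x in lebesgue_on \<Omega>. (\<Sum>j\<in>{j. 1 \<le> j \<and> lam j = t}. (if j \<in> T then c j else 0) *s e j x) = 0" by simp
      then have "\<forall>j\<ge>1. lam j = t \<longrightarrow> (if j \<in> T then c j else 0) = 0"
        by (rule ind[THEN spec, THEN spec, THEN mp])
      then have "(if i \<in> T then c i else 0) = 0" using i T by blast
      then show "c i = 0" using i by simp
    qed
    then show "cf.independent_family {j \<in> J. lam j = t} e" by (simp add: T_def)
  qed
qed

text \<open>On the empty set every combination vanishes almost everywhere, so no eigenspace has
  positive dimension, while \<open>lam 1\<close> must have multiplicity at least 1. Nonemptiness
  gives the domain positive measure, on which the choice of the two plane waves relies.\<close>

lemma eigenvalue_seq_nonempty: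
  assumes "eigenvalue_seq \<Omega> V lam"
  shows "\<Omega> \<noteq> {}"
proof
  assume \<Omega>: "\<Omega> = {}"
  have f: "finite {n. 1 \<le> n \<and> lam n = lam 1}" using assms by (simp add: eigenvalue_seq_def)
  moreover have "1 \<in> {n. 1 \<le> n \<and> lam n = lam 1}" by simp
  ultimately have "1 \<le> card {n. 1 \<le> n \<and> lam n = lam 1}"
    by (metis One_nat_def Suc_leI card_gt_0_iff empty_iff)
  then have "indep_eigvecs \<Omega> V (lam 1) 1" using assms by (simp add: eigenvalue_seq_def)
  then obtain u :: "nat \<Rightarrow> real^'a \<Rightarrow> complex^'a" where
    u: "\<And>c :: nat \<Rightarrow> complex. AE x in lebesgue_on \<Omega>. (\<Sum>i<1. c i *s u i x) = 0 \<Longrightarrow> \<forall>i<1. c i = 0"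
    unfolding indep_eigvecs_def by blast
  have "AE x in lebesgue_on \<Omega>. (\<Sum>i<1. (1::complex) *s u i x) = 0"
    by (rule AE_I2) (simp add: \<Omega>)
  from u[OF this] show False by auto
qed

theorem theorem3p7:
  fixes \<Omega> :: "(real^'d) set" and lamN lamD :: "nat \<Rightarrow> real" and n :: nat
  assumes "CARD('d) \<ge> 2"
    and "bounded \<Omega>" and "open \<Omega>" and "connected \<Omega>" and "lipschitz_boundary \<Omega>"
    and "eigenvalue_seq \<Omega> (V_N \<Omega>) lamN"
    and "eigenvalue_seq \<Omega> (V_D \<Omega>) lamD"
    and "n \<ge> 1"
  shows "lamN (n + 1) < lamD n"
proof (rule ccontr)
  assume neg: "\<not> lamN (n + 1) < lamD n"
  note O = assms(2,3)
  define lam where "lam = lamD n"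
  note cf = compact_form_V_N[OF assms(2,3,5)]
  interpret cf: compact_form vscale "V_N \<Omega>" "L2_inner \<Omega>" "stokes_form \<Omega>" by (rule cf)
  have monoN: "mono_on {1..} lamN" and monoD: "mono_on {1..} lamD"
    and finN: "\<And>t. finite {j. 1 \<le> j \<and> lamN j = t}" and finD: "\<And>t. finite {j. 1 \<le> j \<and> lamD j = t}"
    and cardN: "\<And>t k. indep_eigvecs \<Omega> (V_N \<Omega>) t k \<Longrightarrow> k \<le> card {j. 1 \<le> j \<and> lamN j = t}"
    using assms(6,7) by (auto simp: eigenvalue_seq_def)
  obtain eN where eN: "\<And>j. 1 \<le> j \<Longrightarrow> is_eigvec \<Omega> (V_N \<Omega>) (lamN j) (eN j)"
    and eNi: "\<forall>t c. (AE x in lebesgue_on \<Omega>. (\<Sum>j\<in>{j. 1 \<le> j \<and> lamN j = t}. c j *s eN j x) = 0) \<longrightarrow> (\<forall>j\<ge>1. lamN j = t \<longrightarrow> c j = 0)"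
    using eigenvalue_seq_eigvecs[OF assms(6)] by blast
  obtain eD where eD: "\<And>j. 1 \<le> j \<Longrightarrow> is_eigvec \<Omega> (V_D \<Omega>) (lamD j) (eD j)"
    and eDi: "\<forall>t c. (AE x in lebesgue_on \<Omega>. (\<Sum>j\<in>{j. 1 \<le> j \<and> lamD j = t}. c j *s eD j x) = 0) \<longrightarrow> (\<forall>j\<ge>1. lamD j = t \<longrightarrow> c j = 0)"
    using eigenvalue_seq_eigvecs[OF assms(7)] by blast
  have indN: "cf.independent_family K eN" if K: "finite K" "K \<subseteq> {1..}" for K
    by (rule is_eigvec_independent_family(2)[where V = "V_N \<Omega>" and lam = lamN and e = eN, OF cf subset_refl K finN eN eNi])
  have indD: "cf.eigen_family K lamD eD" "cf.independent_family K eD" if K: "finite K" "K \<subseteq> {1..}" for K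
    using is_eigvec_independent_family[where V = "V_D \<Omega>" and lam = lamD and e = eD, OF cf V_D_subset_V_N K finD eD eDi]
    by blast+
  have eNV: "eN j \<in> V_N \<Omega>" if "1 \<le> j" for j using eN[OF that] by (simp add: is_eigvec_def)
  have eDV: "eD j \<in> V_N \<Omega>" if "1 \<le> j" for j using eD[OF that] V_D_subset_V_N by (auto simp: is_eigvec_def)
  have eDt: "trace_free \<Omega> (eD j)" if "1 \<le> j" for j
    using eD[OF that] by (intro H10_trace_free O) (simp add: is_eigvec_def V_D_def)
  have null: "Re (L2_inner \<Omega> u u) = 0 \<longleftrightarrow> (AE x in lebesgue_on \<Omega>. u x = 0)" if "u \<in> V_N \<Omega>" for u
    using that by (intro Re_L2_inner_eq_0_iff) (simp add: V_N_def)
  have eDn: "Re (L2_inner \<Omega> (eD n) (eD n)) > 0"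
  proof -
    have "cf.independent_family {n} eD" using assms(8) by (intro indD(2)) auto
    then have "\<not> Re (L2_inner \<Omega> (eD n) (eD n)) = 0"
      unfolding cf.independent_family_def by (auto dest!: spec[of _ "\<lambda>_. 1"])
    then show ?thesis using cf.ip.form_nonneg[OF eDV[OF assms(8)]] by simp
  qed
  have lam: "lam > 0"
  proof -
    have "stokes_form \<Omega> (eD n) (eD n) = of_real lam * L2_inner \<Omega> (eD n) (eD n)"
      using eD[OF assms(8)] by (simp add: is_eigvec_def lam_def)
    then have r: "Re (stokes_form \<Omega> (eD n) (eD n)) = lam * Re (L2_inner \<Omega> (eD n) (eD n))" by simp
    then have "lam \<ge> 0" using cf.a.form_nonneg[OF eDV[OF assms(8)]] eDn by (simp add: zero_le_mult_iff)
    \<comment> \<open>For \<open>lam = 0\<close> the Dirichlet eigenvector would be a null vector of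
      the Stokes form and hence a Neumann eigenvector for 0, which a trace free function can be only
      if it vanishes.\<close>
    moreover have "lam \<noteq> 0"
    proof
      assume "lam = 0"
      then have "stokes_form \<Omega> (eD n) v = of_real 0 * L2_inner \<Omega> (eD n) v" if "v \<in> V_N \<Omega>" for v
        using r cf.a.form_eq_0_if_diag_eq_0[OF eDV[OF assms(8)] that] by simp
      then have "AE x in lebesgue_on \<Omega>. eD n x = 0"
        by (intro trace_free_neumann_eigenfunction_eq_0[OF O eDt[OF assms(8)] eDV[OF assms(8)], of 0])
      then show False using null[OF eDV[OF assms(8)]] eDn by simp
    qed
    ultimately show ?thesis by simp
  qed
  obtain w h w' h' where w: "w \<bullet> h = 0" "w' \<bullet> h' = 0" "w \<bullet> w = lam" "w' \<bullet> w' = lam"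
    and ne: "stokes_form \<Omega> (plane_wave w h) (plane_wave w' h') \<noteq> of_real lam * L2_inner \<Omega> (plane_wave w h) (plane_wave w' h')"
    using plane_wave_pair_exists[OF O eigenvalue_seq_nonempty[OF assms(6)] assms(1) lam] by blast
  define M where "M = {j. 1 \<le> j \<and> lamN j = lam}"
  define J where "J = {j. 1 \<le> j \<and> lamN j \<le> lam}"
  have M: "finite M" using finN by (simp add: M_def)
  \<comment> \<open>Here the negated claim enters: by monotonicity an index beyond \<open>n\<close>
    has a Neumann eigenvalue of at least \<open>lam\<close>, so if it belongs to \<open>J\<close>,
    its eigenvalue is exactly \<open>lam\<close>.\<close>
  have JM: "J \<subseteq> {1..n} \<union> M"
  proof
    fix j assume j: "j \<in> J"
    show "j \<in> {1..n} \<union> M"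
    proof (cases "j \<le> n")
      case False
      then have "lamN (n + 1) \<le> lamN j" using monoN by (intro mono_onD[OF monoN]) auto
      then show ?thesis using j neg by (auto simp: J_def M_def lam_def)
    qed (use j in \<open>auto simp: J_def\<close>)
  qed
  then have J: "finite J" using M finite_subset by blast
  have "card J \<le> card ({1..n} \<union> M)" using JM M by (intro card_mono) auto
  also have "\<dots> \<le> n + card M" using card_Un_le[of "{1..n}" M] by simp
  finally have cardJ: "card J < card {1..n} + card M + 1" by simp
  have "\<exists>mu\<le>lam. \<exists>u. cf.eigvec mu u \<and> Re (L2_inner \<Omega> u u) > 0 \<and> (\<forall>j\<in>J. L2_inner \<Omega> u (eN j) = 0)"
  proof (rule cf.trial_space_new_eigvec[where JD = "{1..n}" and tD = lamD and eD = eD and M = M and eN = eN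
        and f = "plane_wave w h" and f' = "plane_wave w' h'" and t = lamN])
    show "cf.eigen_family {1..n} lamD eD" "cf.independent_family {1..n} eD" by (intro indD; auto)+
    show "lamD j \<le> lam" if "j \<in> {1..n}" for j
      using that unfolding lam_def by (intro mono_onD[OF monoD]) auto
    show "cf.independent_family M eN" using M by (intro indN) (auto simp: M_def)
    show "cf.independent_family J eN" using J by (intro indN) (auto simp: J_def)
    show "cf.eigvec lam (eN j)" if "j \<in> M" for j
      using eN[of j] that by (auto simp: M_def cf.eigvec_def is_eigvec_def)
    show "cf.eigvec (lamN j) (eN j)" if "j \<in> J" for j
      using eN[of j] that by (auto simp: J_def cf.eigvec_def is_eigvec_def)
    show "plane_wave w h \<in> V_N \<Omega>" "plane_wave w' h' \<in> V_N \<Omega>" by (intro plane_wave_V_N O w)+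
    show "stokes_form \<Omega> (plane_wave w h) (plane_wave w h) - of_real lam * L2_inner \<Omega> (plane_wave w h) (plane_wave w h) = 0"
      using stokes_form_plane_waves(1)[OF O, of w h w h] w(3) by simp
    show "stokes_form \<Omega> (plane_wave w h) (plane_wave w' h') - of_real lam * L2_inner \<Omega> (plane_wave w h) (plane_wave w' h') \<noteq> 0"
      using ne by simp
    show "stokes_form \<Omega> (eD j) (plane_wave w h) - of_real lam * L2_inner \<Omega> (eD j) (plane_wave w h) = 0"
      "stokes_form \<Omega> (eD j) (plane_wave w' h') - of_real lam * L2_inner \<Omega> (eD j) (plane_wave w' h') = 0" if "j \<in> {1..n}" for j
      using that stokes_form_trace_free_plane_wave[OF O eDt[of j]] w(3,4) by simp_all
    \<comment> \<open>The combination is trace free by linearity and solves the Neumann equation for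
      \<open>lam\<close> by assumption, so it vanishes almost everywhere.\<close>
    show "Re (L2_inner \<Omega> (\<Sum>j\<in>{1..n}. vscale (c j) (eD j)) (\<Sum>j\<in>{1..n}. vscale (c j) (eD j))) = 0"
      if c: "\<forall>v\<in>V_N \<Omega>. stokes_form \<Omega> (\<Sum>j\<in>{1..n}. vscale (c j) (eD j)) v - of_real lam * L2_inner \<Omega> (\<Sum>j\<in>{1..n}. vscale (c j) (eD j)) v = 0" for c
    proof -
      define x where "x = (\<Sum>j\<in>{1..n}. vscale (c j) (eD j))"
      have x: "x \<in> V_N \<Omega>" unfolding x_def by (intro cf.ip.lincomb_mem eDV) auto
      have t: "trace_free \<Omega> x" unfolding x_def by (intro trace_free_sum O eDt) auto
      have "AE y in lebesgue_on \<Omega>. x y = 0"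
        by (rule trace_free_neumann_eigenfunction_eq_0[OF O t x, of lam]) (use c in \<open>simp add: x_def\<close>)
      then show ?thesis using null[OF x] unfolding x_def by blast
    qed
  qed (use M J cardJ in auto)
  then obtain mu u where mu: "mu \<le> lam" and u: "cf.eigvec mu u" "Re (L2_inner \<Omega> u u) > 0" "\<And>j. j \<in> J \<Longrightarrow> L2_inner \<Omega> u (eN j) = 0"
    by blast
  have uV: "u \<in> V_N \<Omega>" using u(1) by (simp add: cf.eigvec_def)
  \<comment> \<open>Since \<open>mu\<close> is at most \<open>lam\<close>, every index recorded for
    \<open>mu\<close> lies in \<open>J\<close>. So \<open>u\<close> is orthogonal to all these
    eigenvectors and would enlarge the eigenspace of \<open>mu\<close> by one dimension.\<close>
  define S where "S = {j. 1 \<le> j \<and> lamN j = mu}"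
  have S: "finite S" "S \<subseteq> J" using finN mu by (auto simp: S_def J_def)
  obtain p where p: "bij_betw p {..<card S} S"
    using ex_bij_betw_nat_finite[OF S(1)] by (auto simp: atLeast0LessThan)
  have pS: "p i \<in> S" if "i < card S" for i using bij_betwE[OF p] that by blast
  \<comment> \<open>The new eigenvector takes the last index \<open>card S\<close>. Pairing a
    vanishing combination with \<open>u\<close> removes its coefficient, and what remains is a
    relation among the recorded eigenvectors.\<close>
  define U where "U i = (if i < card S then eN (p i) else u)" for i
  have "indep_eigvecs \<Omega> (V_N \<Omega>) mu (Suc (card S))"
    unfolding indep_eigvecs_def
  proof (intro exI[of _ U] conjI allI impI)
    show "is_eigvec \<Omega> (V_N \<Omega>) mu (U i)" for i
    proof (cases "i < card S")
      case True
      then show ?thesis using eN[of "p i"] pS[OF True] by (simp add: U_def S_def)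
    next
      case False
      then show ?thesis using u(1) by (simp add: U_def is_eigvec_def cf.eigvec_def)
    qed
    fix c i assume z: "AE x in lebesgue_on \<Omega>. (\<Sum>i<Suc (card S). c i *s U i x) = 0" and i: "i < Suc (card S)"
    define k where "k = c (card S)"
    define y where "y = (\<Sum>i<card S. vscale (c i) (eN (p i)))"
    have pV: "eN (p i) \<in> V_N \<Omega>" if "i < card S" for i using pS[OF that] eNV by (simp add: S_def)
    have yV: "y \<in> V_N \<Omega>" unfolding y_def by (intro cf.ip.lincomb_mem pV) auto
    have kV: "vscale k u \<in> V_N \<Omega>" by (rule cf.ip.subspace_scale[OF cf.ip.subspace_S uV])
    have ykV: "y + vscale k u \<in> V_N \<Omega>" by (rule cf.ip.subspace_add[OF cf.ip.subspace_S yV kV])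
    have "(\<Sum>i<Suc (card S). c i *s U i x) = (y + vscale k u) x" for x
      by (simp add: y_def vscale_sum_apply U_def k_def)
    then have "AE x in lebesgue_on \<Omega>. (y + vscale k u) x = 0" using z by simp
    then have n0: "Re (L2_inner \<Omega> (y + vscale k u) (y + vscale k u)) = 0" using null[OF ykV] by blast
    have "L2_inner \<Omega> (eN (p i)) u = 0" if "i < card S" for i
      using cf.ip.form_cnj[OF uV pV[OF that]] u(3)[of "p i"] pS[OF that] S(2) by auto
    then have "L2_inner \<Omega> y u = 0"
      using cf.ip.form_lincomb[of "{..<card S}" "\<lambda>i. eN (p i)" u c] pV uV by (simp add: y_def)
    then have "L2_inner \<Omega> (y + vscale k u) u = k * L2_inner \<Omega> u u"
      using cf.ip.form_add[OF yV kV uV] cf.ip.form_scale[OF uV uV] by simp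
    moreover have "L2_inner \<Omega> (y + vscale k u) u = 0" by (rule cf.ip.form_eq_0_if_diag_eq_0[OF ykV uV n0])
    ultimately have k0: "k = 0" using u(2) by auto
    define q where "q = the_inv_into {..<card S} p"
    have q: "q (p i) = i" if "i < card S" for i
      unfolding q_def using p that by (intro the_inv_into_f_f) (auto simp: bij_betw_def)
    have "(\<Sum>j\<in>S. c (q j) *s eN j x) = (y + vscale k u) x" for x
    proof -
      have "(\<Sum>j\<in>S. c (q j) *s eN j x) = (\<Sum>i<card S. c (q (p i)) *s eN (p i) x)"
        using sum.reindex_bij_betw[OF p, of "\<lambda>j. c (q j) *s eN j x"] by simp
      also have "\<dots> = (\<Sum>i<card S. c i *s eN (p i) x)" by (intro sum.cong) (auto simp: q)
      finally show ?thesis by (simp add: y_def vscale_sum_apply k0)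
    qed
    then have z2: "AE x in lebesgue_on \<Omega>. (\<Sum>j\<in>{j. 1 \<le> j \<and> lamN j = mu}. c (q j) *s eN j x) = 0"
      using \<open>AE x in lebesgue_on \<Omega>. (y + vscale k u) x = 0\<close> by (simp add: S_def)
    show "c i = 0"
    proof (cases "i < card S")
      case True
      have "\<forall>j\<ge>1. lamN j = mu \<longrightarrow> c (q j) = 0" using z2 by (rule eNi[THEN spec, THEN spec, THEN mp])
      then have "c (q (p i)) = 0" using pS[OF True] by (simp add: S_def)
      then show ?thesis using q[OF True] by simp
    next
      case False
      then show ?thesis using i k0 by (simp add: k_def less_Suc_eq)
    qed
  qed
  then have "Suc (card S) \<le> card S" using cardN[of mu "Suc (card S)"] by (simp add: S_def)
  then show False by simp
qed

end
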